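(* Let $\mathbb{F}$ be an arbitrary field and let $E$ be the natural $2$-dimensional representation of $\mathrm{GL}_2(\mathbb{F})$. Let $M,d\in\mathbb{N}_0$ and $N\in\mathbb{N}$ (so $N\ge 1$) be such that $N\le d+1$. Then there is an isomorphism of $\mathrm{GL}_2(\mathbb{F})$-representations $$\det{}^{\binom{N}{2}}\otimes\mathrm{Sym}_{M}\mathrm{Sym}^{N-1}E\otimes\mathrm{Sym}_{M+N}\mathrm{Sym}^{d-N+1}E \;\cong\; \Delta^{(M+1,1^{N-1})}\mathrm{Sym}^{d}E,$$ where $\det^{\binom{N}{2}}$ is the $\binom{N}{2}$-th tensor power of the determinant representation of $\mathrm{GL}_2(\mathbb{F})$.
   Context: $\mathbb{N}_0 = \{0,1,2,\ldots\}$ and $\mathbb{N}=\{1,2,\ldots\}$. Upper symmetric powers: fixing a basis $X,Y$ of $E$, $\mathrm{Sym}^d E$ is the space of homogeneous polynomials of degree $d$ in $X,Y$ over $\mathbb{F}$, with basis $X^d, X^{d-1}Y,\ldots,Y^d$ and action of $\mathrm{GL}_2(\mathbb{F})$ given by $\begin{pmatrix}\alpha&\beta\\ \gamma&\delta\end{pmatrix}\cdot P(X,Y) = P(\alpha X+\gamma Y,\beta X+\delta Y)$. Lower symmetric powers: for a finite-dimensional vector space $V$ and $R\in\mathbb{N}_0$, $\mathrm{Sym}_R V = \{w\in V^{\otimes R} : \sigma\cdot w = w \text{ for all } \sigma\in\mathfrak{S}_R\}$, where the symmetric group $\mathfrak{S}_R$ acts by permuting tensor positions. Exterior powers: $\bigwedge^R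 V\subseteq V^{\otimes R}$ is the span of the elements $v_{1}\wedge\cdots\wedge v_{R} = \sum_{\sigma\in\mathfrak{S}_R}\mathrm{sgn}(\sigma)\,\sigma\cdot(v_1\otimes\cdots\otimes v_R)$. For $R=0$ both are $\mathbb{F}$. A group acting linearly on $V$ acts diagonally on $V^{\otimes R}$, and these are subrepresentations. Weyl functor for hook partitions: let $V$ have basis $v_0,\ldots,v_d$. For a tableau $t$ of hook shape $(M+1,1^{N-1})$ with entries in $\{0,\ldots,d\}$, with top row $a_0,a_1,\ldots,a_M$ and first column $a_0,b_1,\ldots,b_{N-1}$, define $$F_\Delta(t) = \sum (v_{c_0}\wedge v_{b_1}\wedge\cdots\wedge v_{b_{N-1}})\otimes v_{c_1}\otimes\cdots\otimes v_{c_M},$$ where the sum is over all distinct tuples $(c_0,c_1,\ldots,c_M)$ obtained by permuting $(a_0,a_1,\ldots,a_M)$. The Weyl module $\Delta^{(M+1,1^{N-1})}(V)$ is the $\mathrm{GL}(V)$-subrepresentation of $\bigwedge^N V\otimes V^{\otimes M}$ with basis all $F_\Delta(t)$ for $t$ a semistandard tableau (row weakly increasing, column strictly increasing) of shape $(M+1,1^{N-1})$ with entries in $\{0,\ldots,d\}$. $\Delta^{(M+1,1^{N-1})}\mathrm{Sym}^dE$ means this functor applied to $V=\mathrm{Sym}^dE$ (with basis $v_i = X^{d-i}Y^i$), with $\mathrm{GL}_2(\mathbb{F})$ acting through $\mathrm{Sym}^dE$. *)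

theory Defs
  imports
    "HOL-Analysis.Determinants"
    "HOL-Library.Poly_Mapping"
    "HOL-Library.Product_Plus"
    "HOL-Combinatorics.Multiset_Permutations"
    "HOL-Algebra.Group"
begin

section \<open>Vector spaces with a chosen basis\<close>

text \<open>
  The finitely supported functions \<open>'b \<Rightarrow>\<^sub>0 'f\<close> are the vector space with basis \<open>'b\<close>; all
  representations live on subspaces of such spaces. The tensor product of the spaces with bases
  \<open>'a\<close> and \<open>'b\<close> is then the space with basis \<open>'a \<times> 'b\<close>, and the tensor powers of the space
  with basis \<open>'b\<close> together form the space with basis \<open>'b list\<close>, the lists of length \<open>R\<close> being
  the basis of the \<open>R\<close>-th power.
\<close>

abbreviation "lookup \<equiv> Poly_Mapping.lookup"
abbreviation "keys \<equiv> Poly_Mapping.keys"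

definition cmul :: "'f::field \<Rightarrow> ('b \<Rightarrow>\<^sub>0 'f) \<Rightarrow> ('b \<Rightarrow>\<^sub>0 'f)" where
  "cmul c v = Poly_Mapping.map ((*) c) v"

lemma lookup_cmul [simp]: "lookup (cmul c v) b = c * lookup v b"
  by (auto simp: cmul_def Poly_Mapping.map.rep_eq when_def)

global_interpretation fspace: vector_space cmul
  by unfold_locales
    (auto intro!: poly_mapping_eqI simp: lookup_add algebra_simps)

lemma mult_if: "(a :: 'f::field) * (if P then b else 0) = (if P then a * b else 0)"
  "(if P then b else 0) * a = (if P then b * a else 0)"
  by simp_all

definition basis_vec :: "'b \<Rightarrow> ('b \<Rightarrow>\<^sub>0 'f::field)" where
  "basis_vec b = Poly_Mapping.single b 1"

text \<open>The unique linear map taking each basis vector \<open>b\<close> to \<open>h b\<close>:\<close>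

definition lin_ext :: "('a \<Rightarrow> ('b \<Rightarrow>\<^sub>0 'f::field)) \<Rightarrow> ('a \<Rightarrow>\<^sub>0 'f) \<Rightarrow> ('b \<Rightarrow>\<^sub>0 'f)" where
  "lin_ext h v = (\<Sum>a\<in>keys v. cmul (lookup v a) (h a))"

lemma lin_ext_superset:
  assumes "finite A" "keys v \<subseteq> A"
  shows "lin_ext h v = (\<Sum>a\<in>A. cmul (lookup v a) (h a))"
  unfolding lin_ext_def using assms
  by (intro sum.mono_neutral_left) (auto simp: in_keys_iff)

lemma lin_ext_basis_vec [simp]: "lin_ext h (basis_vec b) = h b"
  by (simp add: lin_ext_def basis_vec_def)

lemma lin_ext_linear: "Vector_Spaces.linear cmul cmul (lin_ext h)"
proof (unfold_locales)
  show "lin_ext h (v + w) = lin_ext h v + lin_ext h w" for v w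
    using keys_add[of v w]
    by (simp add: lin_ext_superset[of "keys v \<union> keys w"] lookup_add fspace.scale_left_distrib
        sum.distrib)
  show "lin_ext h (cmul c v) = cmul c (lin_ext h v)" for c v
  proof -
    have "keys (cmul c v) \<subseteq> keys v"
      by (auto simp: in_keys_iff)
    then show ?thesis
      by (simp add: lin_ext_superset[of "keys v"] fspace.scale_sum_right)
  qed
qed

lemma linear_eq_lin_ext:
  assumes "Vector_Spaces.linear cmul cmul f"
  shows "f v = lin_ext (\<lambda>b. f (basis_vec b)) v"
proof -
  interpret f: Vector_Spaces.linear cmul cmul f by fact
  have "v = (\<Sum>b\<in>keys v. cmul (lookup v b) (basis_vec b))"
    by (rule poly_mapping_eqI)
      (auto simp: lookup_sum basis_vec_def lookup_single when_def in_keys_iff mult_if)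
  then have "f v = f (\<Sum>b\<in>keys v. cmul (lookup v b) (basis_vec b))"
    by simp
  then show ?thesis
    by (simp add: f.sum f.scale lin_ext_def)
qed


section \<open>Tensors\<close>

definition tensor :: "('a \<Rightarrow>\<^sub>0 'f::field) \<Rightarrow> ('b \<Rightarrow>\<^sub>0 'f) \<Rightarrow> ('a \<times> 'b \<Rightarrow>\<^sub>0 'f)" where
  "tensor v w = lin_ext (\<lambda>a. lin_ext (\<lambda>b. basis_vec (a, b)) w) v"

definition tensor_map ::
  "(('a \<Rightarrow>\<^sub>0 'f::field) \<Rightarrow> ('c \<Rightarrow>\<^sub>0 'f)) \<Rightarrow> (('b \<Rightarrow>\<^sub>0 'f) \<Rightarrow> ('d \<Rightarrow>\<^sub>0 'f)) \<Rightarrow>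
   ('a \<times> 'b \<Rightarrow>\<^sub>0 'f) \<Rightarrow> ('c \<times> 'd \<Rightarrow>\<^sub>0 'f)" where
  "tensor_map f g = lin_ext (\<lambda>(a, b). tensor (f (basis_vec a)) (g (basis_vec b)))"

text \<open>\<open>tensor_list [v\<^sub>1, \<dots>, v\<^sub>R]\<close> is \<open>v\<^sub>1 \<otimes> \<dots> \<otimes> v\<^sub>R\<close>:\<close>

primrec tensor_list :: "('b \<Rightarrow>\<^sub>0 'f::field) list \<Rightarrow> ('b list \<Rightarrow>\<^sub>0 'f)" where
  "tensor_list [] = basis_vec []"
| "tensor_list (v # vs) = lin_ext (\<lambda>b. lin_ext (\<lambda>bs. basis_vec (b # bs)) (tensor_list vs)) v"

text \<open>The diagonal map \<open>v\<^sub>1 \<otimes> \<dots> \<otimes> v\<^sub>R \<mapsto> f v\<^sub>1 \<otimes> \<dots> \<otimes> f v\<^sub>R\<close>, in all degrees at once:\<close>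

definition tensor_list_map ::
  "(('a \<Rightarrow>\<^sub>0 'f::field) \<Rightarrow> ('b \<Rightarrow>\<^sub>0 'f)) \<Rightarrow> ('a list \<Rightarrow>\<^sub>0 'f) \<Rightarrow> ('b list \<Rightarrow>\<^sub>0 'f)" where
  "tensor_list_map f = lin_ext (\<lambda>as. tensor_list (map (\<lambda>a. f (basis_vec a)) as))"

text \<open>
  The place permutation moving the \<open>i\<close>-th tensor factor to position \<open>\<sigma> i\<close>. The inverse makes this
  a left action, since \<open>permute_list \<sigma> xs ! i = xs ! \<sigma> i\<close>.
\<close>

definition place_perm :: "(nat \<Rightarrow> nat) \<Rightarrow> ('b list \<Rightarrow>\<^sub>0 'f::field) \<Rightarrow> ('b list \<Rightarrow>\<^sub>0 'f)" where
  "place_perm \<sigma> = lin_ext (\<lambda>bs. basis_vec (permute_list (inv_into UNIV \<sigma>) bs))"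

definition wedge :: "('b \<Rightarrow>\<^sub>0 'f::field) list \<Rightarrow> ('b list \<Rightarrow>\<^sub>0 'f)" where
  "wedge vs =
     (\<Sum>\<sigma> | \<sigma> permutes {..<length vs}.
        cmul (of_int (sign \<sigma>)) (place_perm \<sigma> (tensor_list vs)))"

lemma lookup_lin_ext: "lookup (lin_ext h v) c = (\<Sum>a\<in>keys v. lookup v a * lookup (h a) c)"
  by (simp add: lin_ext_def lookup_sum)

lemma lookup_tensor: "lookup (tensor v w) (a, b) = lookup v a * lookup w b"
proof -
  have "lookup (lin_ext (\<lambda>b. basis_vec (a', b)) w) (a, b) = (if a' = a then lookup w b else 0)"
    for a'
    by (auto simp: lookup_lin_ext basis_vec_def lookup_single when_def in_keys_iff mult_if)
  then show ?thesis
    by (auto simp: tensor_def lookup_lin_ext in_keys_iff mult_if)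
qed

lemma lookup_tensor_list:
  fixes vs :: "('b \<Rightarrow>\<^sub>0 'f::field) list"
  shows "lookup (tensor_list vs) bs =
     (if length bs = length vs then \<Prod>i<length vs. lookup (vs ! i) (bs ! i) else 0)"
proof (induction vs arbitrary: bs)
  case Nil
  then show ?case
    by (simp add: basis_vec_def lookup_single when_def)
next
  case (Cons v vs)
  have inner: "lookup (lin_ext (\<lambda>bs. basis_vec (b # bs)) w) (c # cs) =
      (if b = c then lookup w cs else 0)" for b c cs and w :: "'b list \<Rightarrow>\<^sub>0 'f"
    by (auto simp: lookup_lin_ext basis_vec_def lookup_single when_def in_keys_iff mult_if)
  show ?case
  proof (cases bs)
    case Nil
    then show ?thesis
      by (simp add: lookup_lin_ext basis_vec_def lookup_single)
  next
    case (Cons c cs)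
    have "lookup (tensor_list (v # vs)) bs = lookup v c * lookup (tensor_list vs) cs"
      by (auto simp: Cons lookup_lin_ext[of _ v] inner in_keys_iff mult_if)
    then show ?thesis
      by (simp add: Cons Cons.IH prod.lessThan_Suc_shift del: tensor_list.simps prod.lessThan_Suc)
  qed
qed

lemma lookup_tensor_list_Cons:
  "lookup (tensor_list (v # vs)) [] = 0"
  "lookup (tensor_list (v # vs)) (b # bs) = lookup v b * lookup (tensor_list vs) bs"
  by (simp_all add: lookup_tensor_list prod.lessThan_Suc_shift
      del: tensor_list.simps prod.lessThan_Suc)

lemma tensor_map_tensor:
  assumes "Vector_Spaces.linear cmul cmul f" "Vector_Spaces.linear cmul cmul g"
  shows "tensor_map f g (tensor v w) = tensor (f v) (g w)"
proof (rule poly_mapping_eqI)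
  fix k :: "'c \<times> 'e"
  obtain c d where k: "k = (c, d)" by force
  have keys: "keys (tensor v w) \<subseteq> keys v \<times> keys w"
    by (auto simp: in_keys_iff lookup_tensor)
  have "lookup (tensor_map f g (tensor v w)) k =
    (\<Sum>(a, b)\<in>keys v \<times> keys w. (lookup v a * lookup (f (basis_vec a)) c) *
       (lookup w b * lookup (g (basis_vec b)) d))"
    by (auto simp: tensor_map_def lin_ext_superset[OF _ keys] lookup_sum k lookup_tensor
        mult_ac intro!: sum.cong)
  also have "\<dots> = lookup (f v) c * lookup (g w) d"
    by (simp add: sum_product sum.cartesian_product lookup_lin_ext
        linear_eq_lin_ext[OF assms(1), of v] linear_eq_lin_ext[OF assms(2), of w])
  finally show "lookup (tensor_map f g (tensor v w)) k = lookup (tensor (f v) (g w)) k"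
    by (simp add: k lookup_tensor)
qed

lemma tensor_list_map_tensor_list:
  fixes f :: "('a \<Rightarrow>\<^sub>0 'f::field) \<Rightarrow> ('b \<Rightarrow>\<^sub>0 'f)"
  assumes f: "Vector_Spaces.linear cmul cmul f"
  shows "tensor_list_map f (tensor_list vs) = tensor_list (map f vs)"
proof (induction vs)
  case Nil
  then show ?case
    by (simp add: tensor_list_map_def)
next
  case (Cons v vs)
  let ?W = "tensor_list vs"
  let ?K = "(\<lambda>(a, as). a # as) ` (keys v \<times> keys ?W)"
  have keys: "keys (tensor_list (v # vs)) \<subseteq> ?K"
  proof
    fix bs assume "bs \<in> keys (tensor_list (v # vs))"
    then show "bs \<in> ?K"
      by (cases bs) (auto simp: in_keys_iff lookup_tensor_list_Cons simp del: tensor_list.simps)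
  qed
  show ?case
  proof (rule poly_mapping_eqI)
    fix bs
    have "lookup (tensor_list_map f (tensor_list (v # vs))) bs =
        (\<Sum>(a, as)\<in>keys v \<times> keys ?W. lookup v a * lookup ?W as *
           lookup (tensor_list (f (basis_vec a) # map (\<lambda>a. f (basis_vec a)) as)) bs)"
      by (simp add: tensor_list_map_def lin_ext_superset[OF _ keys] lookup_sum sum.reindex
          inj_on_def case_prod_unfold lookup_tensor_list_Cons del: tensor_list.simps)
    also have "\<dots> = lookup (tensor_list (f v # map f vs)) bs"
    proof (cases bs)
      case Nil
      then show ?thesis
        by (simp add: lookup_tensor_list_Cons del: tensor_list.simps)
    next
      case (Cons c cs)
      have "lookup (tensor_list (map f vs)) cs =
          (\<Sum>as\<in>keys ?W. lookup ?W as * lookup (tensor_list (map (\<lambda>a. f (basis_vec a)) as)) cs)"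
        by (simp add: Cons.IH[symmetric] tensor_list_map_def lookup_lin_ext)
      then show ?thesis
        by (simp add: Cons lookup_tensor_list_Cons linear_eq_lin_ext[OF f, of v] lookup_lin_ext sum_product
            sum.cartesian_product mult_ac del: tensor_list.simps)
    qed
    finally show "lookup (tensor_list_map f (tensor_list (v # vs))) bs =
        lookup (tensor_list (map f (v # vs))) bs"
      by (simp del: tensor_list.simps)
  qed
qed


section \<open>Representations\<close>

text \<open>
  The group acts by maps of the whole ambient space, of which the representation is the restriction
  to the subspace \<open>vecs\<close>. The tensor constructions evaluate these maps on basis vectors, which need
  not lie in \<open>vecs\<close>; they give the diagonal action because all the maps used below are linear on
  the ambient space (see \<open>tensor_map_tensor\<close> and \<open>tensor_list_map_tensor_list\<close>).
\<close>

record ('g, 'v) rep =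
  vecs :: "'v set"
  act :: "'g \<Rightarrow> 'v \<Rightarrow> 'v"

definition linear_on_vecs ::
  "('a \<Rightarrow>\<^sub>0 'f::field) set \<Rightarrow> (('a \<Rightarrow>\<^sub>0 'f) \<Rightarrow> ('b \<Rightarrow>\<^sub>0 'f)) \<Rightarrow> bool" where
  "linear_on_vecs V f \<longleftrightarrow>
     (\<forall>v\<in>V. \<forall>w\<in>V. f (v + w) = f v + f w) \<and> (\<forall>c. \<forall>v\<in>V. f (cmul c v) = cmul c (f v))"

definition representation :: "'g monoid \<Rightarrow> ('g, 'b \<Rightarrow>\<^sub>0 'f::field) rep \<Rightarrow> bool" where
  "representation G V \<longleftrightarrow>
     fspace.subspace (vecs V) \<and>
     (\<forall>g\<in>carrier G. linear_on_vecs (vecs V) (act V g) \<and> act V g ` vecs V \<subseteq> vecs V) \<and>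
     (\<forall>v\<in>vecs V. act V \<one>\<^bsub>G\<^esub> v = v) \<and>
     (\<forall>g\<in>carrier G. \<forall>h\<in>carrier G. \<forall>v\<in>vecs V. act V (g \<otimes>\<^bsub>G\<^esub> h) v = act V g (act V h v))"

definition rep_isomorphic ::
  "'g monoid \<Rightarrow> ('g, 'a \<Rightarrow>\<^sub>0 'f::field) rep \<Rightarrow> ('g, 'b \<Rightarrow>\<^sub>0 'f) rep \<Rightarrow> bool" where
  "rep_isomorphic G V W \<longleftrightarrow>
     representation G V \<and> representation G W \<and>
     (\<exists>\<phi>. linear_on_vecs (vecs V) \<phi> \<and> bij_betw \<phi> (vecs V) (vecs W) \<and>
        (\<forall>g\<in>carrier G. \<forall>v\<in>vecs V. \<phi> (act V g v) = act W g (\<phi> v)))"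

definition tensor_rep ::
  "('g, 'a \<Rightarrow>\<^sub>0 'f::field) rep \<Rightarrow> ('g, 'b \<Rightarrow>\<^sub>0 'f) rep \<Rightarrow> ('g, 'a \<times> 'b \<Rightarrow>\<^sub>0 'f) rep" where
  "tensor_rep V W =
     \<lparr>vecs = fspace.span {tensor v w | v w. v \<in> vecs V \<and> w \<in> vecs W},
      act = (\<lambda>g. tensor_map (act V g) (act W g))\<rparr>"

definition tensor_power :: "nat \<Rightarrow> ('g, 'b \<Rightarrow>\<^sub>0 'f::field) rep \<Rightarrow> ('g, 'b list \<Rightarrow>\<^sub>0 'f) rep" where
  "tensor_power R V =
     \<lparr>vecs = fspace.span {tensor_list vs | vs. length vs = R \<and> set vs \<subseteq> vecs V},
      act = (\<lambda>g. tensor_list_map (act V g))\<rparr>"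

definition lower_sym :: "nat \<Rightarrow> ('g, 'b \<Rightarrow>\<^sub>0 'f::field) rep \<Rightarrow> ('g, 'b list \<Rightarrow>\<^sub>0 'f) rep" where
  "lower_sym R V =
     \<lparr>vecs = {w \<in> vecs (tensor_power R V). \<forall>\<sigma>. \<sigma> permutes {..<R} \<longrightarrow> place_perm \<sigma> w = w},
      act = act (tensor_power R V)\<rparr>"

definition ext_power :: "nat \<Rightarrow> ('g, 'b \<Rightarrow>\<^sub>0 'f::field) rep \<Rightarrow> ('g, 'b list \<Rightarrow>\<^sub>0 'f) rep" where
  "ext_power R V =
     \<lparr>vecs = fspace.span {wedge vs | vs. length vs = R \<and> set vs \<subseteq> vecs V},
      act = act (tensor_power R V)\<rparr>"


section \<open>Weyl modules for hook partitions\<close>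

text \<open>
  A tableau of shape \<open>(M + 1, 1\<^bsup>N - 1\<^esup>)\<close> with entries in \<open>{0..d}\<close> is a pair \<open>(as, bs)\<close>: the top
  row \<open>as = [a\<^sub>0, \<dots>, a\<^sub>M]\<close> and the part \<open>bs = [b\<^sub>1, \<dots>, b\<^sub>N\<^sub>-\<^sub>1]\<close> of the first column below \<open>a\<^sub>0\<close>.
\<close>

definition hook_ssyt :: "nat \<Rightarrow> nat \<Rightarrow> nat \<Rightarrow> (nat list \<times> nat list) set" where
  "hook_ssyt M N d =
     {(as, bs). length as = M + 1 \<and> length bs = N - 1 \<and> set as \<subseteq> {0..d} \<and> set bs \<subseteq> {0..d} \<and>
        sorted as \<and> sorted_wrt (<) (hd as # bs)}"

definition F_Delta ::
  "(nat \<Rightarrow> ('b \<Rightarrow>\<^sub>0 'f::field)) \<Rightarrow> nat list \<times> nat list \<Rightarrow> ('b list \<times> 'b list \<Rightarrow>\<^sub>0 'f)" where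
  "F_Delta v = (\<lambda>(as, bs).
     \<Sum>cs\<in>permutations_of_multiset (mset as).
       tensor (wedge (map v (hd cs # bs))) (tensor_list (map v (tl cs))))"

text \<open>Here \<open>v 0, \<dots>, v d\<close> is a basis of \<open>V\<close>, and \<open>N \<ge> 1\<close>:\<close>

definition hook_weyl ::
  "nat \<Rightarrow> nat \<Rightarrow> nat \<Rightarrow> (nat \<Rightarrow> ('b \<Rightarrow>\<^sub>0 'f::field)) \<Rightarrow> ('g, 'b \<Rightarrow>\<^sub>0 'f) rep \<Rightarrow>
   ('g, 'b list \<times> 'b list \<Rightarrow>\<^sub>0 'f) rep" where
  "hook_weyl M N d v V =
     \<lparr>vecs = fspace.span (F_Delta v ` hook_ssyt M N d),
      act = act (tensor_rep (ext_power N V) (tensor_power M V))\<rparr>"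


section \<open>Representations of the general linear group of degree two\<close>

definition GL2 :: "('f::field ^ 2 ^ 2) monoid" where
  "GL2 = \<lparr>carrier = {A. invertible A}, mult = (**), one = mat 1\<rparr>"

definition det_rep :: "('f::field ^ 2 ^ 2, unit \<Rightarrow>\<^sub>0 'f) rep" where
  "det_rep = \<lparr>vecs = UNIV, act = (\<lambda>g. cmul (det g))\<rparr>"

text \<open>
  The polynomial ring in \<open>X\<close>, \<open>Y\<close> is \<open>nat \<times> nat \<Rightarrow>\<^sub>0 'f\<close> with the ring structure of the library:
  the basis vector \<open>(i, j)\<close> is the monomial \<open>X\<^sup>i Y\<^sup>j\<close>.
\<close>

definition pX :: "nat \<times> nat \<Rightarrow>\<^sub>0 'f::field" where "pX = basis_vec (1, 0)"
definition pY :: "nat \<times> nat \<Rightarrow>\<^sub>0 'f::field" where "pY = basis_vec (0, 1)"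

text \<open>\<open>subst2 P Q\<close> is the substitution \<open>X \<mapsto> P\<close>, \<open>Y \<mapsto> Q\<close>:\<close>

definition subst2 ::
  "(nat \<times> nat \<Rightarrow>\<^sub>0 'f::field) \<Rightarrow> (nat \<times> nat \<Rightarrow>\<^sub>0 'f) \<Rightarrow> (nat \<times> nat \<Rightarrow>\<^sub>0 'f) \<Rightarrow> (nat \<times> nat \<Rightarrow>\<^sub>0 'f)"
  where "subst2 P Q = lin_ext (\<lambda>(i, j). P ^ i * Q ^ j)"

definition upper_sym :: "nat \<Rightarrow> ('f::field ^ 2 ^ 2, nat \<times> nat \<Rightarrow>\<^sub>0 'f) rep" where
  "upper_sym d =
     \<lparr>vecs = {p. \<forall>(i, j)\<in>keys p. i + j = d},
      act = (\<lambda>g. subst2 (cmul (g $ 1 $ 1) pX + cmul (g $ 2 $ 1) pY)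
                        (cmul (g $ 1 $ 2) pX + cmul (g $ 2 $ 2) pY))\<rparr>"

definition hook_weyl_upper_sym ::
  "nat \<Rightarrow> nat \<Rightarrow> nat \<Rightarrow> ('f::field ^ 2 ^ 2, (nat \<times> nat) list \<times> (nat \<times> nat) list \<Rightarrow>\<^sub>0 'f) rep" where
  "hook_weyl_upper_sym M N d = hook_weyl M N d (\<lambda>i. pX ^ (d - i) * pY ^ i) (upper_sym d)"

end

theory Submission
  imports Defs "HOL-Computational_Algebra.Polynomial_Factorial"
begin

text \<open>
  Regard the tensors as polynomials in the points \<open>z\<^sub>1, \<dots>, z\<^sub>N, w\<^sub>1, \<dots>, w\<^sub>M\<close> of the affine line. The
  isomorphism takes \<open>p \<otimes> h\<close> to \<open>V(z) p(w) h(z, w)\<close>, where \<open>V\<close> is the Vandermonde determinant; it is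
  equivariant since \<open>g\<close> multiplies \<open>V\<close> by \<open>det g ^ (N choose 2)\<close>. The image is the antisymmetrization over
  \<open>z\<^sub>1, \<dots>, z\<^sub>N\<close> of an element whose antisymmetrization over \<open>z\<^sub>1, \<dots>, z\<^sub>N, w\<^sub>1\<close> vanishes, because
  \<open>p\<close> has degree less than \<open>N\<close> in \<open>w\<^sub>1\<close>. The same holds for \<open>F\<^sub>\<Delta>(t)\<close>, and the exchange relation
  that follows determines such an element by its coefficients at the semistandard positions, where
  the \<open>F\<^sub>\<Delta>(t)\<close> have the coefficients \<open>0\<close> and \<open>1\<close>. So the image lies in the Weyl module. The map
  is injective since a polynomial \<open>p\<close> as above is determined by its values at the tuples of distinct
  elements of a set of \<open>N + M\<close> points, and it is onto since both sides have dimension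
  \<open>(M + N - 1 choose M) * (d + M + 1 choose M + N)\<close>.
\<close>

section \<open>Antisymmetrization\<close>

text \<open>The field may be finite and may have characteristic two. So signed sums are cancelled in
  pairs instead of being divided by two, and the points are taken in an infinite extension, a field
  of rational functions, because over a finite field distinct polynomials can have the same values.
  Points carry homogeneous coordinates, since a matrix can send a point of the affine line to
  infinity; equivariance is tested at points for which this does not happen. Where two of the z's
  coincide the factor V vanishes and the value of the image says nothing about p and h, which is why
  injectivity has to be settled with tuples of distinct points. The exponent (N choose 2) counts the
  pairs of z's. For the dimensions one inequality on each side is enough: the number of tableaux
  bounds the Weyl module from above, and the independent images of orbit sums bound it from below.
  The Weyl module is given as a span only; its stability under the group is transported along the
  map, once that is known to be onto.\<close>

lemma sum_sign_permutes_eq_0: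
  fixes h :: "('a \<Rightarrow> 'a) \<Rightarrow> 'f::comm_ring_1"
  assumes S: "finite S" "a \<in> S" "b \<in> S" "a \<noteq> b"
    and h: "(\<forall>\<sigma>. \<sigma> permutes S \<longrightarrow> h (Transposition.transpose a b \<circ> \<sigma>) = h \<sigma>) \<or>
            (\<forall>\<sigma>. \<sigma> permutes S \<longrightarrow> h (\<sigma> \<circ> Transposition.transpose a b) = h \<sigma>)"
  shows "(\<Sum>\<sigma> | \<sigma> permutes S. of_int (sign \<sigma>) * h \<sigma>) = 0"
proof -
  let ?t = "Transposition.transpose a b"
  let ?E = "{\<sigma>. \<sigma> permutes S \<and> evenperm \<sigma>}" and ?O = "{\<sigma>. \<sigma> permutes S \<and> \<not> evenperm \<sigma>}"
  have fin: "finite ?E" "finite ?O"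
    using finite_permutations[OF S(1)] by auto
  have t: "?t permutes S" "permutation ?t" "\<not> evenperm ?t"
    using S by (auto intro: permutes_swap_id permutation_swap_id simp: evenperm_swap)
  have perm: "permutation \<sigma>" if "\<sigma> permutes S" for \<sigma>
    using that S(1) by (rule permutes_imp_permutation[rotated])
  \<comment> \<open>Left or right multiplication by the transposition is an involution that
    exchanges even and odd permutations, so the two halves of the sum cancel in every
    characteristic.\<close>
  obtain r where r: "\<And>\<sigma>. \<sigma> permutes S \<Longrightarrow> h (r \<sigma>) = h \<sigma>"
    "\<And>\<sigma>. \<sigma> permutes S \<Longrightarrow> r \<sigma> permutes S \<and> evenperm (r \<sigma>) = (\<not> evenperm \<sigma>)"
    "\<And>\<sigma>. r (r \<sigma>) = \<sigma>"
  proof -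
    from h show ?thesis
    proof
      assume "\<forall>\<sigma>. \<sigma> permutes S \<longrightarrow> h (?t \<circ> \<sigma>) = h \<sigma>"
      then show ?thesis
        using t perm
        by (intro that[of "\<lambda>\<sigma>. ?t \<circ> \<sigma>"]) (auto simp: evenperm_comp permutes_compose fun_eq_iff)
    next
      assume "\<forall>\<sigma>. \<sigma> permutes S \<longrightarrow> h (\<sigma> \<circ> ?t) = h \<sigma>"
      then show ?thesis
        using t perm
        by (intro that[of "\<lambda>\<sigma>. \<sigma> \<circ> ?t"]) (auto simp: evenperm_comp permutes_compose fun_eq_iff)
    qed
  qed
  have "sum h ?O = sum h ?E"
    by (rule sum.reindex_bij_witness[of _ r r]) (use r in auto)
  moreover have "(\<Sum>\<sigma> | \<sigma> permutes S. of_int (sign \<sigma>) * h \<sigma>) =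
      (\<Sum>\<sigma>\<in>?E. of_int (sign \<sigma>) * h \<sigma>) + (\<Sum>\<sigma>\<in>?O. of_int (sign \<sigma>) * h \<sigma>)"
  proof -
    have "{\<sigma>. \<sigma> permutes S} = ?E \<union> ?O" "?E \<inter> ?O = {}"
      by auto
    then show ?thesis
      using fin by (simp only: sum.union_disjoint)
  qed
  moreover have "(\<Sum>\<sigma>\<in>?E. of_int (sign \<sigma>) * h \<sigma>) = sum h ?E"
    by (intro sum.cong) (auto simp: sign_def)
  moreover have "(\<Sum>\<sigma>\<in>?O. of_int (sign \<sigma>) * h \<sigma>) = - sum h ?O"
    by (simp add: sign_def flip: sum_negf)
  ultimately show ?thesis
    by simp
qed

text \<open>Acts on coefficient functions and has the number of places as a parameter, because the
  same function is alternated over \<open>N\<close> places and over \<open>N + 1\<close>.\<close>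

definition alternate :: "nat \<Rightarrow> ('b list \<Rightarrow> 'f::comm_ring_1) \<Rightarrow> 'b list \<Rightarrow> 'f" where
  "alternate n f xs = (\<Sum>\<sigma> | \<sigma> permutes {..<n}. of_int (sign \<sigma>) * f (permute_list \<sigma> xs))"

lemma permutes_lessThan_mono: "\<sigma> permutes {..<n} \<Longrightarrow> n \<le> m \<Longrightarrow> \<sigma> permutes {..<m::nat}"
  by (erule permutes_subset) auto

lemma alternate_permute_list:
  assumes \<tau>: "\<tau> permutes {..<n}" and n: "n \<le> length xs"
  shows "alternate n f (permute_list \<tau> xs) = of_int (sign \<tau>) * alternate n f xs"
proof -
  let ?P = "{\<sigma>. \<sigma> permutes {..<n}}"
  have "alternate n f xs =
      (\<Sum>\<sigma>\<in>?P. of_int (sign (\<tau> \<circ> \<sigma>)) * f (permute_list (\<tau> \<circ> \<sigma>) xs))"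
    unfolding alternate_def by (rule setum_permutations_compose_left[OF \<tau>])
  also have "\<dots> = (\<Sum>\<sigma>\<in>?P. of_int (sign \<tau>) * (of_int (sign \<sigma>) * f (permute_list \<sigma> (permute_list \<tau> xs))))"
  proof (rule sum.cong)
    fix \<sigma> assume "\<sigma> \<in> ?P"
    then have \<sigma>: "\<sigma> permutes {..<n}" "\<sigma> permutes {..<length xs}"
      using n permutes_lessThan_mono[of \<sigma> n "length xs"] by simp_all
    show "of_int (sign (\<tau> \<circ> \<sigma>)) * f (permute_list (\<tau> \<circ> \<sigma>) xs) =
        of_int (sign \<tau>) * (of_int (sign \<sigma>) * f (permute_list \<sigma> (permute_list \<tau> xs)))"
      using permutes_imp_permutation[OF _ \<tau>] permutes_imp_permutation[OF _ \<sigma>(1)]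
      by (simp add: permute_list_compose[OF \<sigma>(2)] sign_compose mult.assoc)
  qed simp
  also have "\<dots> = of_int (sign \<tau>) * alternate n f (permute_list \<tau> xs)"
    by (simp add: alternate_def sum_distrib_left)
  finally have "of_int (sign \<tau>) * alternate n f xs =
      of_int (sign \<tau> * sign \<tau>) * alternate n f (permute_list \<tau> xs)"
    by (simp only: of_int_mult mult.assoc)
  then show ?thesis
    by simp
qed

lemma permute_list_transpose_same:
  assumes "a < length xs" "b < length xs" "xs ! a = xs ! b"
  shows "permute_list (Transposition.transpose a b) xs = xs"
  using assms by (intro nth_equalityI) (auto simp: permute_list_def Transposition.transpose_def)

lemma alternate_eq_0_if_repeated:
  assumes n: "n \<le> length xs" and ab: "a < n" "b < n" "a \<noteq> b" "xs ! a = xs ! b"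
  shows "alternate n f xs = 0"
  unfolding alternate_def
proof (rule sum_sign_permutes_eq_0[of _ a b], goal_cases)
  case 5
  have "permute_list (Transposition.transpose a b \<circ> \<sigma>) xs = permute_list \<sigma> xs" if "\<sigma> permutes {..<n}" for \<sigma>
    using n ab permutes_lessThan_mono[OF that n]
    by (simp add: permute_list_compose permute_list_transpose_same)
  then show ?case
    by simp
qed (use ab in auto)

text \<open>Pairs \<open>\<sigma>\<close> with its product by the transposition on the right, which
  swaps two places after \<open>\<sigma>\<close> has acted. For a repeated entry the product is
  taken on the left, where the swap acts on the list itself.\<close>

lemma alternate_eq_0_if_symmetric:
  assumes n: "n \<le> length xs" and ab: "a < n" "b < n" "a \<noteq> b"
    and f: "\<And>ys. length ys = length xs \<Longrightarrow> f (permute_list (Transposition.transpose a b) ys) = f ys"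
  shows "alternate n f xs = 0"
  unfolding alternate_def
proof (rule sum_sign_permutes_eq_0[of _ a b], goal_cases)
  case 5
  have "Transposition.transpose a b permutes {..<length xs}"
    using n ab by (intro permutes_swap_id) auto
  then have "f (permute_list (\<sigma> \<circ> Transposition.transpose a b) xs) = f (permute_list \<sigma> xs)" for \<sigma>
    by (simp add: permute_list_compose f)
  then show ?case
    by simp
qed (use ab in auto)

lemma lessThan_not_self: "n \<notin> {..<n::nat}"
  by simp

text \<open>The transpositions of \<open>n\<close> with \<open>k\<close>, and the identity for
  \<open>k = n\<close>, represent the cosets of the permutations of \<open>n\<close> places among
  those of \<open>n + 1\<close>; the proper ones have sign -1. This is the origin of the exchange
  relation.\<close>

lemma alternate_Suc:
  assumes n: "Suc n \<le> length xs"
  shows "alternate (Suc n) f xs =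
    alternate n f xs - (\<Sum>k<n. alternate n f (permute_list (Transposition.transpose n k) xs))"
proof -
  let ?P = "{\<sigma>. \<sigma> permutes {..<n}}"
  have *: "(\<Sum>\<sigma>\<in>?P. of_int (sign (Transposition.transpose n k \<circ> \<sigma>)) * f (permute_list (Transposition.transpose n k \<circ> \<sigma>) xs)) =
      of_int (sign (Transposition.transpose n k)) * alternate n f (permute_list (Transposition.transpose n k) xs)" for k
    unfolding alternate_def sum_distrib_left
  proof (rule sum.cong[OF refl])
    fix \<sigma> assume "\<sigma> \<in> ?P"
    then have \<sigma>: "\<sigma> permutes {..<n}" "\<sigma> permutes {..<length xs}"
      using n permutes_lessThan_mono[of \<sigma> n "length xs"] by simp_all
    show "of_int (sign (Transposition.transpose n k \<circ> \<sigma>)) * f (permute_list (Transposition.transpose n k \<circ> \<sigma>) xs) =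
        of_int (sign (Transposition.transpose n k)) *
          (of_int (sign \<sigma>) * f (permute_list \<sigma> (permute_list (Transposition.transpose n k) xs)))"
      using permutes_imp_permutation[OF _ \<sigma>(1)] permutation_swap_id[of n k]
      by (simp add: permute_list_compose[OF \<sigma>(2)] sign_compose mult.assoc)
  qed
  have "alternate (Suc n) f xs =
      (\<Sum>k\<in>insert n {..<n}. of_int (sign (Transposition.transpose n k)) * alternate n f (permute_list (Transposition.transpose n k) xs))"
    using sum_over_permutations_insert[OF finite_lessThan lessThan_not_self,
        of "\<lambda>\<sigma>. of_int (sign \<sigma>) * f (permute_list \<sigma> xs)" n]
    by (simp only: * alternate_def[of "Suc n"] lessThan_Suc)
  also have "\<dots> = alternate n f xs - (\<Sum>k<n. alternate n f (permute_list (Transposition.transpose n k) xs))"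
  proof -
    have "(\<Sum>k<n. of_int (sign (Transposition.transpose n k)) * alternate n f (permute_list (Transposition.transpose n k) xs)) =
        (\<Sum>k<n. - alternate n f (permute_list (Transposition.transpose n k) xs))"
      by (intro sum.cong) (auto simp: sign_swap_id)
    then show ?thesis
      by (simp add: sum_negf)
  qed
  finally show ?thesis .
qed

section \<open>Antisymmetrized tensors and their coefficients\<close>

lemma keys_lin_ext:
  assumes "l \<in> keys (lin_ext h u)"
  obtains a where "a \<in> keys u" "l \<in> keys (h a)"
proof -
  have "\<exists>a\<in>keys u. lookup u a * lookup (h a) l \<noteq> 0"
  proof (rule ccontr)
    assume "\<not> ?thesis"
    then have "lookup (lin_ext h u) l = 0"
      unfolding lookup_lin_ext by (intro sum.neutral) blast
    with assms show False
      by (simp add: in_keys_iff)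
  qed
  with that show ?thesis
    by (auto simp: in_keys_iff)
qed

lemma keys_basis_vec: "keys (basis_vec b :: _ \<Rightarrow>\<^sub>0 'f::field) = {b}"
  by (simp add: basis_vec_def)

text \<open>Extends \<open>wedge\<close> from pure tensors to a linear map that leaves all places
  from \<open>n\<close> on alone, so that the exterior factor and the row can share one list of
  length \<open>N + M\<close>.\<close>

definition antisymmetrize :: "nat \<Rightarrow> ('b list \<Rightarrow>\<^sub>0 'f::field) \<Rightarrow> ('b list \<Rightarrow>\<^sub>0 'f)" where
  "antisymmetrize n u = (\<Sum>\<sigma> | \<sigma> permutes {..<n}. cmul (of_int (sign \<sigma>)) (place_perm \<sigma> u))"

lemma lookup_lin_ext_basis_vec:
  "lookup (lin_ext (\<lambda>a. basis_vec (f a)) u) b = (\<Sum>a\<in>keys u. if f a = b then lookup u a else 0)"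
  by (auto simp: lookup_lin_ext basis_vec_def lookup_single when_def intro!: sum.cong)

lemma lookup_lin_ext_inj:
  assumes "f a = b" "\<And>a'. a' \<in> keys u \<Longrightarrow> f a' = b \<Longrightarrow> a' = a"
  shows "lookup (lin_ext (\<lambda>a. basis_vec (f a)) u) b = lookup u a"
proof -
  have "lookup (lin_ext (\<lambda>a. basis_vec (f a)) u) b = (\<Sum>a'\<in>keys u. if a' = a then lookup u a' else 0)"
    unfolding lookup_lin_ext_basis_vec by (rule sum.cong) (use assms in blast, metis assms)
  then show ?thesis
    by (auto simp: in_keys_iff)
qed

lemma permute_list_inv:
  assumes \<sigma>: "\<sigma> permutes {..<length l}"
  shows "permute_list \<sigma> (permute_list (inv_into UNIV \<sigma>) l) = l"
    and "permute_list (inv_into UNIV \<sigma>) (permute_list \<sigma> l) = l"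
proof -
  have "permute_list \<sigma> (permute_list (inv_into UNIV \<sigma>) l) = permute_list (inv_into UNIV \<sigma> \<circ> \<sigma>) l"
    by (rule permute_list_compose[OF \<sigma>, symmetric])
  then show "permute_list \<sigma> (permute_list (inv_into UNIV \<sigma>) l) = l"
    by (simp only: permutes_inv_o[OF \<sigma>] permute_list_id)
  have "permute_list (inv_into UNIV \<sigma>) (permute_list \<sigma> l) = permute_list (\<sigma> \<circ> inv_into UNIV \<sigma>) l"
    by (rule permute_list_compose[OF permutes_inv[OF \<sigma>], symmetric])
  then show "permute_list (inv_into UNIV \<sigma>) (permute_list \<sigma> l) = l"
    by (simp only: permutes_inv_o[OF \<sigma>] permute_list_id)
qed

text \<open>\<open>place_perm\<close> moves lists by the inverse, so reading off a coefficient
  brings back \<open>\<sigma>\<close> itself.\<close>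

lemma lookup_place_perm:
  assumes "\<sigma> permutes {..<length xs}"
  shows "lookup (place_perm \<sigma> u) xs = lookup u (permute_list \<sigma> xs)"
  unfolding place_perm_def
proof (rule lookup_lin_ext_inj)
  show "permute_list (inv_into UNIV \<sigma>) (permute_list \<sigma> xs) = xs"
    using assms by (rule permute_list_inv)
  show "a = permute_list \<sigma> xs" if "permute_list (inv_into UNIV \<sigma>) a = xs" for a
    using that permute_list_inv(1)[of \<sigma> a] assms by auto
qed

lemma lookup_antisymmetrize:
  assumes "n \<le> length xs"
  shows "lookup (antisymmetrize n u) xs = alternate n (lookup u) xs"
  unfolding antisymmetrize_def alternate_def lookup_sum
  using assms by (intro sum.cong) (simp_all add: lookup_place_perm[OF permutes_lessThan_mono])

lemma keys_antisymmetrize: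
  assumes l: "l \<in> keys (antisymmetrize n u)"
  obtains l' \<tau> where "l' \<in> keys u" "\<tau> permutes {..<n}" "l = permute_list \<tau> l'"
proof -
  have "\<exists>\<sigma>. \<sigma> permutes {..<n} \<and> lookup (place_perm \<sigma> u) l \<noteq> 0"
  proof (rule ccontr)
    assume "\<not> ?thesis"
    then have "lookup (antisymmetrize n u) l = 0"
      unfolding antisymmetrize_def lookup_sum by (intro sum.neutral) simp
    with l show False
      by (simp add: in_keys_iff)
  qed
  then obtain \<sigma> where \<sigma>: "\<sigma> permutes {..<n}" "l \<in> keys (place_perm \<sigma> u)"
    by (auto simp: in_keys_iff)
  from \<sigma>(2) obtain l' where "l' \<in> keys u" "l \<in> keys (basis_vec (permute_list (inv_into UNIV \<sigma>) l') :: _ \<Rightarrow>\<^sub>0 'b)"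
    unfolding place_perm_def by (rule keys_lin_ext)
  then show ?thesis
    using that[of l' "inv_into UNIV \<sigma>"] permutes_inv[OF \<sigma>(1)] by (simp add: keys_basis_vec)
qed

section \<open>The Koszul condition\<close>

lemma permute_list_append_left:
  assumes "\<sigma> permutes {..<length xs}"
  shows "permute_list \<sigma> (xs @ ys) = permute_list \<sigma> xs @ ys"
proof (rule nth_equalityI)
  fix i assume "i < length (permute_list \<sigma> (xs @ ys))"
  then show "permute_list \<sigma> (xs @ ys) ! i = (permute_list \<sigma> xs @ ys) ! i"
    using permutes_in_image[OF assms, of i] permutes_not_in[OF assms, of i]
    by (auto simp: permute_list_def nth_append)
qed simp

text \<open>Evaluates one term of the exchange relation: the first row entry trades places with an
  entry of the exterior part.\<close>

lemma permute_list_transpose_append: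
  assumes "k < length xs"
  shows "permute_list (Transposition.transpose (length xs) k) (xs @ y # ys) = xs[k := y] @ xs ! k # ys"
proof (rule nth_equalityI)
  fix i assume i: "i < length (permute_list (Transposition.transpose (length xs) k) (xs @ y # ys))"
  consider "i < length xs" | "i = length xs" | j where "i = Suc (length xs + j)" "j < length ys"
    using i by (metis Suc_less_eq add_Suc_right add_less_cancel_left length_Cons length_append
        length_permute_list less_imp_Suc_add linorder_neqE_nat)
  then show "permute_list (Transposition.transpose (length xs) k) (xs @ y # ys) ! i =
      (xs[k := y] @ xs ! k # ys) ! i"
  proof cases
    case (3 j)
    then have "length ys - Suc 0 = j" if "\<not> Suc j < length ys"
      using that by simp
    with 3 assms show ?thesis
      by (auto simp: permute_list_def nth_append Transposition.transpose_def nth_Cons')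
  qed (use assms i in \<open>auto simp: permute_list_def nth_append Transposition.transpose_def nth_Cons'\<close>)
qed simp

text \<open>
  The coefficients, in the basis of lists, of an element of \<open>\<Lambda>\<^sup>N V \<otimes> Sym\<^sub>M V\<close> that the Koszul
  differential \<open>\<Lambda>\<^sup>N V \<otimes> Sym\<^sub>M V \<rightarrow> \<Lambda>\<^sup>N\<^sup>+\<^sup>1 V \<otimes> Sym\<^sub>M\<^sub>-\<^sub>1 V\<close> annihilates. The condition on repeated
  entries follows from the one on signs unless the characteristic is two.
\<close>

definition hook_symmetric :: "nat \<Rightarrow> nat \<Rightarrow> ('b list \<Rightarrow> 'f::comm_ring_1) \<Rightarrow> bool" where
  "hook_symmetric N M U \<longleftrightarrow>
     (\<forall>xs \<tau>. length xs = N + M \<longrightarrow> \<tau> permutes {..<N} \<longrightarrow>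
        U (permute_list \<tau> xs) = of_int (sign \<tau>) * U xs) \<and>
     (\<forall>xs a b. length xs = N + M \<longrightarrow> a < N \<longrightarrow> b < N \<longrightarrow> a \<noteq> b \<longrightarrow> xs ! a = xs ! b \<longrightarrow> U xs = 0) \<and>
     (\<forall>zs ws ws'. length zs = N \<longrightarrow> length ws = M \<longrightarrow> mset ws = mset ws' \<longrightarrow>
        U (zs @ ws) = U (zs @ ws')) \<and>
     (\<forall>xs. 1 \<le> M \<longrightarrow> length xs = N + M \<longrightarrow>
        U xs = (\<Sum>k<N. U (permute_list (Transposition.transpose N k) xs)))"

text \<open>The exchange relation is \<open>alternate_Suc\<close> solved for its first term.
  Antisymmetry and the zeros at repeated entries hold for any alternation, and the symmetry of the
  row survives because only the first \<open>N\<close> places are permuted.\<close>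

lemma hook_symmetric_alternate:
  assumes sym: "\<And>zs ws ws'. length zs = N \<Longrightarrow> length ws = M \<Longrightarrow> mset ws = mset ws' \<Longrightarrow>
      f (zs @ ws) = f (zs @ ws')"
    and Suc: "\<And>xs. 1 \<le> M \<Longrightarrow> length xs = N + M \<Longrightarrow> alternate (Suc N) f xs = 0"
  shows "hook_symmetric N M (alternate N f)"
  unfolding hook_symmetric_def
proof (intro conjI allI impI)
  show "alternate N f (zs @ ws) = alternate N f (zs @ ws')"
    if "length zs = N" "length ws = M" "mset ws = mset ws'" for zs ws ws'
    unfolding alternate_def
  proof (rule sum.cong[OF refl])
    fix \<sigma> assume "\<sigma> \<in> {\<sigma>. \<sigma> permutes {..<N}}"
    then show "of_int (sign \<sigma>) * f (permute_list \<sigma> (zs @ ws)) =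
        of_int (sign \<sigma>) * f (permute_list \<sigma> (zs @ ws'))"
      using that sym[of "permute_list \<sigma> zs" ws ws'] by (simp add: permute_list_append_left)
  qed
  show "alternate N f xs = (\<Sum>k<N. alternate N f (permute_list (Transposition.transpose N k) xs))"
    if "1 \<le> M" "length xs = N + M" for xs
    using Suc[OF that] alternate_Suc[of N xs f] that by simp
qed (auto intro: alternate_permute_list alternate_eq_0_if_repeated)

lemma hook_symmetric_diff:
  assumes "hook_symmetric N M U" "hook_symmetric N M W"
  shows "hook_symmetric N M (\<lambda>xs. U xs - W xs)"
  unfolding hook_symmetric_def
proof (intro conjI allI impI)
  show "U xs - W xs = (\<Sum>k<N. U (permute_list (Transposition.transpose N k) xs) -
      W (permute_list (Transposition.transpose N k) xs))"
    if "1 \<le> M" "length xs = N + M" for xs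
    using assms that unfolding hook_symmetric_def sum_subtractf by metis
  show "U (zs @ ws) - W (zs @ ws) = U (zs @ ws') - W (zs @ ws')"
    if "length zs = N" "length ws = M" "mset ws = mset ws'" for zs ws ws'
    using assms that unfolding hook_symmetric_def by metis
  show "U xs - W xs = 0" if "length xs = N + M" "a < N" "b < N" "a \<noteq> b" "xs ! a = xs ! b" for xs a b
  proof -
    have "U xs = 0" "W xs = 0"
      using assms that unfolding hook_symmetric_def by metis+
    then show ?thesis by simp
  qed
  show "U (permute_list \<tau> xs) - W (permute_list \<tau> xs) = of_int (sign \<tau>) * (U xs - W xs)"
    if "length xs = N + M" "\<tau> permutes {..<N}" for xs \<tau>
    using assms that unfolding hook_symmetric_def right_diff_distrib by metis
qed

lemma hook_symmetric_sum:
  assumes "\<And>t. t \<in> T \<Longrightarrow> hook_symmetric N M (W t)"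
  shows "hook_symmetric N M (\<lambda>xs. \<Sum>t\<in>T. c t * W t xs)"
  unfolding hook_symmetric_def
proof (intro conjI allI impI)
  show "(\<Sum>t\<in>T. c t * W t xs) =
      (\<Sum>k<N. \<Sum>t\<in>T. c t * W t (permute_list (Transposition.transpose N k) xs))"
    if "1 \<le> M" "length xs = N + M" for xs
  proof -
    have "W t xs = (\<Sum>k<N. W t (permute_list (Transposition.transpose N k) xs))" if "t \<in> T" for t
      using assms[OF that] \<open>1 \<le> M\<close> \<open>length xs = N + M\<close> unfolding hook_symmetric_def by metis
    then have "(\<Sum>t\<in>T. c t * W t xs) =
        (\<Sum>t\<in>T. c t * (\<Sum>k<N. W t (permute_list (Transposition.transpose N k) xs)))"
      by (intro sum.cong) auto
    also have "\<dots> = (\<Sum>k<N. \<Sum>t\<in>T. c t * W t (permute_list (Transposition.transpose N k) xs))"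
      unfolding sum_distrib_left by (rule sum.swap)
    finally show ?thesis .
  qed
  show "(\<Sum>t\<in>T. c t * W t (zs @ ws)) = (\<Sum>t\<in>T. c t * W t (zs @ ws'))"
    if "length zs = N" "length ws = M" "mset ws = mset ws'" for zs ws ws'
  proof (rule sum.cong[OF refl])
    fix t assume "t \<in> T"
    from assms[OF this] that have "W t (zs @ ws) = W t (zs @ ws')"
      unfolding hook_symmetric_def by metis
    then show "c t * W t (zs @ ws) = c t * W t (zs @ ws')" by simp
  qed
  show "(\<Sum>t\<in>T. c t * W t xs) = 0"
    if "length xs = N + M" "a < N" "b < N" "a \<noteq> b" "xs ! a = xs ! b" for xs a b
  proof (rule sum.neutral, rule ballI)
    fix t assume "t \<in> T"
    from assms[OF this] that have "W t xs = 0"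
      unfolding hook_symmetric_def by metis
    then show "c t * W t xs = 0" by simp
  qed
  show "(\<Sum>t\<in>T. c t * W t (permute_list \<tau> xs)) = of_int (sign \<tau>) * (\<Sum>t\<in>T. c t * W t xs)"
    if "length xs = N + M" "\<tau> permutes {..<N}" for xs \<tau>
    unfolding sum_distrib_left
  proof (rule sum.cong[OF refl])
    fix t assume "t \<in> T"
    from assms[OF this] that have "W t (permute_list \<tau> xs) = of_int (sign \<tau>) * W t xs"
      unfolding hook_symmetric_def by metis
    then show "c t * W t (permute_list \<tau> xs) = of_int (sign \<tau>) * (c t * W t xs)"
      by (simp add: mult.left_commute)
  qed
qed

text \<open>The conditions concern places only, so entries may be renamed. This reduces monomials to
  their indices, for which semistandardness is defined.\<close>

lemma hook_symmetric_map:
  assumes "hook_symmetric N M U"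
  shows "hook_symmetric N M (\<lambda>xs. U (map g xs))"
  unfolding hook_symmetric_def
proof (intro conjI allI impI)
  show "U (map g xs) = (\<Sum>k<N. U (map g (permute_list (Transposition.transpose N k) xs)))"
    if "1 \<le> M" "length xs = N + M" for xs
  proof -
    have "map g (permute_list (Transposition.transpose N k) xs) =
        permute_list (Transposition.transpose N k) (map g xs)" if "k < N" for k
      by (rule permute_list_map[symmetric], rule permutes_swap_id)
        (use \<open>1 \<le> M\<close> \<open>length xs = N + M\<close> that in auto)
    moreover have "U (map g xs) = (\<Sum>k<N. U (permute_list (Transposition.transpose N k) (map g xs)))"
      using assms that unfolding hook_symmetric_def by (metis length_map)
    ultimately show ?thesis by simp
  qed
  show "U (map g (zs @ ws)) = U (map g (zs @ ws'))"
    if "length zs = N" "length ws = M" "mset ws = mset ws'" for zs ws ws'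
    using assms that unfolding hook_symmetric_def map_append by (metis length_map mset_map)
  show "U (map g xs) = 0" if "length xs = N + M" "a < N" "b < N" "a \<noteq> b" "xs ! a = xs ! b" for xs a b
  proof -
    have "map g xs ! a = map g xs ! b" using that by simp
    with assms that show ?thesis unfolding hook_symmetric_def by (metis length_map)
  qed
  show "U (map g (permute_list \<tau> xs)) = of_int (sign \<tau>) * U (map g xs)"
    if "length xs = N + M" "\<tau> permutes {..<N}" for xs \<tau>
  proof -
    have "\<tau> permutes {..<length xs}"
      using permutes_lessThan_mono[OF that(2), of "length xs"] that(1) by simp
    then show ?thesis
      using assms that unfolding hook_symmetric_def by (metis length_map permute_list_map)
  qed
qed

text \<open>Sorting the exterior part costs a sign and sorting the row costs nothing. As the least
  entry lies in the exterior part, it then heads the column and is at most every row entry: the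
  sorted position is semistandard.\<close>

lemma hook_symmetric_eq_0_aux:
  fixes U :: "nat list \<Rightarrow> 'f::comm_ring_1"
  assumes U: "hook_symmetric N M U"
    and std: "\<And>as bs. (as, bs) \<in> hook_ssyt M N d \<Longrightarrow> U (hd as # bs @ tl as) = 0"
    and len: "length zs = N" "length ws = M"
    and d: "set zs \<subseteq> {..d}" "set ws \<subseteq> {..d}"
    and m: "m \<in> set zs" "\<And>z. z \<in> set zs \<union> set ws \<Longrightarrow> m \<le> z"
  shows "U (zs @ ws) = 0"
proof (cases "distinct zs")
  case False
  then obtain a b where "a < N" "b < N" "a \<noteq> b" "zs ! a = zs ! b"
    using len by (auto simp: distinct_conv_nth)
  then have "(zs @ ws) ! a = (zs @ ws) ! b"
    using len by (simp add: nth_append)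
  with \<open>a < N\<close> \<open>b < N\<close> \<open>a \<noteq> b\<close> show ?thesis
    using U len unfolding hook_symmetric_def by (metis length_append)
next
  case True
  obtain p where p: "p permutes {..<length zs}" "permute_list p zs = sort zs"
    using mset_eq_permutation[of "sort zs" zs] by auto
  have "U (permute_list p (zs @ ws)) = of_int (sign p) * U (zs @ ws)"
    using U len p(1) unfolding hook_symmetric_def by (metis length_append)
  then have *: "U (sort zs @ ws) = of_int (sign p) * U (zs @ ws)"
    by (simp add: permute_list_append_left[OF p(1)] p(2))
  have **: "U (sort zs @ ws) = U (sort zs @ sort ws)"
    using U len unfolding hook_symmetric_def by (metis length_sort mset_sort)
  obtain z0 bs where zb: "sort zs = z0 # bs"
    using m(1) by (metis list.exhaust set_empty empty_iff set_sort)
  have set: "set zs = insert z0 (set bs)"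
    using arg_cong[OF zb, of set] by simp
  have str: "sorted_wrt (<) (z0 # bs)"
    using True by (simp flip: zb add: strict_sorted_iff)
  have "z0 \<le> m"
    using str m(1) set by auto
  have "(z0 # sort ws, bs) \<in> hook_ssyt M N d"
    using len d str m set \<open>z0 \<le> m\<close> arg_cong[OF zb, of length]
    by (auto simp: hook_ssyt_def intro: order.trans)
  from std[OF this] have "U (sort zs @ sort ws) = 0"
    by (simp add: zb)
  \<comment> \<open>Multiplying by the sign once more takes the place of division, as the
    coefficients form only a ring.\<close>
  with * ** have "of_int (sign p * sign p) * U (zs @ ws) = 0"
    by (simp only: of_int_mult mult.assoc mult_zero_right)
  then show ?thesis
    by simp
qed

text \<open>
  If the least entry is not in the exterior factor, then the exchange relation expresses the
  coefficient by coefficients for which it is.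
\<close>

lemma hook_symmetric_eq_0:
  fixes U :: "nat list \<Rightarrow> 'f::comm_ring_1"
  assumes U: "hook_symmetric N M U" and N: "1 \<le> N"
    and std: "\<And>as bs. (as, bs) \<in> hook_ssyt M N d \<Longrightarrow> U (hd as # bs @ tl as) = 0"
    and xs: "length xs = N + M" "set xs \<subseteq> {..d}"
  shows "U xs = 0"
proof -
  define zs ws where "zs = take N xs" and "ws = drop N xs"
  have zw: "xs = zs @ ws" "length zs = N" "length ws = M"
    using xs by (auto simp: zs_def ws_def)
  have d: "set zs \<subseteq> {..d}" "set ws \<subseteq> {..d}"
    using xs zw by auto
  define m where "m = Min (set xs)"
  have "xs \<noteq> []"
    using xs N by auto
  then have m: "m \<in> set zs \<or> m \<in> set ws" "\<And>z. z \<in> set zs \<union> set ws \<Longrightarrow> m \<le> z"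
    unfolding m_def using zw by (metis Min_in finite_set set_append set_empty Un_iff)
      (simp add: zw)
  show ?thesis
  proof (cases "m \<in> set zs")
    case True
    then show ?thesis
      using hook_symmetric_eq_0_aux[OF U std zw(2,3) d] m(2) zw(1) by blast
  next
    case False
    then obtain ws' where ws': "mset ws = mset (m # ws')"
      using m(1) by (metis ex_mset insert_DiffM mset.simps(2) set_mset_mset)
    then have M: "1 \<le> M" "length ws' = M - 1" and setws: "set ws = insert m (set ws')"
      using zw(3) mset_eq_length[OF ws'] mset_eq_setD[OF ws'] by auto
    have "U xs = U (zs @ m # ws')"
      using U zw ws' unfolding hook_symmetric_def by metis
    also have "\<dots> = (\<Sum>k<N. U (permute_list (Transposition.transpose N k) (zs @ m # ws')))"
      using U zw M unfolding hook_symmetric_def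
      by (metis length_append mset_eq_length ws')
    also have "\<dots> = (\<Sum>k<N. U (zs[k := m] @ zs ! k # ws'))"
      using permute_list_transpose_append[of _ zs m ws'] zw(2) by (intro sum.cong) auto
    also have "\<dots> = 0"
    proof (rule sum.neutral, rule ballI)
      fix k assume "k \<in> {..<N}"
      then have k: "k < length zs" by (simp add: zw)
      have sub: "set (zs[k := m]) \<subseteq> insert m (set zs)"
        by (rule set_update_subset_insert)
      have "m \<le> d"
        using m(1) d by auto
      have "zs ! k \<in> set zs"
        using k by simp
      show "U (zs[k := m] @ zs ! k # ws') = 0"
      proof (rule hook_symmetric_eq_0_aux[OF U std])
        show "set (zs[k := m]) \<subseteq> {..d}"
          using sub d \<open>m \<le> d\<close> by auto
        show "set (zs ! k # ws') \<subseteq> {..d}"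
          using d setws \<open>zs ! k \<in> set zs\<close> by auto
        show "m \<in> set (zs[k := m])"
          using k by (rule set_update_memI)
        show "m \<le> z" if "z \<in> set (zs[k := m]) \<union> set (zs ! k # ws')" for z
        proof -
          have "z = m \<or> z \<in> set zs \<union> set ws"
            using that sub setws \<open>zs ! k \<in> set zs\<close> by auto
          then show ?thesis
            using m(2) by auto
        qed
      qed (use zw M in auto)
    qed
    finally show ?thesis .
  qed
qed

section \<open>The vectors spanning the Weyl module\<close>

interpretation lin_ext: Vector_Spaces.linear cmul cmul "lin_ext h" for h
  by (rule lin_ext_linear)

text \<open>The exponents of the basis vector \<open>X^(d - k) Y^k\<close>. The second component
  alone makes this injective on all naturals, also beyond \<open>d\<close>, where the subtraction
  truncates.\<close>

definition hmon :: "nat \<Rightarrow> nat \<Rightarrow> nat \<times> nat" where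
  "hmon d k = (d - k, k)"

lemma inj_hmon: "inj (hmon d)"
  by (auto simp: inj_on_def hmon_def)

text \<open>Separates the exterior factor from the row only at the end: the exchange relation moves
  entries across that border, so the arguments are about flat lists.\<close>

definition unflatten :: "nat \<Rightarrow> ('b list \<Rightarrow>\<^sub>0 'f::field) \<Rightarrow> ('b list \<times> 'b list \<Rightarrow>\<^sub>0 'f)" where
  "unflatten n = lin_ext (\<lambda>xs. basis_vec (take n xs, drop n xs))"

text \<open>\<open>F_Delta\<close> before antisymmetrization and before the list is split
  (\<open>F_Delta_eq_unflatten\<close>). The row of the tableau occupies place 0 and the places
  after the column.\<close>

definition row_sym :: "'b list \<times> 'b list \<Rightarrow> ('b list \<Rightarrow>\<^sub>0 'f::field)" where
  "row_sym = (\<lambda>(as, bs). \<Sum>cs\<in>permutations_of_multiset (mset as). basis_vec (hd cs # bs @ tl cs))"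

lemma tensor_list_basis_vec: "tensor_list (map basis_vec bs) = basis_vec bs"
  by (induction bs) simp_all

lemma place_perm_basis_vec:
  "place_perm \<sigma> (basis_vec bs) = basis_vec (permute_list (inv_into UNIV \<sigma>) bs)"
  by (simp add: place_perm_def)

lemma wedge_basis_vec: "wedge (map basis_vec bs) = antisymmetrize (length bs) (basis_vec bs)"
  by (simp add: wedge_def antisymmetrize_def tensor_list_basis_vec)

lemma linear_antisymmetrize: "Vector_Spaces.linear cmul cmul (antisymmetrize n)"
proof -
  have "Vector_Spaces.linear cmul cmul
      (\<lambda>u. \<Sum>\<sigma> | \<sigma> permutes {..<n}. cmul (of_int (sign \<sigma>)) (place_perm \<sigma> u))"
    unfolding place_perm_def
    by unfold_locales (simp_all add: lin_ext.add lin_ext.scale fspace.scale_right_distrib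
        sum.distrib fspace.scale_sum_right mult.commute)
  then show ?thesis
    unfolding antisymmetrize_def[abs_def] .
qed

interpretation antisymmetrize: Vector_Spaces.linear cmul cmul "antisymmetrize n" for n
  by (rule linear_antisymmetrize)

lemma linear_unflatten: "Vector_Spaces.linear cmul cmul (unflatten n)"
  unfolding unflatten_def by (rule lin_ext_linear)

interpretation unflatten: Vector_Spaces.linear cmul cmul "unflatten n" for n
  by (rule linear_unflatten)

lemma unflatten_antisymmetrize_basis_vec:
  assumes "length zs = n"
  shows "unflatten n (antisymmetrize n (basis_vec (zs @ ws))) =
    tensor (antisymmetrize n (basis_vec zs)) (basis_vec ws)"
proof -
  have "permute_list (inv_into UNIV \<sigma>) (zs @ ws) = permute_list (inv_into UNIV \<sigma>) zs @ ws"
    if "\<sigma> permutes {..<n}" for \<sigma>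
    using permutes_inv[OF that] assms by (simp add: permute_list_append_left)
  then show ?thesis
    using assms
    by (simp add: antisymmetrize_def unflatten_def tensor_def lin_ext.sum lin_ext.scale
        place_perm_basis_vec)
qed

text \<open>The sums on the two sides run over the rearrangements of \<open>as\<close> and of
  \<open>map g as\<close>, which correspond one to one because \<open>g\<close> is
  injective.\<close>

lemma F_Delta_eq_unflatten:
  fixes g :: "nat \<Rightarrow> 'b"
  assumes N: "1 \<le> N" and g: "inj g" and len: "length as = Suc M" "length bs = N - 1"
  shows "F_Delta (\<lambda>i. basis_vec (g i) :: 'b \<Rightarrow>\<^sub>0 'f::field) (as, bs) =
    unflatten N (antisymmetrize N (row_sym (map g as, map g bs)))"
proof -
  have inj: "inj_on (map g) A" for A
    using g by (simp add: inj_on_def inj_map_eq_map)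
  have "F_Delta (\<lambda>i. basis_vec (g i) :: 'b \<Rightarrow>\<^sub>0 'f) (as, bs) = (\<Sum>cs\<in>permutations_of_multiset (mset as).
      unflatten N (antisymmetrize N (basis_vec (g (hd cs) # map g bs @ map g (tl cs)))))"
    unfolding F_Delta_def prod.case
  proof (rule sum.cong[OF refl])
    fix cs assume "cs \<in> permutations_of_multiset (mset as)"
    have "tensor (wedge (map (\<lambda>i. basis_vec (g i)) (hd cs # bs)))
        (tensor_list (map (\<lambda>i. basis_vec (g i)) (tl cs))) =
        tensor (wedge (map basis_vec (g (hd cs) # map g bs)))
        (tensor_list (map basis_vec (map g (tl cs))))"
      by (simp add: comp_def)
    also have "\<dots> = tensor (antisymmetrize N (basis_vec (g (hd cs) # map g bs))) (basis_vec (map g (tl cs)))"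
      unfolding wedge_basis_vec tensor_list_basis_vec using N len by simp
    also have "\<dots> = unflatten N (antisymmetrize N (basis_vec ((g (hd cs) # map g bs) @ map g (tl cs))))"
      using N len by (subst unflatten_antisymmetrize_basis_vec) auto
    finally show "tensor (wedge (map (\<lambda>i. basis_vec (g i)) (hd cs # bs)))
        (tensor_list (map (\<lambda>i. basis_vec (g i)) (tl cs))) =
        unflatten N (antisymmetrize N (basis_vec (g (hd cs) # map g bs @ map g (tl cs))))"
      by simp
  qed
  also have "\<dots> = unflatten N (antisymmetrize N
      (\<Sum>cs\<in>permutations_of_multiset (mset as). basis_vec (g (hd cs) # map g bs @ map g (tl cs))))"
    by (simp only: unflatten.sum antisymmetrize.sum)
  also have "(\<Sum>cs\<in>permutations_of_multiset (mset as). basis_vec (g (hd cs) # map g bs @ map g (tl cs))) =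
      (row_sym (map g as, map g bs) :: _ \<Rightarrow>\<^sub>0 'f)"
    unfolding row_sym_def prod.case mset_map permutations_of_multiset_image sum.reindex[OF inj] comp_def
  proof (rule sum.cong[OF refl])
    fix cs assume "cs \<in> permutations_of_multiset (mset as)"
    then have "cs \<noteq> []"
      using len(1) by (auto dest!: permutations_of_multisetD)
    then show "basis_vec (g (hd cs) # map g bs @ map g (tl cs)) =
        (basis_vec (hd (map g cs) # map g bs @ tl (map g cs)) :: _ \<Rightarrow>\<^sub>0 'f)"
      by (simp add: hd_map map_tl)
  qed
  finally show ?thesis .
qed

text \<open>Distinct rearrangements are summed once each, so there are no multiplicities that could
  vanish in the field.\<close>

lemma lookup_row_sym:
  fixes as :: "'b list"
  assumes "length bs = length zs" "as \<noteq> []"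
  shows "lookup (row_sym (as, bs)) (z # zs @ ws) =
    (if zs = bs \<and> mset (z # ws) = mset as then 1 else 0 :: 'f::field)"
proof -
  let ?P = "permutations_of_multiset (mset as)"
  have "lookup (row_sym (as, bs)) (z # zs @ ws) =
      (\<Sum>cs\<in>?P. if zs = bs \<and> cs = z # ws then 1 else 0 :: 'f)"
    unfolding row_sym_def prod.case lookup_sum
  proof (rule sum.cong[OF refl])
    fix cs assume "cs \<in> ?P"
    then have "cs \<noteq> []"
      using assms by (auto dest!: permutations_of_multisetD)
    then have "hd cs # bs @ tl cs = z # zs @ ws \<longleftrightarrow> zs = bs \<and> cs = z # ws"
      using assms by (cases cs) auto
    then show "lookup (basis_vec (hd cs # bs @ tl cs)) (z # zs @ ws) =
        (if zs = bs \<and> cs = z # ws then 1 else 0 :: 'f)"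
      by (simp add: basis_vec_def lookup_single when_def)
  qed
  also have "\<dots> = (if zs = bs \<and> mset (z # ws) = mset as then 1 else 0)"
  proof (cases "zs = bs")
    case True
    then show ?thesis
      by (simp add: sum.delta) (auto simp: permutations_of_multiset_def)
  qed simp
  finally show ?thesis .
qed

lemma keys_row_sym:
  assumes "xs \<in> keys (row_sym (as, bs) :: 'b list \<Rightarrow>\<^sub>0 'f::field)" "as \<noteq> []"
  shows "length xs = length as + length bs \<and> set xs = set as \<union> set bs"
proof -
  have "\<exists>cs\<in>permutations_of_multiset (mset as). lookup (basis_vec (hd cs # bs @ tl cs)) xs \<noteq> (0 :: 'f)"
    using assms sum.neutral by (force simp: row_sym_def in_keys_iff lookup_sum)
  then obtain cs where cs: "mset cs = mset as" "xs = hd cs # bs @ tl cs"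
    by (auto simp: basis_vec_def lookup_single when_def split: if_splits
        dest!: permutations_of_multisetD)
  then have "length cs = length as" "set cs = set as" "cs \<noteq> []"
    using assms(2) by (auto dest: mset_eq_length mset_eq_setD)
  with cs show ?thesis
    by (cases cs) auto
qed

lemma split_list_at:
  assumes "length xs = N + M" "1 \<le> N"
  obtains z zs ws where "xs = z # zs @ ws" "length zs = N - 1" "length ws = M"
proof -
  obtain z xs' where "xs = z # xs'"
    using assms by (cases xs) auto
  then show ?thesis
    using assms that[of z "take (N - 1) xs'" "drop (N - 1) xs'"] by simp
qed

text \<open>Places 0 and \<open>N\<close> both carry entries of the row, over whose rearrangements
  \<open>row_sym\<close> sums. The coefficients are thus symmetric in two of the first
  \<open>N + 1\<close> places, which kills the alternation over these.\<close>

lemma hook_symmetric_row_sym: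
  assumes N: "1 \<le> N" and len: "length as = Suc M" "length bs = N - 1"
  shows "hook_symmetric N M (lookup (antisymmetrize N (row_sym (as, bs))))"
proof -
  let ?f = "lookup (row_sym (as, bs))"
  have as: "as \<noteq> []"
    using len by auto
  have "hook_symmetric N M (alternate N ?f)"
  proof (rule hook_symmetric_alternate)
    show "?f (zs @ ws) = ?f (zs @ ws')"
      if *: "length zs = N" "length ws = M" "mset ws = mset ws'" for zs ws ws'
    proof -
      obtain z zs' where "zs = z # zs'"
        using * N by (cases zs) auto
      then show ?thesis
        using * len as by (simp add: lookup_row_sym)
    qed
    show "alternate (Suc N) ?f xs = 0" if M: "1 \<le> M" and xs: "length xs = N + M" for xs
    proof (rule alternate_eq_0_if_symmetric[of _ _ 0 N])
      show "?f (permute_list (Transposition.transpose 0 N) ys) = ?f ys" if "length ys = length xs" for ys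
      proof -
        have "length ys = N + M"
          using that xs by simp
        then obtain z zs ws where ys: "ys = z # zs @ ws" "length zs = N - 1" "length ws = M"
          using N by (rule split_list_at)
        then obtain w ws' where w: "ws = w # ws'"
          using M by (cases ws) auto
        have "permute_list (Transposition.transpose 0 N) ys = w # zs @ z # ws'"
          using permute_list_transpose_append[of 0 "z # zs" w ws'] ys w N
          by (simp add: transpose_commute)
        then show ?thesis
          using len as ys w by (simp add: lookup_row_sym add_mset_commute)
      qed
    qed (use M N xs in auto)
  qed
  moreover have "lookup (antisymmetrize N (row_sym (as, bs))) xs = alternate N ?f xs"
    if "length xs = N + M" for xs
    using that by (simp add: lookup_antisymmetrize)
  ultimately show ?thesis
    unfolding hook_symmetric_def by (simp add: lookup_antisymmetrize)
qed

lemma permute_list_eq_imp_id: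
  assumes "\<sigma> permutes {..<length xs}" "distinct xs" "permute_list \<sigma> xs = xs"
  shows "\<sigma> = id"
proof
  fix i
  show "\<sigma> i = id i"
  proof (cases "i < length xs")
    case True
    then have "xs ! \<sigma> i = xs ! i" "\<sigma> i < length xs"
      using assms permute_list_nth[OF assms(1) True] permutes_in_image[OF assms(1), of i] by auto
    with assms(2) True show ?thesis
      by (simp add: nth_eq_iff_index_eq)
  next
    case False
    then show ?thesis
      using assms(1) by (simp add: permutes_not_in)
  qed
qed

text \<open>Suppose that \<open>c\<close> is not the corner of the second tableau. Then
  \<open>c\<close> lies below that corner and exceeds it, while that corner lies in the leg of the
  first tableau and exceeds the corner of the first. But the corner of the first is \<open>c\<close>
  or an arm entry of the second, so it is at least the corner of the second.\<close>

lemma hook_ssyt_determined: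
  assumes t: "(as, bs) \<in> hook_ssyt M N d" and t': "(as', bs') \<in> hook_ssyt M N d"
    and c: "mset (c # bs) = mset (hd as' # bs')" "mset (c # tl as') = mset as"
  shows "c = hd as'" "as = as'" "bs = bs'"
proof -
  have ne: "as \<noteq> []" "as' \<noteq> []"
    using t t' by (auto simp: hook_ssyt_def)
  have srt: "sorted as" "sorted as'" "sorted_wrt (<) (hd as # bs)" "sorted_wrt (<) (hd as' # bs')"
    using t t' by (auto simp: hook_ssyt_def)
  have set_as: "set as = insert c (set (tl as'))"
    using mset_eq_setD[OF c(2)] by simp
  have le: "hd as' \<le> x" if "x \<in> set (tl as')" for x
    using srt(2) ne(2) that by (cases as') auto
  have hd_in: "hd as \<in> insert c (set (tl as'))"
    using ne(1) set_as by (metis hd_in_set)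
  show 1: "c = hd as'"
  proof (rule ccontr)
    assume "c \<noteq> hd as'"
    then have *: "c \<in> set bs'" "hd as' \<in> set bs"
      using mset_eq_setD[OF c(1)] by auto
    then have "hd as' < c" "hd as < hd as'"
      using srt by auto
    moreover have "hd as' \<le> hd as"
      using hd_in le \<open>hd as' < c\<close> by auto
    ultimately show False by simp
  qed
  have "mset (hd as' # tl as') = mset as'"
    using ne(2) by simp
  then have "mset as = mset as'"
    using c(2) 1 by simp
  then show "as = as'"
    using srt(1,2) by (metis properties_for_sort)
  have "mset bs = mset bs'"
    using c(1) 1 by simp
  moreover have "sorted bs" "sorted bs'"
    using srt by (auto simp: strict_sorted_iff)
  ultimately show "bs = bs'"
    by (metis properties_for_sort)
qed

text \<open>The antisymmetrized row sums are dual to the semistandard positions: a nonzero term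
  forces the tableaux to agree by \<open>hook_ssyt_determined\<close>, and then
  \<open>\<sigma> = id\<close> because a column has distinct entries.\<close>

lemma alternate_row_sym_standard:
  assumes N: "1 \<le> N" and t: "(as, bs) \<in> hook_ssyt M N d" and t': "(as', bs') \<in> hook_ssyt M N d"
  shows "alternate N (lookup (row_sym (as, bs))) (hd as' # bs' @ tl as') =
    (if (as, bs) = (as', bs') then 1 else 0 :: 'f::field)"
proof -
  have len: "length as = Suc M" "length bs = N - 1" "length as' = Suc M" "length bs' = N - 1"
    using t t' by (auto simp: hook_ssyt_def)
  have as: "as \<noteq> []" "as' \<noteq> []"
    using len by auto
  have dist: "distinct (hd as' # bs')"
    using t' by (auto simp: hook_ssyt_def strict_sorted_iff)
  have *: "lookup (row_sym (as, bs)) (permute_list \<sigma> (hd as' # bs' @ tl as')) =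
      (if \<sigma> = id \<and> (as, bs) = (as', bs') then 1 else 0 :: 'f)" if \<sigma>: "\<sigma> permutes {..<N}" for \<sigma>
  proof -
    have \<sigma>': "\<sigma> permutes {..<length (hd as' # bs')}"
      using \<sigma> len N by simp
    obtain c cs where cs: "permute_list \<sigma> (hd as' # bs') = c # cs"
      by (metis length_0_conv length_permute_list list.distinct(1) list.exhaust)
    have "length (permute_list \<sigma> (hd as' # bs')) = length (c # cs)"
      by (simp only: cs)
    then have lcs: "length cs = length bs"
      using len by simp
    have "permute_list \<sigma> ((hd as' # bs') @ tl as') = c # cs @ tl as'"
      by (subst permute_list_append_left[OF \<sigma>']) (simp add: cs)
    then have "lookup (row_sym (as, bs)) (permute_list \<sigma> (hd as' # bs' @ tl as')) =
        (if cs = bs \<and> mset (c # tl as') = mset as then 1 else 0 :: 'f)"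
      using lookup_row_sym[of bs cs as c "tl as'"] lcs as by simp
    moreover have "cs = bs \<and> mset (c # tl as') = mset as \<longleftrightarrow> \<sigma> = id \<and> (as, bs) = (as', bs')"
    proof
      assume *: "cs = bs \<and> mset (c # tl as') = mset as"
      have "mset (c # bs) = mset (hd as' # bs')"
        using mset_permute_list[OF \<sigma>'] cs * by simp
      from hook_ssyt_determined[OF t t' this] * have "c = hd as'" "as = as'" "bs = bs'"
        by auto
      with permute_list_eq_imp_id[OF \<sigma>' dist] cs * show "\<sigma> = id \<and> (as, bs) = (as', bs')"
        by simp
    next
      assume "\<sigma> = id \<and> (as, bs) = (as', bs')"
      with cs show "cs = bs \<and> mset (c # tl as') = mset as"
        using as by (auto simp flip: mset.simps)
    qed
    ultimately show ?thesis
      by simp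
  qed
  have "alternate N (lookup (row_sym (as, bs))) (hd as' # bs' @ tl as') =
      (\<Sum>\<sigma> | \<sigma> permutes {..<N}. if \<sigma> = id then (if (as, bs) = (as', bs') then 1 else 0) else 0 :: 'f)"
    unfolding alternate_def by (rule sum.cong[OF refl]) (simp add: *)
  also have "\<dots> = (if (as, bs) = (as', bs') then 1 else 0)"
    by (subst sum.delta) (simp_all add: finite_permutations)
  finally show ?thesis .
qed

lemma alternate_map:
  assumes "n \<le> length xs"
  shows "alternate n f (map g xs) = alternate n (\<lambda>xs. f (map g xs)) xs"
  unfolding alternate_def
  by (rule sum.cong[OF refl])
    (use permutes_lessThan_mono[OF _ assms] in \<open>auto simp: permute_list_map\<close>)

lemma finite_hook_ssyt: "finite (hook_ssyt M N d)"
proof (rule finite_subset)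
  show "hook_ssyt M N d \<subseteq> {as. set as \<subseteq> {0..d} \<and> length as = M + 1} \<times>
      {bs. set bs \<subseteq> {0..d} \<and> length bs = N - 1}"
    by (auto simp: hook_ssyt_def)
qed (simp add: finite_lists_length_eq)

lemma lookup_row_sym_map:
  assumes "inj g" "as \<noteq> []" "length xs = length as + length bs"
  shows "lookup (row_sym (map g as, map g bs)) (map g xs) = lookup (row_sym (as, bs)) xs"
proof -
  have "length xs = Suc (length bs) + (length as - 1)"
    using assms by (cases as) auto
  then obtain z zs ws where xs: "xs = z # zs @ ws" "length zs = length bs"
    by (rule split_list_at) auto
  have "mset (map g (z # ws)) = mset (map g as) \<longleftrightarrow> mset (z # ws) = mset as"
    unfolding mset_map inj_eq[OF multiset.inj_map[OF assms(1)]] ..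
  then show ?thesis
    using assms xs by (simp add: lookup_row_sym inj_map_eq_map)
qed

text \<open>Subtract the combination whose coefficients are those of \<open>u\<close> at the
  semistandard positions. The difference still satisfies \<open>hook_symmetric\<close> and vanishes
  at these positions, hence everywhere by \<open>hook_symmetric_eq_0\<close>.\<close>

lemma hook_symmetric_in_span:
  fixes u :: "'b list \<Rightarrow>\<^sub>0 'f::field"
  assumes N: "1 \<le> N" and g: "inj g"
    and u: "hook_symmetric N M (lookup u)"
    and keys: "\<And>xs. xs \<in> keys u \<Longrightarrow> length xs = N + M \<and> set xs \<subseteq> g ` {..d}"
  shows "u \<in> fspace.span
    ((\<lambda>(as, bs). antisymmetrize N (row_sym (map g as, map g bs))) ` hook_ssyt M N d)"
proof -
  let ?T = "hook_ssyt M N d"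
  define A where "A = (\<lambda>(as, bs). antisymmetrize N (row_sym (map g as, map g bs)) :: 'b list \<Rightarrow>\<^sub>0 'f)"
  define c where "c = (\<lambda>(as, bs). lookup u (map g (hd as # bs @ tl as)))"
  have len: "length as = Suc M" "length bs = N - 1" "as \<noteq> []" "set as \<subseteq> {..d}" "set bs \<subseteq> {..d}"
    if "(as, bs) \<in> ?T" for as bs
    using that by (auto simp: hook_ssyt_def)
  have A: "lookup (A (as, bs)) (map g xs) = alternate N (lookup (row_sym (as, bs))) xs"
    if "(as, bs) \<in> ?T" "length xs = N + M" for as bs xs
  proof -
    have "lookup (A (as, bs)) (map g xs) =
        alternate N (\<lambda>xs. lookup (row_sym (map g as, map g bs)) (map g xs)) xs"
      unfolding A_def prod.case using that(2) by (simp add: lookup_antisymmetrize alternate_map)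
    also have "\<dots> = alternate N (lookup (row_sym (as, bs))) xs"
      unfolding alternate_def
      by (rule sum.cong[OF refl]) (use len[OF that(1)] that(2) N in \<open>simp add: lookup_row_sym_map[OF g]\<close>)
    finally show ?thesis .
  qed
  define U where "U = (\<lambda>xs. lookup u (map g xs) - (\<Sum>t\<in>?T. c t * lookup (A t) (map g xs)))"
  have U: "hook_symmetric N M U"
    unfolding U_def
  proof (rule hook_symmetric_diff[OF hook_symmetric_map[OF u] hook_symmetric_sum])
    fix t assume "t \<in> ?T"
    then obtain as bs where "t = (as, bs)" "(as, bs) \<in> ?T"
      by (cases t) auto
    then show "hook_symmetric N M (\<lambda>xs. lookup (A t) (map g xs))"
      using len by (auto simp: A_def intro!: hook_symmetric_map hook_symmetric_row_sym[OF N])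
  qed
  have U0: "U xs = 0" if "length xs = N + M" "set xs \<subseteq> {..d}" for xs
  proof (rule hook_symmetric_eq_0[OF U N _ that])
    fix as bs assume t: "(as, bs) \<in> ?T"
    have "(\<Sum>t\<in>?T. c t * lookup (A t) (map g (hd as # bs @ tl as))) =
        (\<Sum>t\<in>?T. if t = (as, bs) then c t else 0)"
    proof (rule sum.cong[OF refl])
      fix t' assume "t' \<in> ?T"
      moreover obtain as' bs' where "t' = (as', bs')" by force
      ultimately show "c t' * lookup (A t') (map g (hd as # bs @ tl as)) = (if t' = (as, bs) then c t' else 0)"
        using A[of as' bs' "hd as # bs @ tl as"] alternate_row_sym_standard[OF N _ t, where ?'f = 'f] len[OF t] N
        by auto
    qed
    also have "\<dots> = lookup u (map g (hd as # bs @ tl as))"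
      using t finite_hook_ssyt by (simp add: c_def)
    finally show "U (hd as # bs @ tl as) = 0"
      by (simp add: U_def)
  qed
  have "u = (\<Sum>t\<in>?T. cmul (c t) (A t))"
  proof (rule poly_mapping_eqI)
    fix l
    show "lookup u l = lookup (\<Sum>t\<in>?T. cmul (c t) (A t)) l"
    \<comment> \<open>\<open>U0\<close> reaches only lists of the right length with entries in the
      image of \<open>{..d}\<close>; at all others both sides have coefficient 0.\<close>
    proof (cases "length l = N + M \<and> set l \<subseteq> g ` {..d}")
      case True
      then have "l \<in> map g ` lists {..d}"
        by (auto simp: in_lists_conv_set simp flip: lists_image)
      then obtain xs where "l = map g xs" "set xs \<subseteq> {..d}"
        by auto
      then show ?thesis
        using True U0[of xs] by (simp add: U_def lookup_sum)
    next
      case False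
      have "lookup (A t) l = 0" if t: "t \<in> ?T" for t
      proof (rule ccontr)
        assume *: "lookup (A t) l \<noteq> 0"
        obtain as bs where ab: "t = (as, bs)" by force
        have "l \<in> keys (antisymmetrize N (row_sym (map g as, map g bs) :: _ \<Rightarrow>\<^sub>0 'f))"
          using * by (simp add: A_def ab in_keys_iff)
        then obtain l' \<tau> where l': "l' \<in> keys (row_sym (map g as, map g bs) :: _ \<Rightarrow>\<^sub>0 'f)"
          and \<tau>: "\<tau> permutes {..<N}" "l = permute_list \<tau> l'"
          by (rule keys_antisymmetrize)
        have "length l' = N + M" "set l' \<subseteq> g ` {..d}"
          using keys_row_sym[OF l'] len[OF t[unfolded ab]] N by auto
        moreover have "\<tau> permutes {..<length l'}"
          using permutes_lessThan_mono[OF \<tau>(1), of "length l'"] calculation by simp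
        ultimately show False
          using False \<tau>(2) by auto
      qed
      moreover have "lookup u l = 0"
        using False keys by (auto simp: in_keys_iff)
      ultimately show ?thesis
        by (simp add: lookup_sum)
    qed
  qed
  also have "\<dots> \<in> fspace.span (A ` ?T)"
    by (intro fspace.span_sum fspace.span_scale fspace.span_base) auto
  finally show ?thesis
    unfolding A_def .
qed

section \<open>Representations acting linearly on the ambient space\<close>

lemma linear_eqI:
  assumes "Vector_Spaces.linear cmul cmul f" "Vector_Spaces.linear cmul cmul h"
    and "\<And>b. f (basis_vec b) = h (basis_vec b)"
  shows "f v = h v"
  using linear_eq_lin_ext[OF assms(1), of v] linear_eq_lin_ext[OF assms(2), of v] assms(3) by simp

text \<open>\<open>representation\<close> asks for linearity on the subspace, but
  \<open>tensor_map_tensor\<close> and \<open>tensor_list_map_tensor_list\<close> ask for it on the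
  ambient space. This stronger notion passes to tensor products, tensor powers and lower symmetric
  powers.\<close>

definition linear_rep :: "'g monoid \<Rightarrow> ('g, 'b \<Rightarrow>\<^sub>0 'f::field) rep \<Rightarrow> bool" where
  "linear_rep G V \<longleftrightarrow>
     representation G V \<and> (\<forall>g\<in>carrier G. Vector_Spaces.linear cmul cmul (act V g))"

lemma linear_on_vecs_if_linear: "Vector_Spaces.linear cmul cmul f \<Longrightarrow> linear_on_vecs V f"
  unfolding linear_on_vecs_def module_hom_iff_linear[symmetric]
  by (simp add: module_hom.add module_hom.scale)

lemma linear_repI:
  assumes "fspace.subspace (vecs V)"
    and "\<And>g. g \<in> carrier G \<Longrightarrow> Vector_Spaces.linear cmul cmul (act V g)"
    and "\<And>g v. g \<in> carrier G \<Longrightarrow> v \<in> vecs V \<Longrightarrow> act V g v \<in> vecs V"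
    and "\<And>v. v \<in> vecs V \<Longrightarrow> act V \<one>\<^bsub>G\<^esub> v = v"
    and "\<And>g h v. g \<in> carrier G \<Longrightarrow> h \<in> carrier G \<Longrightarrow> v \<in> vecs V \<Longrightarrow>
      act V (g \<otimes>\<^bsub>G\<^esub> h) v = act V g (act V h v)"
  shows "linear_rep G V"
  using assms unfolding linear_rep_def representation_def by (auto intro: linear_on_vecs_if_linear)

lemma linear_repD:
  assumes "linear_rep G V"
  shows "fspace.subspace (vecs V)"
    and "g \<in> carrier G \<Longrightarrow> Vector_Spaces.linear cmul cmul (act V g)"
    and "g \<in> carrier G \<Longrightarrow> v \<in> vecs V \<Longrightarrow> act V g v \<in> vecs V"
    and "v \<in> vecs V \<Longrightarrow> act V \<one>\<^bsub>G\<^esub> v = v"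
    and "g \<in> carrier G \<Longrightarrow> h \<in> carrier G \<Longrightarrow> v \<in> vecs V \<Longrightarrow>
      act V (g \<otimes>\<^bsub>G\<^esub> h) v = act V g (act V h v)"
  using assms unfolding linear_rep_def representation_def by auto

lemma linear_eq_on_span:
  assumes f: "Vector_Spaces.linear cmul cmul f" and h: "Vector_Spaces.linear cmul cmul h"
    and eq: "\<And>v. v \<in> S \<Longrightarrow> f v = h v" and v: "v \<in> fspace.span S"
  shows "f v = h v"
proof -
  interpret f: Vector_Spaces.linear cmul cmul f by fact
  interpret h: Vector_Spaces.linear cmul cmul h by fact
  show ?thesis
    using v by (induction rule: fspace.span_induct_alt) (simp_all add: f.add f.scale h.add h.scale eq)
qed

lemma linear_span_closed:
  assumes f: "Vector_Spaces.linear cmul cmul f"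
    and S: "\<And>v. v \<in> S \<Longrightarrow> f v \<in> fspace.span T" and v: "v \<in> fspace.span S"
  shows "f v \<in> fspace.span T"
proof -
  interpret f: Vector_Spaces.linear cmul cmul f by fact
  show ?thesis
    using v
    by (induction rule: fspace.span_induct_alt)
      (simp_all add: f.add f.scale S fspace.span_zero fspace.span_add fspace.span_scale)
qed

text \<open>Closure and the two action laws are statements about linear maps, so a spanning set
  decides them.\<close>

lemma linear_rep_spanI:
  assumes G: "monoid G" and V: "vecs V = fspace.span S"
    and lin: "\<And>g. g \<in> carrier G \<Longrightarrow> Vector_Spaces.linear cmul cmul (act V g)"
    and closed: "\<And>g v. g \<in> carrier G \<Longrightarrow> v \<in> S \<Longrightarrow> act V g v \<in> fspace.span S"
    and one: "\<And>v. v \<in> S \<Longrightarrow> act V \<one>\<^bsub>G\<^esub> v = v"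
    and mult: "\<And>g h v. g \<in> carrier G \<Longrightarrow> h \<in> carrier G \<Longrightarrow> v \<in> S \<Longrightarrow>
      act V (g \<otimes>\<^bsub>G\<^esub> h) v = act V g (act V h v)"
  shows "linear_rep G V"
proof (rule linear_repI)
  show "act V g v \<in> vecs V" if "g \<in> carrier G" "v \<in> vecs V" for g v
    using linear_span_closed[OF lin closed] that V by metis
  show "act V \<one>\<^bsub>G\<^esub> v = v" if "v \<in> vecs V" for v
    using linear_eq_on_span[OF lin[OF monoid.one_closed[OF G]] fspace.linear_id, of S v] one that V by simp
  show "act V (g \<otimes>\<^bsub>G\<^esub> h) v = act V g (act V h v)"
    if g: "g \<in> carrier G" and h: "h \<in> carrier G" and v: "v \<in> vecs V" for g h v
    using linear_eq_on_span[OF lin[OF monoid.m_closed[OF G g h]] Vector_Spaces.linear_compose[OF lin[OF h] lin[OF g]], of S v]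
      mult[OF g h] v V
    by simp
qed (use V lin in auto)

lemma linear_tensor_map: "Vector_Spaces.linear cmul cmul (tensor_map f h)"
  unfolding tensor_map_def by (rule lin_ext_linear)

lemma linear_tensor_list_map: "Vector_Spaces.linear cmul cmul (tensor_list_map f)"
  unfolding tensor_list_map_def by (rule lin_ext_linear)

lemma linear_place_perm: "Vector_Spaces.linear cmul cmul (place_perm \<sigma>)"
  unfolding place_perm_def by (rule lin_ext_linear)

lemma linear_rep_tensor_rep:
  assumes G: "monoid G" and V: "linear_rep G V" and W: "linear_rep G W"
  shows "linear_rep G (tensor_rep V W)"
proof (rule linear_rep_spanI[OF G])
  let ?S = "{tensor v w | v w. v \<in> vecs V \<and> w \<in> vecs W}"
  note [simp] = tensor_map_tensor[OF linear_repD(2)[OF V] linear_repD(2)[OF W]]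
    monoid.one_closed[OF G] monoid.m_closed[OF G]
  show "vecs (tensor_rep V W) = fspace.span ?S"
    by (simp add: tensor_rep_def)
  show "act (tensor_rep V W) g x \<in> fspace.span ?S" if g: "g \<in> carrier G" and "x \<in> ?S" for g x
  proof -
    from \<open>x \<in> ?S\<close> obtain v w where x: "x = tensor v w" "v \<in> vecs V" "w \<in> vecs W"
      by blast
    with g have "act (tensor_rep V W) g x = tensor (act V g v) (act W g w)"
      by (simp add: tensor_rep_def)
    then show ?thesis
      using x g linear_repD(3)[OF V] linear_repD(3)[OF W] by (intro fspace.span_base) blast
  qed
  show "act (tensor_rep V W) \<one>\<^bsub>G\<^esub> x = x" if "x \<in> ?S" for x
    using that by (auto simp: tensor_rep_def linear_repD(4)[OF V] linear_repD(4)[OF W])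
  show "act (tensor_rep V W) (g \<otimes>\<^bsub>G\<^esub> h) x = act (tensor_rep V W) g (act (tensor_rep V W) h x)"
    if "g \<in> carrier G" "h \<in> carrier G" "x \<in> ?S" for g h x
    using that by (auto simp: tensor_rep_def linear_repD(5)[OF V] linear_repD(5)[OF W])
qed (simp add: tensor_rep_def linear_tensor_map)

lemma linear_rep_tensor_power:
  assumes G: "monoid G" and V: "linear_rep G V"
  shows "linear_rep G (tensor_power R V)"
proof (rule linear_rep_spanI[OF G])
  let ?S = "{tensor_list vs | vs. length vs = R \<and> set vs \<subseteq> vecs V}"
  note [simp] = tensor_list_map_tensor_list[OF linear_repD(2)[OF V]]
    monoid.one_closed[OF G] monoid.m_closed[OF G]
  show "vecs (tensor_power R V) = fspace.span ?S"
    by (simp add: tensor_power_def)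
  show "act (tensor_power R V) g x \<in> fspace.span ?S" if g: "g \<in> carrier G" and x: "x \<in> ?S" for g x
  proof -
    obtain vs where vs: "x = tensor_list vs" "length vs = R" "set vs \<subseteq> vecs V"
      using x by blast
    have "act (tensor_power R V) g x = tensor_list (map (act V g) vs)"
      using g by (simp add: tensor_power_def vs)
    moreover have "length (map (act V g) vs) = R" "set (map (act V g) vs) \<subseteq> vecs V"
      using vs g linear_repD(3)[OF V] by auto
    ultimately show ?thesis
      by (intro fspace.span_base) blast
  qed
  show "act (tensor_power R V) \<one>\<^bsub>G\<^esub> x = x" if x: "x \<in> ?S" for x
  proof -
    obtain vs where vs: "x = tensor_list vs" "set vs \<subseteq> vecs V"
      using x by blast
    then have "map (act V \<one>\<^bsub>G\<^esub>) vs = vs"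
      by (intro map_idI) (auto intro: linear_repD(4)[OF V])
    then show ?thesis
      by (simp add: tensor_power_def vs)
  qed
  show "act (tensor_power R V) (g \<otimes>\<^bsub>G\<^esub> h) x = act (tensor_power R V) g (act (tensor_power R V) h x)"
    if gh: "g \<in> carrier G" "h \<in> carrier G" and x: "x \<in> ?S" for g h x
  proof -
    obtain vs where vs: "x = tensor_list vs" "set vs \<subseteq> vecs V"
      using x by blast
    then have "map (act V (g \<otimes>\<^bsub>G\<^esub> h)) vs = map (act V g) (map (act V h) vs)"
      using linear_repD(5)[OF V gh] by auto
    then show ?thesis
      using gh by (simp add: tensor_power_def vs del: map_map)
  qed
qed (simp add: tensor_power_def linear_tensor_list_map)

lemma place_perm_tensor_list:
  assumes \<sigma>: "\<sigma> permutes {..<length vs}"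
  shows "place_perm \<sigma> (tensor_list vs) = tensor_list (permute_list (inv_into UNIV \<sigma>) vs)"
proof (rule poly_mapping_eqI)
  fix bs
  have inv: "inv_into UNIV \<sigma> permutes {..<length vs}"
    using \<sigma> by (rule permutes_inv)
  show "lookup (place_perm \<sigma> (tensor_list vs)) bs =
      lookup (tensor_list (permute_list (inv_into UNIV \<sigma>) vs)) bs"
  proof (cases "length bs = length vs")
    case True
    have "(\<Prod>i<length vs. lookup (vs ! i) (bs ! \<sigma> i)) =
        (\<Prod>i<length vs. lookup (vs ! inv_into UNIV \<sigma> i) (bs ! \<sigma> (inv_into UNIV \<sigma> i)))"
      by (rule prod.reindex_bij_betw[OF permutes_imp_bij[OF inv], symmetric])
    with True \<sigma> inv show ?thesis
      by (simp add: lookup_place_perm lookup_tensor_list permute_list_nth permutes_inverses)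
  next
    case False
    then have "permute_list (inv_into UNIV \<sigma>) l \<noteq> bs" if "l \<in> keys (tensor_list vs)" for l
      using that by (auto simp: in_keys_iff lookup_tensor_list split: if_splits)
    then have "lookup (place_perm \<sigma> (tensor_list vs)) bs = 0"
      unfolding place_perm_def lookup_lin_ext_basis_vec by (intro sum.neutral) auto
    with False show ?thesis
      by (simp add: lookup_tensor_list)
  qed
qed

text \<open>Makes the symmetric tensors stable under the diagonal action. The tensor is taken from
  the \<open>R\<close>-th power because the place permutation is understood on lists of length
  \<open>R\<close>.\<close>

lemma place_perm_tensor_list_map:
  assumes f: "Vector_Spaces.linear cmul cmul f" and \<sigma>: "\<sigma> permutes {..<R}"
    and w: "w \<in> vecs (tensor_power R V)"
  shows "place_perm \<sigma> (tensor_list_map f w) = tensor_list_map f (place_perm \<sigma> w)"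
proof -
  have "(place_perm \<sigma> \<circ> tensor_list_map f) w = (tensor_list_map f \<circ> place_perm \<sigma>) w"
  proof (rule linear_eq_on_span[where f = "place_perm \<sigma> \<circ> tensor_list_map f"
        and h = "tensor_list_map f \<circ> place_perm \<sigma>"])
    show "w \<in> fspace.span {tensor_list vs | vs. length vs = R \<and> set vs \<subseteq> vecs V}"
      using w by (simp add: tensor_power_def)
    fix x assume "x \<in> {tensor_list vs | vs. length vs = R \<and> set vs \<subseteq> vecs V}"
    then obtain vs where "x = tensor_list vs" "length vs = R"
      by blast
    then show "(place_perm \<sigma> \<circ> tensor_list_map f) x = (tensor_list_map f \<circ> place_perm \<sigma>) x"
      using \<sigma> permutes_inv[OF \<sigma>]
      by (simp add: place_perm_tensor_list tensor_list_map_tensor_list[OF f] permute_list_map)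
  qed (intro Vector_Spaces.linear_compose[of cmul cmul _ cmul] linear_place_perm linear_tensor_list_map)+
  then show ?thesis
    by simp
qed

lemma linear_rep_lower_sym:
  assumes G: "monoid G" and V: "linear_rep G V"
  shows "linear_rep G (lower_sym R V)"
proof (rule linear_repI)
  note T = linear_rep_tensor_power[OF G V, of R]
  interpret place_perm: Vector_Spaces.linear cmul cmul "place_perm \<sigma>" for \<sigma>
    by (rule linear_place_perm)
  show "fspace.subspace (vecs (lower_sym R V))"
    using linear_repD(1)[OF T]
    by (auto simp: lower_sym_def fspace.subspace_def place_perm.zero place_perm.add place_perm.scale)
  show "act (lower_sym R V) g v \<in> vecs (lower_sym R V)"
    if "g \<in> carrier G" "v \<in> vecs (lower_sym R V)" for g v
    using that linear_repD(3)[OF T that(1), of v]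
      place_perm_tensor_list_map[OF linear_repD(2)[OF V that(1)], of _ R v V]
    by (auto simp: lower_sym_def) (simp add: tensor_power_def)
qed (use linear_repD[OF linear_rep_tensor_power[OF G V, of R]] in \<open>auto simp: lower_sym_def\<close>)

section \<open>Polynomials under linear substitution\<close>

lemma cmul_conv_mult: "cmul c (p :: 'b::monoid_add \<Rightarrow>\<^sub>0 'f::field) = Poly_Mapping.single 0 c * p"
  unfolding cmul_def by (rule mult_map_scale_conv_mult)

lemma linear_mult_right: "Vector_Spaces.linear cmul cmul (\<lambda>p. p * q :: 'b::comm_monoid_add \<Rightarrow>\<^sub>0 'f::field)"
  by unfold_locales (simp_all add: cmul_conv_mult algebra_simps)

lemma linear_mult_left: "Vector_Spaces.linear cmul cmul (\<lambda>p. q * p :: 'b::comm_monoid_add \<Rightarrow>\<^sub>0 'f::field)"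
  by unfold_locales (simp_all add: cmul_conv_mult algebra_simps)

lemma basis_vec_mult: "basis_vec a * basis_vec b = basis_vec (a + b)"
  by (simp add: basis_vec_def mult_single)

lemma basis_vec_0: "basis_vec 0 = 1"
  by (simp add: basis_vec_def)

lemma linear_subst2: "Vector_Spaces.linear cmul cmul (subst2 P Q)"
  unfolding subst2_def by (rule lin_ext_linear)

lemma subst2_basis_vec: "subst2 P Q (basis_vec (i, j)) = P ^ i * Q ^ j"
  by (simp add: subst2_def)

text \<open>Both sides are linear in each factor separately and agree on monomials.\<close>

lemma subst2_mult: "subst2 P Q (p * q) = subst2 P Q p * subst2 P Q q"
proof -
  have 1: "(subst2 P Q \<circ> (\<lambda>q. basis_vec a * q)) q = ((\<lambda>q. subst2 P Q (basis_vec a) * q) \<circ> subst2 P Q) q" for a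
  proof (rule linear_eqI[where f = "subst2 P Q \<circ> (\<lambda>q. basis_vec a * q)"
        and h = "(\<lambda>q. subst2 P Q (basis_vec a) * q) \<circ> subst2 P Q"])
    fix b
    show "(subst2 P Q \<circ> (\<lambda>q. basis_vec a * q)) (basis_vec b) =
        ((\<lambda>q. subst2 P Q (basis_vec a) * q) \<circ> subst2 P Q) (basis_vec b)"
      by (cases a; cases b) (simp add: basis_vec_mult subst2_basis_vec power_add algebra_simps)
  qed (intro Vector_Spaces.linear_compose[of cmul cmul _ cmul] linear_subst2 linear_mult_left)+
  have "(subst2 P Q \<circ> (\<lambda>p. p * q)) p = ((\<lambda>p. p * subst2 P Q q) \<circ> subst2 P Q) p"
  proof (rule linear_eqI[where f = "subst2 P Q \<circ> (\<lambda>p. p * q)"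
        and h = "(\<lambda>p. p * subst2 P Q q) \<circ> subst2 P Q"])
    show "(subst2 P Q \<circ> (\<lambda>p. p * q)) (basis_vec a) =
        ((\<lambda>p. p * subst2 P Q q) \<circ> subst2 P Q) (basis_vec a)" for a
      using 1[of a] by simp
  qed (intro Vector_Spaces.linear_compose[of cmul cmul _ cmul] linear_subst2 linear_mult_right)+
  then show ?thesis
    by simp
qed

lemma subst2_power: "subst2 P Q (p ^ n) = subst2 P Q p ^ n"
proof (induction n)
  case 0
  have "subst2 P Q (basis_vec (0, 0)) = 1"
    by (simp add: subst2_basis_vec)
  then show ?case
    by (simp add: zero_prod_def[symmetric] basis_vec_0)
qed (simp add: subst2_mult)

lemma subst2_subst2: "subst2 P Q (subst2 P' Q' v) = subst2 (subst2 P Q P') (subst2 P Q Q') v"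
proof -
  have "(subst2 P Q \<circ> subst2 P' Q') v = subst2 (subst2 P Q P') (subst2 P Q Q') v"
  proof (rule linear_eqI[where f = "subst2 P Q \<circ> subst2 P' Q'"])
    fix b
    show "(subst2 P Q \<circ> subst2 P' Q') (basis_vec b) = subst2 (subst2 P Q P') (subst2 P Q Q') (basis_vec b)"
      by (cases b) (simp add: subst2_basis_vec subst2_mult subst2_power)
  qed (intro Vector_Spaces.linear_compose[of cmul cmul _ cmul] linear_subst2)+
  then show ?thesis
    by simp
qed

lemma pX_power_mult_pY_power: "pX ^ i * pY ^ j = (basis_vec (i, j) :: _ \<Rightarrow>\<^sub>0 'f::field)"
proof -
  have "pX ^ i = (basis_vec (i, 0) :: _ \<Rightarrow>\<^sub>0 'f)" for i
    by (induction i) (simp_all add: pX_def basis_vec_mult zero_prod_def[symmetric] basis_vec_0)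
  moreover have "pY ^ j = (basis_vec (0, j) :: _ \<Rightarrow>\<^sub>0 'f)" for j
    by (induction j) (simp_all add: pY_def basis_vec_mult zero_prod_def[symmetric] basis_vec_0)
  ultimately show ?thesis
    by (simp add: basis_vec_mult)
qed

lemma subst2_pX_pY: "subst2 pX pY v = v"
proof -
  have "subst2 pX pY v = id v"
    by (rule linear_eqI[OF linear_subst2 fspace.linear_id])
      (auto simp: subst2_def pX_power_mult_pY_power)
  then show ?thesis
    by simp
qed

definition homogeneous :: "nat \<Rightarrow> (nat \<times> nat \<Rightarrow>\<^sub>0 'f::field) \<Rightarrow> bool" where
  "homogeneous d p \<longleftrightarrow> (\<forall>(i, j)\<in>keys p. i + j = d)"

lemma subspace_homogeneous: "fspace.subspace {p. homogeneous d p}"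
  unfolding fspace.subspace_def homogeneous_def
proof (intro conjI allI ballI impI)
  fix p q :: "nat \<times> nat \<Rightarrow>\<^sub>0 'a"
  assume "p \<in> {p. \<forall>(i, j)\<in>keys p. i + j = d}" "q \<in> {p. \<forall>(i, j)\<in>keys p. i + j = d}"
  then show "p + q \<in> {p. \<forall>(i, j)\<in>keys p. i + j = d}"
    using keys_add[of p q] by blast
next
  fix c and p :: "nat \<times> nat \<Rightarrow>\<^sub>0 'a"
  assume "p \<in> {p. \<forall>(i, j)\<in>keys p. i + j = d}"
  moreover have "keys (cmul c p) \<subseteq> keys p"
    by (auto simp: in_keys_iff)
  ultimately show "cmul c p \<in> {p. \<forall>(i, j)\<in>keys p. i + j = d}"
    by blast
qed simp

lemma homogeneous_mult: "homogeneous d p \<Longrightarrow> homogeneous e q \<Longrightarrow> homogeneous (d + e) (p * q)"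
  unfolding homogeneous_def using keys_mult[of p q] by fastforce

lemma homogeneous_power: "homogeneous d p \<Longrightarrow> homogeneous (d * n) (p ^ n)"
proof (induction n)
  case 0
  then show ?case
    by (simp add: homogeneous_def zero_prod_def)
next
  case (Suc n)
  then show ?case
    using homogeneous_mult[of d p "d * n" "p ^ n"] by simp
qed

lemma homogeneous_subst2:
  assumes "homogeneous 1 P" "homogeneous 1 Q" "homogeneous d p"
  shows "homogeneous d (subst2 P Q p)"
proof -
  have "subst2 P Q p \<in> {p. homogeneous d p}"
    unfolding subst2_def lin_ext_def
  proof (intro fspace.subspace_sum fspace.subspace_scale subspace_homogeneous)
    fix a assume "a \<in> keys p"
    moreover obtain i j where a: "a = (i, j)" by force
    ultimately have "d = 1 * i + 1 * j"
      using assms(3) by (auto simp: homogeneous_def)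
    then have "homogeneous d (P ^ i * Q ^ j)"
      using assms by (simp only: homogeneous_mult homogeneous_power)
    then show "(case a of (i, j) \<Rightarrow> P ^ i * Q ^ j) \<in> {p. homogeneous d p}"
      by (simp add: a)
  qed
  then show ?thesis
    by simp
qed

lemma homogeneous_linear_form: "homogeneous 1 (cmul a pX + cmul b pY)"
proof -
  have "cmul a pX \<in> {p. homogeneous 1 p}" "cmul b pY \<in> {p. homogeneous 1 p}"
    by (intro fspace.subspace_scale subspace_homogeneous;
        simp add: homogeneous_def pX_def pY_def basis_vec_def)+
  then have "cmul a pX + cmul b pY \<in> {p. homogeneous 1 p}"
    by (rule fspace.subspace_add[OF subspace_homogeneous])
  then show ?thesis
    by simp
qed

lemma monoid_GL2: "monoid (GL2 :: ('f::field ^ 2 ^ 2) monoid)"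
  unfolding monoid_def GL2_def
  by (auto simp: matrix_mul_assoc invertible_mult) (simp add: invertible_def exI[of _ "mat 1"])

lemma linear_rep_upper_sym: "linear_rep (GL2 :: ('f::field ^ 2 ^ 2) monoid) (upper_sym d)"
proof (rule linear_repI)
  have vecs: "vecs (upper_sym d) = {p :: _ \<Rightarrow>\<^sub>0 'f. homogeneous d p}"
    by (simp add: upper_sym_def homogeneous_def)
  show "fspace.subspace (vecs (upper_sym d) :: (_ \<Rightarrow>\<^sub>0 'f) set)"
    unfolding vecs by (rule subspace_homogeneous)
  show "act (upper_sym d) g v \<in> vecs (upper_sym d)"
    if "v \<in> vecs (upper_sym d)" for g :: "'f ^ 2 ^ 2" and v
    using that unfolding vecs
    by (simp add: upper_sym_def homogeneous_subst2[OF homogeneous_linear_form homogeneous_linear_form])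
  show "act (upper_sym d) \<one>\<^bsub>GL2\<^esub> v = v" for v :: "_ \<Rightarrow>\<^sub>0 'f"
    by (simp add: upper_sym_def GL2_def mat_def subst2_pX_pY)
  \<comment> \<open>The linear forms are read from the columns of a matrix. Substituting the forms
    of \<open>g\<close> into those of \<open>h\<close> therefore gives the forms of the product of
    \<open>g\<close> and \<open>h\<close> in this order, that is, a left action.\<close>
  show "act (upper_sym d) (g \<otimes>\<^bsub>GL2\<^esub> h) v = act (upper_sym d) g (act (upper_sym d) h v)"
    for g h :: "'f ^ 2 ^ 2" and v
  proof -
    interpret subst2: Vector_Spaces.linear cmul cmul "subst2 P Q" for P Q :: "_ \<Rightarrow>\<^sub>0 'f"
      by (rule linear_subst2)
    have "subst2 P Q pX = P" "subst2 P Q pY = Q" for P Q :: "_ \<Rightarrow>\<^sub>0 'f"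
      by (simp_all add: pX_def pY_def subst2_basis_vec)
    then show ?thesis
      by (simp add: upper_sym_def GL2_def subst2_subst2 subst2.add subst2.scale
          matrix_matrix_mult_def sum_2 fspace.scale_right_distrib fspace.scale_left_distrib
          algebra_simps)
  qed
qed (simp add: upper_sym_def linear_subst2)

lemma linear_rep_det_rep: "linear_rep (GL2 :: ('f::field ^ 2 ^ 2) monoid) det_rep"
  by (rule linear_repI)
    (simp_all add: det_rep_def GL2_def det_mul fspace.linear_scale_self fspace.subspace_UNIV)

section \<open>Zeros of polynomials and Vandermonde determinants\<close>

definition bounded_lists :: "nat \<Rightarrow> nat \<Rightarrow> nat list set" where
  "bounded_lists n D = {l. set l \<subseteq> {..D} \<and> length l = n}"

lemma finite_bounded_lists: "finite (bounded_lists n D)"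
  unfolding bounded_lists_def by (rule finite_lists_length_eq) simp

lemma bounded_lists_Suc: "bounded_lists (Suc n) D = (\<lambda>(k, l). k # l) ` ({..D} \<times> bounded_lists n D)"
  unfolding bounded_lists_def by (auto simp: length_Suc_conv image_iff)

text \<open>In the induction step the last \<open>n\<close> points are fixed. The sum is then a
  polynomial of degree at most \<open>D\<close> in the first point and vanishes on the rest of
  \<open>S\<close>, which has more than \<open>D\<close> elements since \<open>S\<close> has at
  least \<open>D + n + 1\<close>. So its coefficients vanish at all tuples of \<open>n\<close>
  distinct points.\<close>

lemma multivariate_poly_eq_0:
  fixes c :: "nat list \<Rightarrow> 'k::field"
  assumes "finite S \<Longrightarrow> D + n \<le> card S"
    and "\<And>ys. length ys = n \<Longrightarrow> distinct ys \<Longrightarrow> set ys \<subseteq> S \<Longrightarrow>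
      (\<Sum>l\<in>bounded_lists n D. c l * (\<Prod>i<n. ys ! i ^ (l ! i))) = 0"
    and "l \<in> bounded_lists n D"
  shows "c l = 0"
  using assms
proof (induction n arbitrary: c l)
  case 0
  have "bounded_lists 0 D = {[]}"
    by (auto simp: bounded_lists_def)
  with "0.prems"(2)[of "[]"] "0.prems"(3) show ?case
    by simp
next
  case (Suc n)
  obtain k l' where l: "l = k # l'" "k \<le> D" "l' \<in> bounded_lists n D"
    using Suc.prems(3) by (auto simp: bounded_lists_Suc)
  have "c (k # l') = 0"
  proof (rule Suc.IH[of "\<lambda>l. c (k # l)"])
    show "D + n \<le> card S" if "finite S"
      using Suc.prems(1)[OF that] by simp
    show "l' \<in> bounded_lists n D" by fact
    fix ys :: "'k list"
    assume ys: "length ys = n" "distinct ys" "set ys \<subseteq> S"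
    define C where "C k = (\<Sum>l\<in>bounded_lists n D. c (k # l) * (\<Prod>i<n. ys ! i ^ (l ! i)))" for k
    define p where "p = (\<Sum>k\<le>D. monom (C k) k)"
    have "\<exists>A\<subseteq>S - set ys. card A = Suc D"
    proof (cases "finite S")
      case True
      then have "Suc D \<le> card (S - set ys)"
        using Suc.prems(1) ys by (simp add: card_Diff_subset distinct_card)
      then show ?thesis
        by (meson obtain_subset_with_card_n)
    next
      case False
      then show ?thesis
        by (metis Diff_infinite_finite finite_set infinite_arbitrarily_large)
    qed
    then obtain A where A: "A \<subseteq> S - set ys" "card A = Suc D"
      by blast
    have "poly p y = 0" if "y \<in> A" for y
    proof -
      have "poly p y = (\<Sum>k\<le>D. \<Sum>l\<in>bounded_lists n D. c (k # l) * (\<Prod>i<Suc n. (y # ys) ! i ^ ((k # l) ! i)))"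
        by (simp add: p_def C_def poly_sum poly_monom sum_distrib_left sum_distrib_right
            prod.lessThan_Suc_shift mult_ac del: prod.lessThan_Suc)
      also have "\<dots> = (\<Sum>l\<in>bounded_lists (Suc n) D. c l * (\<Prod>i<Suc n. (y # ys) ! i ^ (l ! i)))"
        unfolding bounded_lists_Suc
        by (subst sum.reindex) (auto simp: inj_on_def sum.cartesian_product case_prod_unfold)
      also have "\<dots> = 0"
        using ys A(1) that by (intro Suc.prems(2)) auto
      finally show ?thesis .
    qed
    moreover have "Polynomial.degree p \<le> D"
      unfolding p_def
      by (intro degree_sum_le) (auto intro: order.trans[OF degree_monom_le])
    ultimately have "p = 0"
      using A(2) by (intro poly_eqI_degree[of A]) auto
    then have "Polynomial.coeff p k = 0"
      by simp
    then show "(\<Sum>l\<in>bounded_lists n D. c (k # l) * (\<Prod>i<n. ys ! i ^ (l ! i))) = 0"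
      using l(2) by (simp add: p_def coeff_sum C_def)
  qed
  then show ?case
    by (simp add: l)
qed

text \<open>The Leibniz expansion of the determinant with entries \<open>y j ^ i\<close>, kept as a
  sum because antisymmetrizing the diagonal monomial yields it in this form.\<close>

definition vandermonde :: "nat \<Rightarrow> (nat \<Rightarrow> 'a::comm_ring_1) \<Rightarrow> 'a" where
  "vandermonde n y = (\<Sum>\<sigma> | \<sigma> permutes {..<n}. of_int (sign \<sigma>) * (\<Prod>i<n. y (\<sigma> i) ^ i))"

lemma vandermonde_cong:
  assumes "\<And>i. i < n \<Longrightarrow> x i = y i"
  shows "vandermonde n x = vandermonde n y"
proof -
  have "(\<Prod>i<n. x (\<sigma> i) ^ i) = (\<Prod>i<n. y (\<sigma> i) ^ i)" if "\<sigma> permutes {..<n}" for \<sigma>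
    using assms permutes_in_image[OF that] by (intro prod.cong) auto
  then show ?thesis
    unfolding vandermonde_def by (intro sum.cong) auto
qed

text \<open>Groups the permutations by the index \<open>b\<close> that receives the top exponent
  \<open>n\<close>. Splitting off the transposition of \<open>n\<close> and \<open>b\<close> leaves
  permutations of \<open>{..<n}\<close>, for which \<open>y n\<close> stands in for
  \<open>y b\<close>.\<close>

lemma vandermonde_Suc:
  "vandermonde (Suc n) y = vandermonde n y * y n ^ n - (\<Sum>b<n. vandermonde n (y(b := y n)) * y b ^ n)"
proof -
  let ?P = "{\<sigma>. \<sigma> permutes {..<n}}"
  have *: "(\<Sum>\<sigma>\<in>?P. of_int (sign (Transposition.transpose n b \<circ> \<sigma>)) *
        (\<Prod>i<Suc n. y ((Transposition.transpose n b \<circ> \<sigma>) i) ^ i)) =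
      of_int (sign (Transposition.transpose n b)) * (vandermonde n (y(b := y n)) * y b ^ n)" if "b \<le> n" for b
    unfolding vandermonde_def sum_distrib_left sum_distrib_right
  proof (rule sum.cong[OF refl])
    fix \<sigma> assume "\<sigma> \<in> ?P"
    then have \<sigma>: "\<sigma> permutes {..<n}" by simp
    have "y (Transposition.transpose n b (\<sigma> i)) = (y(b := y n)) (\<sigma> i)" if "i < n" for i
      using permutes_in_image[OF \<sigma>, of i] that by (auto simp: Transposition.transpose_def)
    then have "(\<Prod>i<n. y (Transposition.transpose n b (\<sigma> i)) ^ i) = (\<Prod>i<n. (y(b := y n)) (\<sigma> i) ^ i)"
      by (intro prod.cong) auto
    moreover have "Transposition.transpose n b (\<sigma> n) = b"
      using permutes_not_in[OF \<sigma>, of n] by simp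
    moreover have "sign (Transposition.transpose n b \<circ> \<sigma>) = sign (Transposition.transpose n b) * sign \<sigma>"
      by (intro sign_compose permutation_swap_id permutes_imp_permutation[OF _ \<sigma>]) simp
    ultimately show "of_int (sign (Transposition.transpose n b \<circ> \<sigma>)) *
        (\<Prod>i<Suc n. y ((Transposition.transpose n b \<circ> \<sigma>) i) ^ i) =
      of_int (sign (Transposition.transpose n b)) *
        (of_int (sign \<sigma>) * (\<Prod>i<n. (y(b := y n)) (\<sigma> i) ^ i) * y b ^ n)"
      by (simp only: comp_apply prod.lessThan_Suc of_int_mult mult_ac)
  qed
  have "vandermonde (Suc n) y = (\<Sum>b\<in>insert n {..<n}. \<Sum>\<sigma>\<in>?P. of_int (sign (Transposition.transpose n b \<circ> \<sigma>)) *
        (\<Prod>i<Suc n. y ((Transposition.transpose n b \<circ> \<sigma>) i) ^ i))"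
    using sum_over_permutations_insert[of "{..<n}" n
        "\<lambda>\<sigma>. of_int (sign \<sigma>) * (\<Prod>i<Suc n. y (\<sigma> i) ^ i)"]
    by (simp add: vandermonde_def lessThan_Suc)
  also have "\<dots> = (\<Sum>b\<in>insert n {..<n}. of_int (sign (Transposition.transpose n b)) *
      (vandermonde n (y(b := y n)) * y b ^ n))"
    by (rule sum.cong[OF refl], rule *) auto
  also have "\<dots> = vandermonde n y * y n ^ n +
      (\<Sum>b<n. of_int (sign (Transposition.transpose n b)) * (vandermonde n (y(b := y n)) * y b ^ n))"
    by simp
  also have "(\<Sum>b<n. of_int (sign (Transposition.transpose n b)) * (vandermonde n (y(b := y n)) * y b ^ n)) =
      (\<Sum>b<n. - (vandermonde n (y(b := y n)) * y b ^ n))"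
    by (rule sum.cong[OF refl]) (simp add: sign_swap_id)
  finally show ?thesis
    by (simp add: sum_negf)
qed

lemma vandermonde_eq_0:
  assumes "a < n" "b < n" "a \<noteq> b" "y a = y b"
  shows "vandermonde n y = 0"
  unfolding vandermonde_def
proof (rule sum_sign_permutes_eq_0[of _ a b])
  have "y (Transposition.transpose a b i) = y i" for i
    using assms by (auto simp: Transposition.transpose_def)
  then show "(\<forall>\<sigma>. \<sigma> permutes {..<n} \<longrightarrow>
      (\<Prod>i<n. y ((Transposition.transpose a b \<circ> \<sigma>) i) ^ i) = (\<Prod>i<n. y (\<sigma> i) ^ i)) \<or>
    (\<forall>\<sigma>. \<sigma> permutes {..<n} \<longrightarrow>
      (\<Prod>i<n. y ((\<sigma> \<circ> Transposition.transpose a b) i) ^ i) = (\<Prod>i<n. y (\<sigma> i) ^ i))"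
    by simp
qed (use assms in auto)

lemma poly_vandermonde: "poly (vandermonde n Y) t = vandermonde n (\<lambda>i. poly (Y i) t)"
  by (simp add: vandermonde_def poly_sum poly_prod)

text \<open>In each term of the Leibniz expansion \<open>Y b\<close> occurs in a single factor, with
  exponent at most \<open>n - 1\<close>.\<close>

lemma degree_vandermonde_le:
  fixes Y :: "nat \<Rightarrow> 'k::field poly"
  assumes b: "b < n" and Y: "\<And>i. i \<noteq> b \<Longrightarrow> Polynomial.degree (Y i) = 0" "Polynomial.degree (Y b) \<le> 1"
  shows "Polynomial.degree (vandermonde n Y) \<le> n - 1"
  unfolding vandermonde_def
proof (rule degree_sum_le)
  fix \<sigma> assume "\<sigma> \<in> {\<sigma>. \<sigma> permutes {..<n}}"
  then have \<sigma>: "\<sigma> permutes {..<n}" by simp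
  let ?j = "inv_into UNIV \<sigma> b"
  have j: "\<sigma> i = b \<longleftrightarrow> i = ?j" for i
    by (metis \<sigma> permutes_inv_eq)
  have "?j < n"
    using permutes_in_image[OF permutes_inv[OF \<sigma>], of b] b by simp
  have "Polynomial.degree (Y (\<sigma> i) ^ i) \<le> (if i = ?j then i else 0)" for i
  proof (cases "i = ?j")
    case True
    have "Polynomial.degree (Y b ^ i) \<le> Polynomial.degree (Y b) * i"
      by (rule degree_power_le)
    also have "\<dots> \<le> 1 * i"
      using Y(2) by (rule mult_le_mono1)
    finally show ?thesis
      using True j[of i] by simp
  next
    case False
    then show ?thesis
      using degree_power_le[of "Y (\<sigma> i)" i] Y(1) j[of i] by simp
  qed
  then have "(\<Sum>i<n. Polynomial.degree (Y (\<sigma> i) ^ i)) \<le> (\<Sum>i<n. if i = ?j then i else 0)"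
    by (intro sum_mono) auto
  also have "\<dots> \<le> n - 1"
    using \<open>?j < n\<close> by simp
  finally have "Polynomial.degree (\<Prod>i<n. Y (\<sigma> i) ^ i) \<le> n - 1"
    using degree_prod_sum_le[of "{..<n}" "\<lambda>i. Y (\<sigma> i) ^ i"] by simp
  moreover have "Polynomial.degree (of_int (sign \<sigma>) :: 'k poly) = 0"
    by simp
  ultimately show "Polynomial.degree (of_int (sign \<sigma>) * (\<Prod>i<n. Y (\<sigma> i) ^ i)) \<le> n - 1"
    using degree_mult_le[of "of_int (sign \<sigma>)" "\<Prod>i<n. Y (\<sigma> i) ^ i"] by simp
qed (simp add: finite_permutations)

text \<open>
  As a polynomial in the last variable, the determinant has the other variables as roots, and its
  leading coefficient is the determinant in the other variables.
\<close>

lemma vandermonde_Suc_prod: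
  fixes y :: "nat \<Rightarrow> 'k::field"
  assumes "inj_on y {..<n}"
  shows "vandermonde (Suc n) y = vandermonde n y * (\<Prod>i<n. y n - y i)"
proof -
  define Y where "Y = (\<lambda>i. if i = n then [:0, 1:] else [:y i:])"
  define p where "p = vandermonde (Suc n) Y"
  define q where "q = [:vandermonde n y:] * (\<Prod>i<n. [:- y i, 1:])"
  have cst: "vandermonde n Y = [:vandermonde n y:]"
  proof -
    have "(\<Prod>i<m. [:z (\<sigma> i) :] ^ i) = [:\<Prod>i<m. z (\<sigma> i) ^ i:]" for m and z :: "nat \<Rightarrow> 'k" and \<sigma>
      by (induction m) (simp_all add: poly_const_pow one_pCons mult.commute)
    then have "vandermonde n (\<lambda>i. [:y i:]) = [:vandermonde n y:]"
      unfolding vandermonde_def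
      by (simp add: of_int_poly mult.commute flip: sum_to_poly)
    moreover have "vandermonde n Y = vandermonde n (\<lambda>i. [:y i:])"
      by (rule vandermonde_cong) (simp add: Y_def)
    ultimately show ?thesis by simp
  qed
  have Ypow: "Y b ^ n = [:y b ^ n:]" if "b < n" for b
    using that by (simp add: Y_def poly_const_pow)
  have p: "p = [:vandermonde n y:] * [:0, 1:] ^ n - (\<Sum>b<n. vandermonde n (Y(b := Y n)) * [:y b ^ n:])"
    unfolding p_def vandermonde_Suc cst using Ypow by (simp add: Y_def)
  have deg: "Polynomial.degree (vandermonde n (Y(b := Y n)) * [:y b ^ n:]) \<le> n - 1" if "b < n" for b
  proof -
    \<comment> \<open>\<open>Y(b := Y n)\<close> has the variable at \<open>b\<close> and at
      \<open>n\<close>, but the determinant reads only the indices below \<open>n\<close>. A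
      constant at \<open>n\<close> brings it into the form that \<open>degree_vandermonde_le\<close>
      asks for.\<close>
    have "Polynomial.degree (vandermonde n (Y(b := Y n))) = Polynomial.degree (vandermonde n ((Y(n := [:y n:]))(b := Y n)))"
      using that by (intro arg_cong[of _ _ Polynomial.degree] vandermonde_cong) auto
    also have "\<dots> \<le> n - 1"
      by (rule degree_vandermonde_le[OF that]) (auto simp: Y_def)
    finally show ?thesis
      using degree_mult_le[of "vandermonde n (Y(b := Y n))" "[:y b ^ n:]"] by simp
  qed
  have deg': "Polynomial.degree (\<Sum>b<n. vandermonde n (Y(b := Y n)) * [:y b ^ n:]) \<le> n - 1"
    by (rule degree_sum_le) (use deg in auto)
  have prod: "Polynomial.degree (\<Prod>i<n. [:- y i, 1:]) = n"
    by (simp add: degree_prod_eq_sum_degree)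
  have "Polynomial.lead_coeff (\<Prod>i<n. [:- y i, 1:]) = 1"
    unfolding lead_coeff_prod by simp
  then have lead: "Polynomial.coeff (\<Prod>i<n. [:- y i, 1:]) n = 1"
    by (simp only: prod)
  have coeff0: "Polynomial.coeff (\<Sum>b<n. vandermonde n (Y(b := Y n)) * [:y b ^ n:]) n = 0"
  \<comment> \<open>The bound \<open>n - 1\<close> is below \<open>n\<close> only for positive
    \<open>n\<close>; for \<open>n = 0\<close> the sum is empty.\<close>
  proof (cases "n = 0")
    case False
    then show ?thesis
      using deg' by (intro coeff_eq_0) auto
  qed simp
  have pw: "[:0, 1:] ^ n = (monom 1 n :: 'k poly)"
    by (simp add: monom_altdef)
  have "p = q"
  proof (rule poly_eqI_degree_lead_coeff[of _ n _ "y ` {..<n}"])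
    show "Polynomial.coeff p n = Polynomial.coeff q n"
      unfolding p q_def coeff_diff coeff0 pw by (simp add: lead)
    show "n \<le> card (y ` {..<n})"
      using assms by (simp add: card_image)
    show "Polynomial.degree p \<le> n"
      unfolding p pw by (intro degree_diff_le) (use deg' in \<open>auto intro: order.trans[OF degree_smult_le] simp: degree_monom_eq\<close>)
    show "Polynomial.degree q \<le> n"
      using prod by (auto simp: q_def intro: order.trans[OF degree_smult_le])
    fix z assume "z \<in> y ` {..<n}"
    then obtain j where j: "j < n" "z = y j"
      by auto
    have "poly p z = 0"
      unfolding p_def poly_vandermonde using j by (intro vandermonde_eq_0[of j _ n]) (auto simp: Y_def)
    moreover have "poly q z = 0"
      using j by (auto simp: q_def poly_prod)
    ultimately show "poly p z = poly q z"
      by simp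
  qed
  then have "poly p (y n) = poly q (y n)"
    by simp
  moreover have "poly p (y n) = vandermonde (Suc n) y"
    unfolding p_def poly_vandermonde by (rule vandermonde_cong) (simp add: Y_def)
  ultimately show ?thesis
    by (simp add: q_def poly_prod)
qed

lemma vandermonde_eq_prod:
  fixes y :: "nat \<Rightarrow> 'k::field"
  assumes "inj_on y {..<n}"
  shows "vandermonde n y = (\<Prod>j<n. \<Prod>i<j. y j - y i)"
  using assms
proof (induction n)
  case 0
  then show ?case
    by (simp add: vandermonde_def)
next
  case (Suc n)
  have "inj_on y {..<n}"
    using Suc.prems by (rule inj_on_subset) auto
  then show ?case
    using Suc.IH by (simp add: vandermonde_Suc_prod)
qed

lemma vandermonde_neq_0:
  fixes y :: "nat \<Rightarrow> 'k::field"
  assumes "inj_on y {..<n}"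
  shows "vandermonde n y \<noteq> 0"
  unfolding vandermonde_eq_prod[OF assms] using assms by (force simp: inj_on_def)

text \<open>Each index belongs to \<open>n - 1\<close> of the pairs \<open>i < j\<close>.\<close>

lemma prod_prod_less_mult:
  fixes q :: "nat \<Rightarrow> 'k::comm_monoid_mult"
  shows "(\<Prod>j<n. \<Prod>i<j. q j * q i) = (\<Prod>i<n. q i ^ (n - 1))"
proof (induction n)
  case (Suc n)
  have "(\<Prod>i<n. q i ^ (n - 1)) * ((q n) ^ n * (\<Prod>i<n. q i)) = (\<Prod>i<n. q i ^ n) * q n ^ n"
  proof (cases n)
    case (Suc m)
    then show ?thesis
      by (simp add: prod.distrib mult_ac)
  qed simp
  moreover have "(\<Prod>j<Suc n. \<Prod>i<j. q j * q i) = (\<Prod>j<n. \<Prod>i<j. q j * q i) * (q n ^ n * (\<Prod>i<n. q i))"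
    by (simp add: prod.distrib mult_ac)
  ultimately show ?case
    by (simp add: Suc.IH)
qed simp

text \<open>The Vandermonde determinant at points of the projective line. Homogeneous coordinates
  are there because a matrix does not preserve the form \<open>(1, y)\<close>.\<close>

definition hvandermonde :: "nat \<Rightarrow> (nat \<Rightarrow> 'a \<times> 'a) \<Rightarrow> 'a::comm_ring_1" where
  "hvandermonde n p = (\<Sum>\<sigma> | \<sigma> permutes {..<n}. of_int (sign \<sigma>) *
     (\<Prod>i<n. fst (p (\<sigma> i)) ^ (n - 1 - i) * snd (p (\<sigma> i)) ^ i))"

lemma hvandermonde_affine: "hvandermonde n (\<lambda>i. (1, y i)) = vandermonde n y"
  by (simp add: hvandermonde_def vandermonde_def)

text \<open>Every term has total exponent \<open>n - 1\<close> in each point, so the first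
  coordinates can be factored out.\<close>

lemma hvandermonde_scale:
  fixes x y :: "nat \<Rightarrow> 'k::field"
  assumes x: "\<And>i. i < n \<Longrightarrow> x i \<noteq> 0"
  shows "hvandermonde n (\<lambda>i. (x i, y i)) = (\<Prod>i<n. x i ^ (n - 1)) * vandermonde n (\<lambda>i. y i / x i)"
  unfolding hvandermonde_def vandermonde_def sum_distrib_left
proof (rule sum.cong[OF refl])
  fix \<sigma> assume "\<sigma> \<in> {\<sigma>. \<sigma> permutes {..<n}}"
  then have \<sigma>: "\<sigma> permutes {..<n}" by simp
  have "(\<Prod>i<n. x (\<sigma> i) ^ (n - 1 - i) * y (\<sigma> i) ^ i) = (\<Prod>i<n. x (\<sigma> i) ^ (n - 1) * (y (\<sigma> i) / x (\<sigma> i)) ^ i)"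
  proof (rule prod.cong[OF refl])
    fix i assume "i \<in> {..<n}"
    then have i: "i < n" "x (\<sigma> i) \<noteq> 0"
      using x permutes_in_image[OF \<sigma>, of i] by auto
    then have "x (\<sigma> i) ^ (n - 1) = x (\<sigma> i) ^ (n - 1 - i) * x (\<sigma> i) ^ i"
      by (simp flip: power_add)
    with i show "x (\<sigma> i) ^ (n - 1 - i) * y (\<sigma> i) ^ i = x (\<sigma> i) ^ (n - 1) * (y (\<sigma> i) / x (\<sigma> i)) ^ i"
      by (simp add: power_divide)
  qed
  also have "\<dots> = (\<Prod>i<n. x i ^ (n - 1)) * (\<Prod>i<n. (y (\<sigma> i) / x (\<sigma> i)) ^ i)"
    using prod.permute[OF \<sigma>, of "\<lambda>i. x i ^ (n - 1)"] by (simp add: prod.distrib comp_def)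
  finally show "of_int (sign \<sigma>) * (\<Prod>i<n. fst (x (\<sigma> i), y (\<sigma> i)) ^ (n - 1 - i) * snd (x (\<sigma> i), y (\<sigma> i)) ^ i) =
      (\<Prod>i<n. x i ^ (n - 1)) * (of_int (sign \<sigma>) * (\<Prod>i<n. (y (\<sigma> i) / x (\<sigma> i)) ^ i))"
    by (simp add: mult_ac)
qed

text \<open>For the images \<open>z\<close> under the fractional linear map,
  \<open>z j - z i\<close> is the determinant times \<open>y j - y i\<close> over the two
  denominators. The homogeneity factors cancel the denominators, and the determinant remains once
  per pair.\<close>

lemma hvandermonde_transform:
  fixes y :: "nat \<Rightarrow> 'k::field"
  assumes inj: "inj_on y {..<n}" and x: "\<And>i. i < n \<Longrightarrow> a + c * y i \<noteq> 0" and D: "a * d - b * c \<noteq> 0"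
  shows "hvandermonde n (\<lambda>i. (a + c * y i, b + d * y i)) = (a * d - b * c) ^ (n choose 2) * vandermonde n y"
proof -
  let ?D = "a * d - b * c"
  define q where "q i = a + c * y i" for i
  define z where "z i = (b + d * y i) / q i" for i
  have q: "q i \<noteq> 0" if "i < n" for i
    using x that by (simp add: q_def)
  have diff: "q j * q i * (z j - z i) = ?D * (y j - y i)" if "j < n" "i < n" for i j
    using q that by (simp add: z_def divide_simps) (simp add: q_def algebra_simps)
  have "inj_on z {..<n}"
  proof (rule inj_onI)
    fix i j assume "i \<in> {..<n}" "j \<in> {..<n}" "z i = z j"
    with diff[of j i] D show "i = j"
      using inj by (auto simp: inj_on_def)
  qed
  then have "hvandermonde n (\<lambda>i. (q i, b + d * y i)) = (\<Prod>j<n. \<Prod>i<j. q j * q i) * (\<Prod>j<n. \<Prod>i<j. z j - z i)"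
    by (subst hvandermonde_scale) (auto simp: q prod_prod_less_mult vandermonde_eq_prod z_def[symmetric])
  also have "\<dots> = (\<Prod>j<n. \<Prod>i<j. ?D * (y j - y i))"
    unfolding prod.distrib[symmetric] using diff by (intro prod.cong refl) auto
  also have "\<dots> = (\<Prod>j<n. ?D ^ j) * vandermonde n y"
    by (simp add: prod.distrib vandermonde_eq_prod[OF inj])
  also have "(\<Prod>j<n. ?D ^ j) = ?D ^ (n choose 2)"
    by (induction n) (simp_all add: numeral_2_eq_2 power_add mult.commute)
  finally show ?thesis
    by (simp add: q_def)
qed

section \<open>The isomorphism and its evaluations\<close>

definition hmon_lists :: "nat \<Rightarrow> nat \<Rightarrow> (nat \<times> nat) list set" where
  "hmon_lists n d = {l. length l = n \<and> set l \<subseteq> hmon d ` {..d}}"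

lemma hmon_lists_eq: "hmon_lists n d = map (hmon d) ` bounded_lists n d"
proof (rule Set.set_eqI, rule iffI)
  fix l assume l: "l \<in> hmon_lists n d"
  then have "l \<in> lists (hmon d ` {..d})"
    by (auto simp: hmon_lists_def in_lists_conv_set)
  then obtain l' where "l = map (hmon d) l'" "l' \<in> lists {..d}"
    unfolding lists_image by blast
  then show "l \<in> map (hmon d) ` bounded_lists n d"
    using l by (auto simp: hmon_lists_def bounded_lists_def in_lists_conv_set)
next
  fix l assume "l \<in> map (hmon d) ` bounded_lists n d"
  then obtain l' where "l = map (hmon d) l'" "set l' \<subseteq> {..d}" "length l' = n"
    by (auto simp: bounded_lists_def)
  then show "l \<in> hmon_lists n d"
    using image_mono[of "set l'" "{..d}" "hmon d"] by (simp add: hmon_lists_def)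
qed

lemma permute_list_hmon_lists:
  assumes "\<sigma> permutes {..<n}" "l \<in> hmon_lists n d"
  shows "permute_list \<sigma> l \<in> hmon_lists n d"
  using assms by (auto simp: hmon_lists_def)

text \<open>
  A basis vector \<open>(us, as, bs)\<close> of the left-hand side stands for the product of a monomial \<open>p\<close> in
  the variables \<open>w\<^sub>1, \<dots>, w\<^sub>M\<close> and a monomial \<open>h\<close> in \<open>z\<^sub>1, \<dots>, z\<^sub>N, w\<^sub>1, \<dots>, w\<^sub>M\<close>; it is
  multiplied by the diagonal monomial of the Vandermonde determinant in \<open>z\<^sub>1, \<dots>, z\<^sub>N\<close>.
\<close>

definition diag_mult ::
  "nat \<Rightarrow> ('u \<times> (nat \<times> nat) list \<times> (nat \<times> nat) list \<Rightarrow>\<^sub>0 'f::field) \<Rightarrow> ((nat \<times> nat) list \<Rightarrow>\<^sub>0 'f)" where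
  "diag_mult N = lin_ext (\<lambda>(us, as, bs).
     basis_vec (map2 (+) (map (hmon (N - 1)) [0..<N] @ as) bs))"

text \<open>As h is symmetric and p does not involve the z's, antisymmetrizing acts on the diagonal
  monomial alone and yields the Vandermonde factor (\<open>ev_plethysm_map\<close>). In this form
  the coefficients of the image are alternations, as \<open>hook_symmetric_alternate\<close>
  requires.\<close>

definition plethysm_map ::
  "nat \<Rightarrow> ('u \<times> (nat \<times> nat) list \<times> (nat \<times> nat) list \<Rightarrow>\<^sub>0 'f::field) \<Rightarrow>
   ((nat \<times> nat) list \<times> (nat \<times> nat) list \<Rightarrow>\<^sub>0 'f)" where
  "plethysm_map N x = unflatten N (antisymmetrize N (diag_mult N x))"

lemma linear_plethysm_map: "Vector_Spaces.linear cmul cmul (plethysm_map N)"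
proof -
  have "Vector_Spaces.linear cmul cmul (unflatten N \<circ> (antisymmetrize N \<circ> diag_mult N))"
    unfolding diag_mult_def
    by (intro Vector_Spaces.linear_compose[of cmul cmul _ cmul] linear_unflatten
        linear_antisymmetrize lin_ext_linear)
  then show ?thesis
    unfolding plethysm_map_def[abs_def] comp_def .
qed

text \<open>Contains the left-hand side (\<open>tensor_rep_lower_sym_subset\<close>) and states
  symmetry by coefficients, the form in which it is used. \<open>U\<close> collects the basis lists
  of the determinant factor.\<close>

definition sym_tensors ::
  "'u set \<Rightarrow> nat \<Rightarrow> nat \<Rightarrow> nat \<Rightarrow> nat \<Rightarrow>
   ('u \<times> (nat \<times> nat) list \<times> (nat \<times> nat) list \<Rightarrow>\<^sub>0 'f::field) set" where
  "sym_tensors U M a R b = {x.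
     keys x \<subseteq> U \<times> hmon_lists M a \<times> hmon_lists R b \<and>
     (\<forall>us as as' bs bs'. mset as = mset as' \<longrightarrow> mset bs = mset bs' \<longrightarrow>
        lookup x (us, as, bs) = lookup x (us, as', bs'))}"

lemma sym_tensors_keys:
  assumes "x \<in> sym_tensors U M a R b" "(us, as, bs) \<in> keys x"
  shows "us \<in> U" "as \<in> hmon_lists M a" "bs \<in> hmon_lists R b"
proof -
  have "keys x \<subseteq> U \<times> hmon_lists M a \<times> hmon_lists R b"
    using assms(1) unfolding sym_tensors_def by blast
  with assms(2) show "us \<in> U" "as \<in> hmon_lists M a" "bs \<in> hmon_lists R b"
    by auto
qed

lemma sym_tensors_length:
  assumes "x \<in> sym_tensors U M a R b" "(us, as, bs) \<in> keys x"
  shows "length as = M" "length bs = R"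
  using sym_tensors_keys(2,3)[OF assms] by (simp_all add: hmon_lists_def)

lemma sym_tensors_lookup:
  assumes "x \<in> sym_tensors U M a R b" "mset as = mset as'" "mset bs = mset bs'"
  shows "lookup x (us, as, bs) = lookup x (us, as', bs')"
proof -
  have "\<forall>us as as' bs bs'. mset as = mset as' \<longrightarrow> mset bs = mset bs' \<longrightarrow>
      lookup x (us, as, bs) = lookup x (us, as', bs')"
    using assms(1) unfolding sym_tensors_def mem_Collect_eq by (rule conjunct2)
  from this[rule_format, OF assms(2,3)] show ?thesis .
qed

section \<open>Evaluation of tensors at points\<close>

definition list_weight :: "(nat \<Rightarrow> 'b \<Rightarrow> 'k::comm_monoid_mult) \<Rightarrow> 'b list \<Rightarrow> 'k" where
  "list_weight w l = (\<Prod>i<length l. w i (l ! i))"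

lemma list_weight_Cons: "list_weight w (b # l) = w 0 b * list_weight (\<lambda>i. w (Suc i)) l"
  by (simp add: list_weight_def prod.lessThan_Suc_shift del: prod.lessThan_Suc)

lemma list_weight_append:
  "list_weight w (l @ l') = list_weight w l * list_weight (\<lambda>i. w (length l + i)) l'"
proof (induction l arbitrary: w)
  case Nil
  then show ?case
    by (simp add: list_weight_def)
qed (simp add: list_weight_Cons mult.assoc)

lemma list_weight_permute_list:
  assumes \<sigma>: "\<sigma> permutes {..<length l}"
  shows "list_weight w (permute_list (inv_into UNIV \<sigma>) l) = list_weight (\<lambda>i. w (\<sigma> i)) l"
proof -
  have inv: "inv_into UNIV \<sigma> permutes {..<length l}"
    using \<sigma> by (rule permutes_inv)
  have "list_weight w (permute_list (inv_into UNIV \<sigma>) l) =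
      (\<Prod>i<length l. w (\<sigma> (inv_into UNIV \<sigma> i)) (l ! inv_into UNIV \<sigma> i))"
    unfolding list_weight_def using inv \<sigma>
    by (intro prod.cong) (auto simp: permute_list_nth permutes_inverses)
  also have "\<dots> = list_weight (\<lambda>i. w (\<sigma> i)) l"
    unfolding list_weight_def by (rule prod.reindex_bij_betw[OF permutes_imp_bij[OF inv]])
  finally show ?thesis .
qed

lemma list_weight_map2_plus:
  assumes "length l = length l'" "\<And>i a b. w i (a + b) = w i a * w i b"
  shows "list_weight w (map2 (+) l l') = list_weight w l * list_weight w l'"
  using assms by (simp add: list_weight_def prod.distrib)

definition mon_weight :: "'k::comm_semiring_1 \<times> 'k \<Rightarrow> nat \<times> nat \<Rightarrow> 'k" where
  "mon_weight p = (\<lambda>(i, j). fst p ^ i * snd p ^ j)"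

lemma mon_weight_add: "mon_weight p (a + b) = mon_weight p a * mon_weight p b"
  by (cases a; cases b) (simp add: mon_weight_def power_add mult_ac)

lemma mon_weight_0: "mon_weight p (0, 0) = 1"
  by (simp add: mon_weight_def)

definition target_weight ::
  "nat \<Rightarrow> (nat \<Rightarrow> 'k::comm_semiring_1 \<times> 'k) \<Rightarrow> (nat \<times> nat) list \<times> (nat \<times> nat) list \<Rightarrow> 'k" where
  "target_weight N p = (\<lambda>(zs, ws).
     list_weight (\<lambda>i. mon_weight (p i)) zs * list_weight (\<lambda>i. mon_weight (p (N + i))) ws)"

text \<open>p is evaluated at the w's and h at all the points. The determinant factor has weight 1
  and enters through the action only (\<open>ev_source_act\<close>).\<close>

definition source_weight ::
  "nat \<Rightarrow> (nat \<Rightarrow> 'k::comm_semiring_1 \<times> 'k) \<Rightarrow>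
   'u \<times> (nat \<times> nat) list \<times> (nat \<times> nat) list \<Rightarrow> 'k" where
  "source_weight N p = (\<lambda>(us, as, bs).
     list_weight (\<lambda>i. mon_weight (p (N + i))) as * list_weight (\<lambda>i. mon_weight (p i)) bs)"

lemma keys_diag_mult:
  assumes "l \<in> keys (diag_mult N x)"
  obtains us as bs where "(us, as, bs) \<in> keys x"
    "l = map2 (+) (map (hmon (N - 1)) [0..<N] @ as) bs"
  using assms unfolding diag_mult_def
  by (rule keys_lin_ext) (use that in \<open>auto simp: keys_basis_vec\<close>)

text \<open>The evaluation formulas use only that \<open>emb\<close> is an injective ring
  homomorphism; that the larger field is infinite is assumed where it matters.\<close>

locale field_embedding =
  fixes emb :: "'f::field \<Rightarrow> 'k::field"
  assumes emb_add: "emb (x + y) = emb x + emb y"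
    and emb_mult: "emb (x * y) = emb x * emb y"
    and emb_0 [simp]: "emb 0 = 0"
    and emb_1 [simp]: "emb 1 = 1"
    and emb_eq_0 [simp]: "emb x = 0 \<longleftrightarrow> x = 0"
begin

lemma emb_uminus: "emb (- x) = - emb x"
proof -
  have "emb (- x) + emb x = 0"
    by (simp flip: emb_add)
  then show ?thesis
    by (simp add: eq_neg_iff_add_eq_0)
qed

lemma emb_diff: "emb (x - y) = emb x - emb y"
  using emb_add[of x "- y"] by (simp add: emb_uminus)

lemma emb_sign: "emb (of_int (sign \<sigma>)) = of_int (sign \<sigma>)"
  by (cases \<sigma> rule: sign_cases) (simp_all add: emb_uminus)

definition ev :: "('b \<Rightarrow> 'k) \<Rightarrow> ('b \<Rightarrow>\<^sub>0 'f) \<Rightarrow> 'k" where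
  "ev m u = (\<Sum>b\<in>keys u. emb (lookup u b) * m b)"

lemma ev_superset:
  assumes "finite A" "keys u \<subseteq> A"
  shows "ev m u = (\<Sum>b\<in>A. emb (lookup u b) * m b)"
  unfolding ev_def using assms by (intro sum.mono_neutral_left) (auto simp: in_keys_iff)

lemma ev_add: "ev m (u + v) = ev m u + ev m v"
  using keys_add[of u v]
  by (simp add: ev_superset[of "keys u \<union> keys v"] lookup_add emb_add distrib_right sum.distrib)

lemma ev_cmul: "ev m (cmul c u) = emb c * ev m u"
proof -
  have "keys (cmul c u) \<subseteq> keys u"
    by (auto simp: in_keys_iff)
  then show ?thesis
    by (simp add: ev_superset[of "keys u"] emb_mult sum_distrib_left mult.assoc)
qed

lemma ev_zero [simp]: "ev m 0 = 0"
  by (simp add: ev_def)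

lemma ev_sum: "ev m (\<Sum>i\<in>A. u i) = (\<Sum>i\<in>A. ev m (u i))"
  by (induction A rule: infinite_finite_induct) (simp_all add: ev_add)

lemma ev_basis_vec [simp]: "ev m (basis_vec b) = m b"
  by (simp add: ev_def basis_vec_def)

lemma ev_lin_ext: "ev m (lin_ext h u) = ev (\<lambda>a. ev m (h a)) u"
  unfolding lin_ext_def ev_sum ev_cmul by (simp add: ev_def)

lemma ev_cong: "(\<And>b. b \<in> keys u \<Longrightarrow> m b = m' b) \<Longrightarrow> ev m u = ev m' u"
  by (simp add: ev_def)

lemma ev_mult_left: "ev (\<lambda>b. c * m b) u = c * ev m u"
  by (simp add: ev_def sum_distrib_left mult_ac)

lemma ev_mult_right: "ev (\<lambda>b. m b * c) u = ev m u * c"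
  by (simp add: ev_def sum_distrib_left sum_distrib_right mult_ac)

lemma ev_tensor: "ev (\<lambda>(a, b). \<alpha> a * \<beta> b) (tensor v w) = ev \<alpha> v * ev \<beta> w"
  by (simp add: tensor_def ev_lin_ext ev_mult_left ev_mult_right)

lemma ev_tensor_map:
  "ev (\<lambda>(a, b). \<alpha> a * \<beta> b) (tensor_map f h u) =
   ev (\<lambda>(a, b). ev \<alpha> (f (basis_vec a)) * ev \<beta> (h (basis_vec b))) u"
  unfolding tensor_map_def ev_lin_ext
proof (rule ev_cong)
  fix t
  show "ev (\<lambda>(a, b). \<alpha> a * \<beta> b) (case t of (a, b) \<Rightarrow> tensor (f (basis_vec a)) (h (basis_vec b))) =
      (case t of (a, b) \<Rightarrow> ev \<alpha> (f (basis_vec a)) * ev \<beta> (h (basis_vec b)))"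
    by (cases t) (simp only: prod.case ev_tensor)
qed

lemma ev_tensor_list: "ev (list_weight w) (tensor_list vs) = (\<Prod>i<length vs. ev (w i) (vs ! i))"
proof (induction vs arbitrary: w)
  case Nil
  then show ?case
    by (simp add: list_weight_def)
next
  case (Cons v vs)
  then show ?case
    by (simp add: ev_lin_ext list_weight_Cons ev_mult_left ev_mult_right prod.lessThan_Suc_shift
        del: prod.lessThan_Suc)
qed

lemma ev_tensor_list_map_basis_vec:
  "ev (list_weight w) (tensor_list_map f (basis_vec as)) =
   list_weight (\<lambda>i a. ev (w i) (f (basis_vec a))) as"
  by (simp add: tensor_list_map_def ev_tensor_list list_weight_def)

lemma ev_mult: "ev (mon_weight p) (P * Q) = ev (mon_weight p) P * ev (mon_weight p) Q"
proof -
  have *: "ev (mon_weight p) (basis_vec a * Q) = mon_weight p a * ev (mon_weight p) Q" for a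
    by (subst linear_eq_lin_ext[OF linear_mult_left])
      (simp add: ev_lin_ext basis_vec_mult mon_weight_add ev_mult_left)
  show ?thesis
    by (subst linear_eq_lin_ext[OF linear_mult_right]) (simp add: ev_lin_ext * ev_mult_right)
qed

lemma ev_power: "ev (mon_weight p) (P ^ n) = ev (mon_weight p) P ^ n"
proof (induction n)
  case 0
  have "ev (mon_weight p) (basis_vec (0, 0)) = 1"
    by (simp add: mon_weight_0)
  then show ?case
    by (simp add: zero_prod_def[symmetric] basis_vec_0)
qed (simp add: ev_mult)

text \<open>The row vector \<open>p\<close> times \<open>g\<close>: to evaluate a substituted
  polynomial at \<open>p\<close> is to evaluate the original one there
  (\<open>ev_act_upper_sym\<close>).\<close>

definition gl2_transform :: "'f ^ 2 ^ 2 \<Rightarrow> 'k \<times> 'k \<Rightarrow> 'k \<times> 'k" where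
  "gl2_transform g p =
     (emb (g $ 1 $ 1) * fst p + emb (g $ 2 $ 1) * snd p, emb (g $ 1 $ 2) * fst p + emb (g $ 2 $ 2) * snd p)"

lemma ev_act_upper_sym:
  "ev (mon_weight p) (act (upper_sym d) g u) = ev (mon_weight (gl2_transform g p)) u"
proof -
  have "ev (mon_weight p) pX = fst p" "ev (mon_weight p) pY = snd p"
    by (simp_all add: pX_def pY_def mon_weight_def)
  then have "ev (mon_weight p) (cmul a pX + cmul b pY) = emb a * fst p + emb b * snd p" for a b
    by (simp add: ev_add ev_cmul)
  then show ?thesis
    unfolding upper_sym_def rep.simps subst2_def ev_lin_ext
    by (intro ev_cong, simp add: case_prod_unfold ev_mult ev_power)
      (simp add: mon_weight_def gl2_transform_def case_prod_unfold)
qed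

lemma ev_unflatten:
  assumes "\<And>l. l \<in> keys u \<Longrightarrow> N \<le> length l"
  shows "ev (target_weight N p) (unflatten N u) = ev (list_weight (\<lambda>i. mon_weight (p i))) u"
  unfolding unflatten_def ev_lin_ext
proof (rule ev_cong)
  fix l assume "l \<in> keys u"
  then have "N \<le> length l"
    by (rule assms)
  then show "ev (target_weight N p) (basis_vec (take N l, drop N l)) = list_weight (\<lambda>i. mon_weight (p i)) l"
    using list_weight_append[of "\<lambda>i. mon_weight (p i)" "take N l" "drop N l"]
    by (simp add: target_weight_def)
qed

lemma ev_antisymmetrize:
  assumes "\<And>l. l \<in> keys u \<Longrightarrow> N \<le> length l"
  shows "ev (list_weight w) (antisymmetrize N u) =
    (\<Sum>\<sigma> | \<sigma> permutes {..<N}. of_int (sign \<sigma>) * ev (list_weight (\<lambda>i. w (\<sigma> i))) u)"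
  unfolding antisymmetrize_def ev_sum ev_cmul emb_sign
proof (rule sum.cong[OF refl])
  fix \<sigma> assume "\<sigma> \<in> {\<sigma>. \<sigma> permutes {..<N}}"
  then have "\<sigma> permutes {..<N}" by simp
  then have "ev (list_weight w) (place_perm \<sigma> u) = ev (list_weight (\<lambda>i. w (\<sigma> i))) u"
    unfolding place_perm_def ev_lin_ext
    by (intro ev_cong) (simp add: list_weight_permute_list permutes_lessThan_mono[OF _ assms])
  then show "of_int (sign \<sigma>) * ev (list_weight w) (place_perm \<sigma> u) =
      of_int (sign \<sigma>) * ev (list_weight (\<lambda>i. w (\<sigma> i))) u"
    by simp
qed

text \<open>Permuting the points of h permutes the lists \<open>bs\<close>, and the coefficients of
  \<open>x\<close> are constant on rearrangements.\<close>

lemma ev_sym_tensors_permute: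
  assumes x: "x \<in> sym_tensors U M a R b" and \<sigma>: "\<sigma> permutes {..<R}"
  shows "ev (\<lambda>(us, as, bs). \<alpha> as * list_weight (\<lambda>i. w (\<sigma> i)) bs) x =
    ev (\<lambda>(us, as, bs). \<alpha> as * list_weight w bs) x"
proof -
  have len: "length bs = R" if "(us, as, bs) \<in> keys x" for us as bs
    using sym_tensors_length(2)[OF x that] .
  have inv: "inv_into UNIV \<sigma> permutes {..<R}"
    using \<sigma> by (rule permutes_inv)
  have sym: "lookup x (us, as, permute_list \<tau> bs) = lookup x (us, as, bs)"
    if "\<tau> permutes {..<R}" "length bs = R" for \<tau> us as bs
    by (rule sym_tensors_lookup[OF x]) (use that in simp_all)
  show ?thesis
    unfolding ev_def
  proof (rule sum.reindex_bij_witness[of _ "\<lambda>(us, as, bs). (us, as, permute_list \<sigma> bs)"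
        "\<lambda>(us, as, bs). (us, as, permute_list (inv_into UNIV \<sigma>) bs)"])
    fix t assume t: "t \<in> keys x"
    obtain us as bs where ab: "t = (us, as, bs)"
      by (metis prod_cases3)
    have [simp]: "length bs = R"
      using len t ab by blast
    show "(\<lambda>(us, as, bs). (us, as, permute_list \<sigma> bs))
        ((\<lambda>(us, as, bs). (us, as, permute_list (inv_into UNIV \<sigma>) bs)) t) = t"
      using \<sigma> by (simp add: ab permute_list_inv)
    show "(\<lambda>(us, as, bs). (us, as, permute_list (inv_into UNIV \<sigma>) bs))
        ((\<lambda>(us, as, bs). (us, as, permute_list \<sigma> bs)) t) = t"
      using \<sigma> by (simp add: ab permute_list_inv)
    show "(\<lambda>(us, as, bs). (us, as, permute_list (inv_into UNIV \<sigma>) bs)) t \<in> keys x"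
      using t inv by (simp add: ab in_keys_iff sym)
    show "(\<lambda>(us, as, bs). (us, as, permute_list \<sigma> bs)) t \<in> keys x"
      using t \<sigma> by (simp add: ab in_keys_iff sym)
    show "emb (lookup x ((\<lambda>(us, as, bs). (us, as, permute_list (inv_into UNIV \<sigma>) bs)) t)) *
        (case (\<lambda>(us, as, bs). (us, as, permute_list (inv_into UNIV \<sigma>) bs)) t of
          (us, as, bs) \<Rightarrow> \<alpha> as * list_weight w bs) =
        emb (lookup x t) * (case t of (us, as, bs) \<Rightarrow> \<alpha> as * list_weight (\<lambda>i. w (\<sigma> i)) bs)"
      using \<sigma> inv by (simp add: ab sym list_weight_permute_list)
  qed
qed

text \<open>In the term of \<open>\<sigma>\<close> the diagonal monomial gives the corresponding
  term of the determinant. p is unaffected since \<open>\<sigma>\<close> fixes the w's, and h since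
  it is symmetric in all points, so their value factors out.\<close>

lemma ev_plethysm_map:
  assumes x: "x \<in> sym_tensors U M a (N + M) b"
  shows "ev (target_weight N p) (plethysm_map N x) = hvandermonde N p * ev (source_weight N p) x"
proof -
  let ?w = "\<lambda>i. mon_weight (p i)"
  have *: "ev (list_weight (\<lambda>i. ?w (\<sigma> i))) (diag_mult N x) =
      (\<Prod>i<N. fst (p (\<sigma> i)) ^ (N - 1 - i) * snd (p (\<sigma> i)) ^ i) * ev (source_weight N p) x"
    if \<sigma>: "\<sigma> permutes {..<N}" for \<sigma>
  proof -
    let ?c = "\<Prod>i<N. fst (p (\<sigma> i)) ^ (N - 1 - i) * snd (p (\<sigma> i)) ^ i"
    have "ev (list_weight (\<lambda>i. ?w (\<sigma> i))) (diag_mult N x) =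
        ev (\<lambda>(us, as, bs). (?c * list_weight (\<lambda>i. ?w (N + i)) as) * list_weight (\<lambda>i. ?w (\<sigma> i)) bs) x"
      unfolding diag_mult_def ev_lin_ext
    proof (rule ev_cong)
      fix t assume t: "t \<in> keys x"
      obtain us as bs where ab: "t = (us, as, bs)"
        by (metis prod_cases3)
      have len: "length as = M" "length bs = N + M"
        using sym_tensors_length[OF x] t ab by auto
      have "list_weight (\<lambda>i. ?w (\<sigma> i)) (map (hmon (N - 1)) [0..<N]) = ?c"
        by (simp add: list_weight_def mon_weight_def hmon_def)
      moreover have "\<sigma> (N + i) = N + i" for i
        using \<sigma> by (rule permutes_not_in) simp
      ultimately show "ev (list_weight (\<lambda>i. ?w (\<sigma> i))) (case t of (us, as, bs) \<Rightarrow>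
          basis_vec (map2 (+) (map (hmon (N - 1)) [0..<N] @ as) bs)) =
        (case t of (us, as, bs) \<Rightarrow>
          (?c * list_weight (\<lambda>i. ?w (N + i)) as) * list_weight (\<lambda>i. ?w (\<sigma> i)) bs)"
        unfolding ab prod.case ev_basis_vec
        by (subst list_weight_map2_plus) (simp_all add: len mon_weight_add list_weight_append)
    qed
    also have "\<dots> = ev (\<lambda>(us, as, bs). (?c * list_weight (\<lambda>i. ?w (N + i)) as) * list_weight ?w bs) x"
      by (rule ev_sym_tensors_permute[OF x permutes_lessThan_mono[OF \<sigma>]]) simp
    also have "\<dots> = ev (\<lambda>t. ?c * source_weight N p t) x"
      by (rule ev_cong) (simp add: source_weight_def case_prod_unfold mult.assoc)
    finally show ?thesis
      by (simp only: ev_mult_left)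
  qed
  have keys: "N \<le> length l" if "l \<in> keys (diag_mult N x)" for l
    using that by (rule keys_diag_mult) (use sym_tensors_length[OF x] in auto)
  have keys': "N \<le> length l" if "l \<in> keys (antisymmetrize N (diag_mult N x))" for l
    using that by (rule keys_antisymmetrize) (use keys in auto)
  show ?thesis
  proof -
    have "ev (target_weight N p) (plethysm_map N x) = ev (list_weight ?w) (antisymmetrize N (diag_mult N x))"
      unfolding plethysm_map_def using keys' by (rule ev_unflatten)
    also have "\<dots> = (\<Sum>\<sigma> | \<sigma> permutes {..<N}. of_int (sign \<sigma>) *
        ev (list_weight (\<lambda>i. ?w (\<sigma> i))) (diag_mult N x))"
      using keys by (rule ev_antisymmetrize)
    also have "\<dots> = hvandermonde N p * ev (source_weight N p) x"
      unfolding hvandermonde_def sum_distrib_right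
      by (rule sum.cong[OF refl]) (simp add: * mult.assoc)
    finally show ?thesis .
  qed
qed

text \<open>Acting amounts to moving the points, except that each of the \<open>C\<close> tensor
  factors scaled by \<open>c\<close> contributes \<open>emb c\<close>.\<close>

lemma ev_source_act:
  fixes x :: "'u list \<times> (nat \<times> nat) list \<times> (nat \<times> nat) list \<Rightarrow>\<^sub>0 'f"
  assumes "\<And>us as bs. (us, as, bs) \<in> keys x \<Longrightarrow> length us = C"
  shows "ev (source_weight N p)
      (tensor_map (tensor_list_map (cmul c))
        (tensor_map (tensor_list_map (act (upper_sym a) g)) (tensor_list_map (act (upper_sym b) g))) x) =
    emb c ^ C * ev (source_weight N (\<lambda>i. gl2_transform g (p i))) x"
proof -
  let ?T = "tensor_map (tensor_list_map (act (upper_sym a) g)) (tensor_list_map (act (upper_sym b) g))"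
  let ?\<alpha> = "list_weight (\<lambda>_ _. 1) :: 'u list \<Rightarrow> 'k"
  let ?\<beta> = "\<lambda>(as, bs). list_weight (\<lambda>i. mon_weight (p (N + i))) as * list_weight (\<lambda>i. mon_weight (p i)) bs"
  have "ev (source_weight N p) (tensor_map (tensor_list_map (cmul c)) ?T x) =
      ev (\<lambda>(us, ab). ?\<alpha> us * ?\<beta> ab) (tensor_map (tensor_list_map (cmul c)) ?T x)"
    by (rule ev_cong) (simp add: source_weight_def list_weight_def case_prod_unfold)
  also have "\<dots> = ev (\<lambda>(us, ab). ev ?\<alpha> (tensor_list_map (cmul c) (basis_vec us)) * ev ?\<beta> (?T (basis_vec ab))) x"
    by (rule ev_tensor_map)
  also have "\<dots> = ev (\<lambda>t. emb c ^ C * source_weight N (\<lambda>i. gl2_transform g (p i)) t) x"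
  proof (rule ev_cong)
    fix t assume t: "t \<in> keys x"
    obtain us as bs where ab: "t = (us, as, bs)"
      by (metis prod_cases3)
    have us: "length us = C"
      using assms t ab by blast
    have "ev ?\<alpha> (tensor_list_map (cmul c) (basis_vec us)) = emb c ^ C"
      by (simp add: ev_tensor_list_map_basis_vec ev_cmul) (simp add: list_weight_def us)
    moreover have "ev ?\<beta> (?T (basis_vec (as, bs))) = source_weight N (\<lambda>i. gl2_transform g (p i)) t"
      unfolding ev_tensor_map ev_basis_vec prod.case ev_tensor_list_map_basis_vec ev_act_upper_sym
      by (simp add: source_weight_def ab)
    ultimately show "(case t of (us, ab) \<Rightarrow>
        ev ?\<alpha> (tensor_list_map (cmul c) (basis_vec us)) * ev ?\<beta> (?T (basis_vec ab))) =
      emb c ^ C * source_weight N (\<lambda>i. gl2_transform g (p i)) t"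
      by (simp only: ab prod.case)
  qed
  finally show ?thesis
    by (simp only: ev_mult_left)
qed

lemma ev_target_act:
  "ev (target_weight N p)
      (tensor_map (tensor_list_map (act (upper_sym d) g)) (tensor_list_map (act (upper_sym d) g)) x) =
    ev (target_weight N (\<lambda>i. gl2_transform g (p i))) x"
  unfolding target_weight_def ev_tensor_map
  by (rule ev_cong) (simp add: case_prod_unfold ev_tensor_list_map_basis_vec ev_act_upper_sym)

end

lemma mon_weight_hmon: "mon_weight (1, y) (hmon d k) = y ^ k"
  by (simp add: mon_weight_def hmon_def)

lemma list_weight_hmon:
  "list_weight (\<lambda>i. mon_weight (1, z i)) (map (hmon d) l) = (\<Prod>i<length l. z i ^ (l ! i))"
  by (simp add: list_weight_def mon_weight_hmon)

context field_embedding
begin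

text \<open>Coefficients are recovered from values by \<open>multivariate_poly_eq_0\<close>. The set
  \<open>S\<close> is left free so that points sent to infinity by a matrix can be excluded.\<close>

lemma eq_0_if_ev_target_eq_0:
  assumes keys: "keys u \<subseteq> hmon_lists N d \<times> hmon_lists M d" and S: "infinite S"
    and ev: "\<And>y. inj_on y {..<N + M} \<Longrightarrow> y ` {..<N + M} \<subseteq> S \<Longrightarrow>
      ev (target_weight N (\<lambda>i. (1, y i))) u = 0"
  shows "u = 0"
proof -
  let ?h = "\<lambda>l. (map (hmon d) (take N l), map (hmon d) (drop N l))"
  let ?L = "bounded_lists (N + M) d"
  have inj: "inj_on ?h A" for A
    by (rule inj_onI) (metis append_take_drop_id inj_hmon inj_map_eq_map prod.inject)
  have onto: "hmon_lists N d \<times> hmon_lists M d \<subseteq> ?h ` ?L"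
  proof clarify
    fix a b assume "a \<in> hmon_lists N d" "b \<in> hmon_lists M d"
    then obtain a' b' where "a = map (hmon d) a'" "b = map (hmon d) b'"
      "a' \<in> bounded_lists N d" "b' \<in> bounded_lists M d"
      by (auto simp: hmon_lists_eq)
    then show "(a, b) \<in> ?h ` ?L"
      by (intro image_eqI[of _ _ "a' @ b'"]) (auto simp: bounded_lists_def)
  qed
  have "emb (lookup u (?h l)) = 0" if "l \<in> ?L" for l
  proof (rule multivariate_poly_eq_0[OF _ _ that, of S "\<lambda>l. emb (lookup u (?h l))"])
    fix ys :: "'k list"
    assume ys: "length ys = N + M" "distinct ys" "set ys \<subseteq> S"
    have "ev (target_weight N (\<lambda>i. (1, ys ! i))) u =
        (\<Sum>t\<in>?h ` ?L. emb (lookup u t) * target_weight N (\<lambda>i. (1, ys ! i)) t)"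
      by (rule ev_superset) (use keys onto finite_bounded_lists in auto)
    also have "\<dots> = (\<Sum>l\<in>?L. emb (lookup u (?h l)) * target_weight N (\<lambda>i. (1, ys ! i)) (?h l))"
      by (simp add: sum.reindex[OF inj])
    also have "\<dots> = (\<Sum>l\<in>?L. emb (lookup u (?h l)) * (\<Prod>i<N + M. ys ! i ^ (l ! i)))"
    proof (rule sum.cong[OF refl])
      fix l assume "l \<in> ?L"
      then have l: "length l = N + M"
        by (simp add: bounded_lists_def)
      have "target_weight N (\<lambda>i. (1, ys ! i)) (?h l) =
          list_weight (\<lambda>i. mon_weight (1, ys ! i)) (map (hmon d) (take N l) @ map (hmon d) (drop N l))"
        by (simp only: target_weight_def prod.case list_weight_append) (simp add: l)
      also have "\<dots> = (\<Prod>i<N + M. ys ! i ^ (l ! i))"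
        unfolding map_append[symmetric] append_take_drop_id list_weight_hmon l ..
      finally show "emb (lookup u (?h l)) * target_weight N (\<lambda>i. (1, ys ! i)) (?h l) =
          emb (lookup u (?h l)) * (\<Prod>i<N + M. ys ! i ^ (l ! i))"
        by simp
    qed
    also have "ev (target_weight N (\<lambda>i. (1, ys ! i))) u = 0"
      using ys by (intro ev) (auto simp: inj_on_def nth_eq_iff_index_eq)
    finally show "(\<Sum>l\<in>?L. emb (lookup u (?h l)) * (\<Prod>i<N + M. ys ! i ^ (l ! i))) = 0"
      by simp
  qed (use S in simp)
  then have "lookup u t = 0" if "t \<in> hmon_lists N d \<times> hmon_lists M d" for t
    using onto that by auto
  then have "lookup u t = 0" for t
    using keys by (metis in_keys_iff subsetD)
  then show ?thesis
    by (intro poly_mapping_eqI) simp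
qed

text \<open>
  The kernel vanishes since a polynomial \<open>p\<close> of degree less than \<open>N\<close> in each of \<open>M\<close> variables is
  zero if it is zero at all the tuples of distinct elements of a set of \<open>N + M\<close> points: apply this
  to the coefficients \<open>h(z, w)\<close>, which do not depend on the order of the points.
\<close>

lemma plethysm_map_eq_0_imp:
  fixes x :: "'u \<times> (nat \<times> nat) list \<times> (nat \<times> nat) list \<Rightarrow>\<^sub>0 'f"
  assumes x: "x \<in> sym_tensors {us0} M (N - 1) (N + M) e" and N: "1 \<le> N"
    and inf: "infinite (UNIV :: 'k set)"
    and 0: "plethysm_map N x = 0"
  shows "x = 0"
proof -
  let ?A = "bounded_lists M (N - 1)" and ?B = "bounded_lists (N + M) e"
  let ?h = "\<lambda>(a, b). (us0, map (hmon (N - 1)) a, map (hmon e) b)"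
  define X where "X a b = lookup x (?h (a, b))" for a b
  have inj: "inj_on ?h T" for T
    by (rule inj_onI) (auto simp: inj_map_eq_map[OF inj_hmon])
  have onto: "{us0} \<times> hmon_lists M (N - 1) \<times> hmon_lists (N + M) e = ?h ` (?A \<times> ?B)"
    unfolding hmon_lists_eq by auto
  have keys: "keys x \<subseteq> ?h ` (?A \<times> ?B)"
    unfolding onto[symmetric] using sym_tensors_keys[OF x] by auto
  have symX: "X a b = X a b'" if "mset b = mset b'" for a b b'
    unfolding X_def prod.case by (rule sym_tensors_lookup[OF x]) (use that in simp_all)
  \<comment> \<open>The value of the polynomial in all points that accompanies the monomial
    \<open>a\<close> in the w's.\<close>
  define c where "c ys a = (\<Sum>b\<in>?B. emb (X a b) * (\<Prod>i<N + M. ys ! i ^ (b ! i)))" for ys a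
  have c_perm: "c (permute_list \<sigma> ys) a = c ys a"
    if \<sigma>: "\<sigma> permutes {..<N + M}" and ys: "length ys = N + M" for \<sigma> ys a
  proof -
    have inv: "inv_into UNIV \<sigma> permutes {..<N + M}"
      using \<sigma> by (rule permutes_inv)
    show ?thesis
      unfolding c_def
    proof (rule sum.reindex_bij_witness[of _ "permute_list \<sigma>" "permute_list (inv_into UNIV \<sigma>)"])
      fix b assume b: "b \<in> ?B"
      then have len: "length b = N + M"
        by (simp add: bounded_lists_def)
      show "permute_list \<sigma> (permute_list (inv_into UNIV \<sigma>) b) = b"
        using \<sigma> by (simp add: len permute_list_inv)
      show "permute_list (inv_into UNIV \<sigma>) (permute_list \<sigma> b) = b"
        using \<sigma> by (simp add: len permute_list_inv)
      show "permute_list (inv_into UNIV \<sigma>) b \<in> ?B" "permute_list \<sigma> b \<in> ?B"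
        using b \<sigma> inv by (auto simp: bounded_lists_def)
      have "(\<Prod>i<N + M. permute_list \<sigma> ys ! i ^ (b ! i)) =
          (\<Prod>i<N + M. ys ! \<sigma> i ^ (b ! inv_into UNIV \<sigma> (\<sigma> i)))"
        using \<sigma> ys by (intro prod.cong) (auto simp: permute_list_nth permutes_inverses)
      also have "\<dots> = (\<Prod>i<N + M. ys ! i ^ (b ! inv_into UNIV \<sigma> i))"
        by (rule prod.reindex_bij_betw[OF permutes_imp_bij[OF \<sigma>]])
      also have "\<dots> = (\<Prod>i<N + M. ys ! i ^ (permute_list (inv_into UNIV \<sigma>) b ! i))"
        using inv len by (intro prod.cong) (auto simp: permute_list_nth)
      finally show "emb (X a (permute_list (inv_into UNIV \<sigma>) b)) *
          (\<Prod>i<N + M. ys ! i ^ (permute_list (inv_into UNIV \<sigma>) b ! i)) =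
        emb (X a b) * (\<Prod>i<N + M. permute_list \<sigma> ys ! i ^ (b ! i))"
        using inv symX[of "permute_list (inv_into UNIV \<sigma>) b" b] by (simp add: len)
    qed
  qed
  have ev: "(\<Sum>a\<in>?A. c ys a * (\<Prod>i<M. ys ! (N + i) ^ (a ! i))) = 0"
    if ys: "length ys = N + M" "distinct ys" for ys
  proof -
    let ?p = "\<lambda>i. (1, ys ! i)"
    have "hvandermonde N ?p * ev (source_weight N ?p) x = 0"
      using ev_plethysm_map[OF x, of ?p] by (simp add: 0)
    moreover have "hvandermonde N ?p \<noteq> 0"
      unfolding hvandermonde_affine
      using ys by (intro vandermonde_neq_0) (auto simp: inj_on_def nth_eq_iff_index_eq)
    ultimately have "0 = ev (source_weight N ?p) x"
      by simp
    also have "\<dots> = (\<Sum>t\<in>?h ` (?A \<times> ?B). emb (lookup x t) * source_weight N ?p t)"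
      by (rule ev_superset) (use keys finite_bounded_lists in auto)
    also have "\<dots> = (\<Sum>(a, b)\<in>?A \<times> ?B. emb (X a b) * source_weight N ?p (?h (a, b)))"
      unfolding sum.reindex[OF inj] X_def comp_def by (simp add: case_prod_unfold)
    also have "\<dots> = (\<Sum>a\<in>?A. \<Sum>b\<in>?B. emb (X a b) * source_weight N ?p (?h (a, b)))"
      by (rule sum.cartesian_product[symmetric])
    also have "\<dots> = (\<Sum>a\<in>?A. c ys a * (\<Prod>i<M. ys ! (N + i) ^ (a ! i)))"
      unfolding c_def sum_distrib_right
      by (intro sum.cong refl) (simp add: source_weight_def list_weight_hmon bounded_lists_def mult_ac)
    finally show ?thesis ..
  qed
  have c0: "c ys a = 0" if ys: "length ys = N + M" "distinct ys" and a: "a \<in> ?A" for ys a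
  proof (rule multivariate_poly_eq_0[OF _ _ a, of "set ys"])
    show "N - 1 + M \<le> card (set ys)"
      using ys by (simp add: distinct_card)
    fix ts :: "'k list"
    assume ts: "length ts = M" "distinct ts" "set ts \<subseteq> set ys"
    \<comment> \<open>Puts the chosen \<open>ts\<close> last, so that they become the w's; by
      \<open>c_perm\<close> the values of \<open>c\<close> do not notice the reordering.\<close>
    define ys' where "ys' = filter (\<lambda>y. y \<notin> set ts) ys @ ts"
    have "distinct ys'" "set ys' = set ys"
      using ys ts by (auto simp: ys'_def)
    then have mset: "mset ys' = mset ys"
      using ys(2) by (simp add: set_eq_iff_mset_eq_distinct)
    then have len: "length ys' = N + M"
      using ys(1) mset_eq_length by metis
    then have "length (filter (\<lambda>y. y \<notin> set ts) ys) = N"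
      using ts(1) by (simp add: ys'_def)
    then have ts': "ys' ! (N + i) = ts ! i" for i
      by (simp add: ys'_def nth_append)
    obtain \<sigma> where \<sigma>: "\<sigma> permutes {..<length ys}" "permute_list \<sigma> ys = ys'"
      using mset_eq_permutation[OF mset] by blast
    then have "c ys' a = c ys a" for a
      using c_perm ys(1) by metis
    with ev[OF len \<open>distinct ys'\<close>] show "(\<Sum>l\<in>?A. c ys l * (\<Prod>i<M. ts ! i ^ (l ! i))) = 0"
      by (simp add: ts')
  qed
  have "emb (X a b) = 0" if a: "a \<in> ?A" and b: "b \<in> ?B" for a b
  \<comment> \<open>Second use of the zero criterion, now in all \<open>N + M\<close> variables and
    over the whole infinite field.\<close>
  proof (rule multivariate_poly_eq_0[OF _ _ b, of UNIV "\<lambda>b. emb (X a b)"])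
    fix ys :: "'k list"
    assume "length ys = N + M" "distinct ys"
    then show "(\<Sum>b\<in>?B. emb (X a b) * (\<Prod>i<N + M. ys ! i ^ (b ! i))) = 0"
      using c0[of ys a] a by (simp only: c_def)
  qed (use inf in simp)
  then have X0: "X a b = 0" if "a \<in> ?A" "b \<in> ?B" for a b
    using that by (simp only: emb_eq_0)
  have "lookup x t = 0" for t
  proof (rule ccontr)
    assume t: "lookup x t \<noteq> 0"
    then have "t \<in> ?h ` (?A \<times> ?B)"
      using keys by (meson in_keys_iff subsetD)
    then obtain a b where "t = ?h (a, b)" "a \<in> ?A" "b \<in> ?B"
      by blast
    then have "lookup x t = 0"
      using X0[of a b] unfolding X_def by blast
    with t show False ..
  qed
  then show ?thesis
    by (intro poly_mapping_eqI) simp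
qed

end

section \<open>The image lies in the Weyl module\<close>

lemma alternate_sum:
  "alternate n (\<lambda>xs. \<Sum>a\<in>A. F a xs) xs = (\<Sum>a\<in>A. alternate n (F a) xs)"
  unfolding alternate_def sum_distrib_left by (rule sum.swap)

lemma permute_list_map2:
  assumes "\<sigma> permutes {..<length xs}" "length xs = length ys"
  shows "permute_list \<sigma> (map2 f xs ys) = map2 f (permute_list \<sigma> xs) (permute_list \<sigma> ys)"
  using assms by (simp add: permute_list_map permute_list_zip[of \<sigma> "{..<length xs}"])

lemma permute_list_inv_eq_iff:
  assumes "\<sigma> permutes {..<length ys}"
  shows "xs = permute_list \<sigma> ys \<longleftrightarrow> permute_list (inv_into UNIV \<sigma>) xs = ys"
  using permute_list_inv[of \<sigma> ys] permute_list_inv[of \<sigma> xs] assms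
  by (metis length_permute_list)

lemma lookup_diag_mult:
  "lookup (diag_mult N x) xs = (\<Sum>t\<in>keys x. case t of (us, as, bs) \<Rightarrow>
     if map2 (+) (map (hmon (N - 1)) [0..<N] @ as) bs = xs then lookup x t else 0)"
  unfolding diag_mult_def lookup_lin_ext
  by (rule sum.cong) (auto simp: basis_vec_def lookup_single when_def)

text \<open>Multiplication is placewise, so rearranging the last \<open>M\<close> places of a
  product rearranges them in p and h simultaneously, and the coefficients of \<open>x\<close> do not
  change under this.\<close>

lemma permute_row_diag_mult:
  assumes x: "x \<in> sym_tensors U M a (N + M) b"
    and len: "length zs = N" "length ws = M" and mset: "mset ws = mset ws'"
  shows "lookup (diag_mult N x) (zs @ ws) = lookup (diag_mult N x) (zs @ ws')"
proof -
  let ?D = "map (hmon (N - 1)) [0..<N]"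
  have len': "length ws' = M"
    using len(2) mset_eq_length[OF mset] by simp
  obtain \<pi> where "\<pi> permutes {..<length ws}" and ws': "permute_list \<pi> ws = ws'"
    using mset_eq_permutation[OF mset[symmetric]] by blast
  then have \<pi>: "\<pi> permutes {..<M}"
    by (simp add: len)
  define \<rho> where "\<rho> = inv_into UNIV \<pi>"
  have \<rho>: "\<rho> permutes {..<M}"
    unfolding \<rho>_def using \<pi> by (rule permutes_inv)
  \<comment> \<open>Permutes the w's in both factors at once.\<close>
  define P where "P \<tau> = (\<lambda>(us :: 'a, as :: (nat \<times> nat) list, bs).
    (us, permute_list \<tau> as, take N bs @ permute_list \<tau> (drop N bs :: (nat \<times> nat) list)))" for \<tau>
  have kx: "length as = M \<and> length bs = N + M" if "(us, as, bs) \<in> keys x" for us as bs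
    using sym_tensors_length[OF x that] by simp
  have lookup_P: "lookup x (P \<tau> t) = lookup x t" if "t \<in> keys x" "\<tau> permutes {..<M}" for t \<tau>
  proof -
    obtain us as bs where t: "t = (us, as, bs)"
      by (metis prod_cases3)
    have "mset (permute_list \<tau> (drop N bs)) = mset (drop N bs)"
      using that(2) kx[of us as bs] that(1) t by simp
    then have "mset (take N bs @ permute_list \<tau> (drop N bs)) = mset bs"
      by (metis append_take_drop_id mset_append)
    moreover have "mset (permute_list \<tau> as) = mset as"
      using that(2) kx[of us as bs] that(1) t by simp
    ultimately show ?thesis
      unfolding t P_def prod.case by (intro sym_tensors_lookup[OF x]) simp_all
  qed
  have PP: "P \<tau> (P \<tau>' t) = t" if "t \<in> keys x" "\<tau> permutes {..<M}" "\<tau>' \<circ> \<tau> = id" for t \<tau> \<tau>'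
  proof -
    obtain us as bs where t: "t = (us, as, bs)"
      by (metis prod_cases3)
    have "permute_list \<tau> (permute_list \<tau>' l) = l" if "length l = M" for l :: "(nat \<times> nat) list"
      using that \<open>\<tau> permutes {..<M}\<close> \<open>\<tau>' \<circ> \<tau> = id\<close> by (simp flip: permute_list_compose)
    then show ?thesis
      using kx[of us as bs] that(1) by (simp add: t P_def)
  qed
  show ?thesis
    unfolding lookup_diag_mult
  proof (rule sum.reindex_bij_witness[of _ "P \<rho>" "P \<pi>"])
    fix t assume t: "t \<in> keys x"
    show "P \<rho> (P \<pi> t) = t" "P \<pi> (P \<rho> t) = t"
      using t \<pi> \<rho> by (auto intro!: PP simp: \<rho>_def permutes_inv_o)
    show "P \<pi> t \<in> keys x" "P \<rho> t \<in> keys x"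
      using t lookup_P[OF t] \<pi> \<rho> by (simp_all add: in_keys_iff)
    obtain us as bs where ab: "t = (us, as, bs)"
      by (metis prod_cases3)
    have k: "length as = M" "length bs = N + M"
      using kx t ab by blast+
    have split: "map2 (+) (?D @ cs) es = map2 (+) ?D (take N es) @ map2 (+) cs (drop N es)"
      if "length es = N + M" for cs es
      using that zip_append[of ?D "take N es" cs "drop N es"] by simp
    have eq: "map2 (+) (permute_list \<pi> as) (permute_list \<pi> (drop N bs)) = ws' \<longleftrightarrow>
        map2 (+) as (drop N bs) = ws"
    proof -
      have "map2 (+) (permute_list \<pi> as) (permute_list \<pi> (drop N bs)) = permute_list \<pi> (map2 (+) as (drop N bs))"
        using \<pi> k by (simp add: permute_list_map2)
      moreover have "permute_list \<pi> l = permute_list \<pi> ws \<longleftrightarrow> l = ws" if "length l = M" for l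
        using permute_list_inv_eq_iff[of \<pi> ws "permute_list \<pi> l"] permute_list_inv_eq_iff[of \<pi> l "permute_list \<pi> l"] \<pi> that len
        by auto
      ultimately show ?thesis
        using k ws' by simp
    qed
    have "map2 (+) (?D @ permute_list \<pi> as) (take N bs @ permute_list \<pi> (drop N bs)) = zs @ ws' \<longleftrightarrow>
        map2 (+) (?D @ as) bs = zs @ ws"
      using k len by (subst (1 2) split) (simp_all add: eq)
    then show "(case P \<pi> t of (us, as, bs) \<Rightarrow> if map2 (+) (?D @ as) bs = zs @ ws' then lookup x (P \<pi> t) else 0) =
        (case t of (us, as, bs) \<Rightarrow> if map2 (+) (?D @ as) bs = zs @ ws then lookup x t else 0)"
      using lookup_P[OF t \<pi>] by (simp add: ab P_def)
  qed
qed

text \<open>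
  The exponent of \<open>w\<^sub>1\<close> in \<open>p\<close> is less than \<open>N\<close>, so it agrees with the exponent of one of the
  \<open>z\<^sub>i\<close> in the diagonal monomial; the product is therefore invariant under a transposition.
\<close>

lemma alternate_diag_mult_eq_0:
  assumes x: "x \<in> sym_tensors U M (N - 1) (N + M) b" and N: "1 \<le> N" and M: "1 \<le> M"
    and xs: "length xs = N + M"
  shows "alternate (Suc N) (lookup (diag_mult N x)) xs = 0"
proof -
  let ?D = "map (hmon (N - 1)) [0..<N]"
  let ?A = "(fst \<circ> snd) ` keys x"
  \<comment> \<open>The transposition to be used depends on p, so the terms are collected by its
    monomial \<open>as\<close>.\<close>
  define F where "F as ys = (\<Sum>t\<in>{t \<in> keys x. fst (snd t) = as}.
    if map2 (+) (?D @ as) (snd (snd t)) = ys then lookup x t else 0)" for as ys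
  have "lookup (diag_mult N x) = (\<lambda>ys. \<Sum>as\<in>?A. F as ys)"
  proof
    fix ys
    show "lookup (diag_mult N x) ys = (\<Sum>as\<in>?A. F as ys)"
      unfolding lookup_diag_mult F_def
      by (subst sum.image_gen[of _ _ "fst \<circ> snd"]) (auto intro!: sum.cong)
  qed
  then have "alternate (Suc N) (lookup (diag_mult N x)) xs = (\<Sum>as\<in>?A. alternate (Suc N) (F as) xs)"
    by (simp only: alternate_sum)
  also have "\<dots> = 0"
  proof (rule sum.neutral, rule ballI)
    fix as assume "as \<in> ?A"
    then have as: "as \<in> hmon_lists M (N - 1)"
      using sym_tensors_keys(2)[OF x] by force
    then have lenas: "length as = M" and sub: "set as \<subseteq> hmon (N - 1) ` {..N - 1}"
      by (auto simp: hmon_lists_def)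
    have "as ! 0 \<in> set as"
      using lenas M by (intro nth_mem) simp
    \<comment> \<open>The monomial \<open>hmon (N - 1) c\<close> stands at place \<open>c\<close> of
      \<open>?D\<close> and, as head of \<open>as\<close>, at place \<open>N\<close> of
      \<open>?D @ as\<close>.\<close>
    then obtain c where c: "c \<le> N - 1" "as ! 0 = hmon (N - 1) c" "length as = M"
      using sub lenas by auto
    let ?t = "Transposition.transpose c N"
    have t: "?t permutes {..<N + M}"
      using c M N by (intro permutes_swap_id) auto
    have tt: "?t \<circ> ?t = id"
      by (simp add: fun_eq_iff)
    have Dt: "permute_list ?t (?D @ as) = ?D @ as"
      using c M N by (intro permute_list_transpose_same) (auto simp: nth_append)
    show "alternate (Suc N) (F as) xs = 0"
    proof (rule alternate_eq_0_if_symmetric[of _ _ c N])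
      fix ys :: "(nat \<times> nat) list" assume "length ys = length xs"
      then have ys: "length ys = N + M"
        using xs by simp
      let ?P = "\<lambda>(us, as, bs). (us, as, permute_list ?t bs)"
      show "F as (permute_list ?t ys) = F as ys"
        unfolding F_def
      proof (rule sum.reindex_bij_witness[of _ ?P ?P])
        fix t' assume "t' \<in> {t \<in> keys x. fst (snd t) = as}"
        then obtain us bs where t': "t' = (us, as, bs)" "t' \<in> keys x"
          by (cases t') auto
        then have len: "length bs = N + M"
          using sym_tensors_length(2)[OF x] by simp
        have lookup: "lookup x (us, as, permute_list ?t bs) = lookup x t'"
          unfolding t'(1) by (rule sym_tensors_lookup[OF x]) (use t len in simp_all)
        have inv: "permute_list ?t (permute_list ?t l) = l" if "length l = N + M" for l :: "(nat \<times> nat) list"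
          using t that tt by (simp flip: permute_list_compose)
        show "?P (?P t') = t'"
          by (simp add: t' inv len)
        then show "?P (?P t') = t'" .
        show "?P t' \<in> {t \<in> keys x. fst (snd t) = as}"
          using t'(2) lookup by (simp add: t' in_keys_iff)
        then show "?P t' \<in> {t \<in> keys x. fst (snd t) = as}" .
        have "map2 (+) (?D @ as) (permute_list ?t bs) = permute_list ?t (map2 (+) (?D @ as) bs)"
        proof -
          have "permute_list ?t (map2 (+) (?D @ as) bs) = map2 (+) (permute_list ?t (?D @ as)) (permute_list ?t bs)"
            by (rule permute_list_map2) (use t len c(3) in simp_all)
          then show ?thesis
            by (simp only: Dt)
        qed
        moreover have "permute_list ?t (map2 (+) (?D @ as) bs) = ys \<longleftrightarrow>
            map2 (+) (?D @ as) bs = permute_list ?t ys"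
          using inv[of ys] inv[of "map2 (+) (?D @ as) bs"] ys len c(3) by auto
        ultimately show "(if map2 (+) (?D @ as) (snd (snd (?P t'))) = ys then lookup x (?P t') else 0) =
            (if map2 (+) (?D @ as) (snd (snd t')) = permute_list ?t ys then lookup x t' else 0)"
          using lookup by (simp add: t')
      qed
    qed (use c M N xs in auto)
  qed
  finally show ?thesis .
qed

lemma hook_symmetric_plethysm:
  assumes x: "x \<in> sym_tensors U M (N - 1) (N + M) b" and N: "1 \<le> N"
  shows "hook_symmetric N M (lookup (antisymmetrize N (diag_mult N x)))"
proof -
  have "hook_symmetric N M (alternate N (lookup (diag_mult N x)))"
    by (rule hook_symmetric_alternate)
      (use permute_row_diag_mult[OF x] alternate_diag_mult_eq_0[OF x N] in auto)
  then show ?thesis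
    unfolding hook_symmetric_def by (simp add: lookup_antisymmetrize)
qed

text \<open>Degrees add up place by place: \<open>(N - 1) + (d + 1 - N) = d\<close>, where the
  bounds on \<open>N\<close> keep both subtractions exact.\<close>

lemma keys_diag_mult_hmon_lists:
  assumes x: "x \<in> sym_tensors U M (N - 1) (N + M) (d + 1 - N)" and N: "1 \<le> N" "N \<le> d + 1"
    and l: "l \<in> keys (diag_mult N x)"
  shows "l \<in> hmon_lists (N + M) d"
proof -
  obtain us as bs where t: "(us, as, bs) \<in> keys x"
    and l: "l = map2 (+) (map (hmon (N - 1)) [0..<N] @ as) bs"
    using l by (rule keys_diag_mult)
  have as: "as \<in> hmon_lists M (N - 1)" and bs: "bs \<in> hmon_lists (N + M) (d + 1 - N)"
    using sym_tensors_keys(2,3)[OF x t] by auto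
  have D: "map (hmon (N - 1)) [0..<N] @ as \<in> hmon_lists (N + M) (N - 1)"
    using as N by (auto simp: hmon_lists_def)
  have "u + v \<in> hmon d ` {..d}" if uv: "u \<in> hmon (N - 1) ` {..N - 1}" "v \<in> hmon (d + 1 - N) ` {..d + 1 - N}" for u v
  proof -
    obtain i k where "u = hmon (N - 1) i" "i \<le> N - 1" "v = hmon (d + 1 - N) k" "k \<le> d + 1 - N"
      using uv by auto
    then have "u + v = hmon d (i + k)" "i + k \<le> d"
      using N by (auto simp: hmon_def)
    then show ?thesis by blast
  qed
  note sum = this
  have "m \<in> hmon d ` {..d}" if m: "m \<in> set l" for m
  proof -
    obtain u v where uv: "(u, v) \<in> set (zip (map (hmon (N - 1)) [0..<N] @ as) bs)" "m = u + v"
      using m by (auto simp: l)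
    have "u \<in> set (map (hmon (N - 1)) [0..<N] @ as)" "v \<in> set bs"
      using set_zip_leftD[OF uv(1)] set_zip_rightD[OF uv(1)] by auto
    then show ?thesis
      using D bs sum[of u v] uv(2) unfolding hmon_lists_def mem_Collect_eq by blast
  qed
  moreover have "length l = N + M"
    using D bs by (simp add: l hmon_lists_def)
  ultimately show ?thesis
    by (auto simp: hmon_lists_def)
qed

section \<open>Dimensions and equivariance\<close>

lemma subspace_keys: "fspace.subspace {w :: 'b \<Rightarrow>\<^sub>0 'f::field. keys w \<subseteq> A}"
  unfolding fspace.subspace_def
proof (intro conjI ballI allI)
  fix v w :: "'b \<Rightarrow>\<^sub>0 'f" assume "v \<in> {w. keys w \<subseteq> A}" "w \<in> {w. keys w \<subseteq> A}"
  then show "v + w \<in> {w. keys w \<subseteq> A}"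
    using keys_add[of v w] by blast
next
  fix c and w :: "'b \<Rightarrow>\<^sub>0 'f" assume "w \<in> {w. keys w \<subseteq> A}"
  moreover have "keys (cmul c w) \<subseteq> keys w"
    by (auto simp: in_keys_iff)
  ultimately show "cmul c w \<in> {w. keys w \<subseteq> A}"
    by blast
qed simp

lemma keys_span:
  assumes "\<And>v. v \<in> S \<Longrightarrow> keys v \<subseteq> A" "w \<in> fspace.span S"
  shows "keys w \<subseteq> A"
  using fspace.span_minimal[OF _ subspace_keys, of S A] assms by blast

lemma keys_tensor_list:
  assumes "l \<in> keys (tensor_list vs)"
  shows "length l = length vs" "i < length vs \<Longrightarrow> l ! i \<in> keys (vs ! i)"
  using assms by (auto simp: in_keys_iff lookup_tensor_list split: if_splits)

lemma keys_tensor: "keys (tensor v w) = keys v \<times> keys w"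
  by (auto simp: in_keys_iff lookup_tensor)

lemma keys_tensor_power:
  assumes V: "\<And>v. v \<in> vecs V \<Longrightarrow> keys v \<subseteq> K" and w: "w \<in> vecs (tensor_power R V)"
  shows "keys w \<subseteq> {l. length l = R \<and> set l \<subseteq> K}"
proof (rule keys_span)
  show "w \<in> fspace.span {tensor_list vs | vs. length vs = R \<and> set vs \<subseteq> vecs V}"
    using w by (simp add: tensor_power_def)
  fix v assume "v \<in> {tensor_list vs | vs. length vs = R \<and> set vs \<subseteq> vecs V}"
  then obtain vs where vs: "v = tensor_list vs" "length vs = R" "set vs \<subseteq> vecs V"
    by blast
  show "keys v \<subseteq> {l. length l = R \<and> set l \<subseteq> K}"
  proof
    fix l assume l: "l \<in> keys v"
    have "l ! i \<in> K" if "i < length l" for i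
    proof -
      have "i < length vs" "l ! i \<in> keys (vs ! i)"
        using keys_tensor_list[of l vs] l that vs(1) by auto
      moreover have "vs ! i \<in> vecs V"
        using vs(3) \<open>i < length vs\<close> by (meson nth_mem subsetD)
      ultimately show ?thesis
        using V by blast
    qed
    then have "set l \<subseteq> K"
      by (auto simp: in_set_conv_nth)
    then show "l \<in> {l. length l = R \<and> set l \<subseteq> K}"
      using keys_tensor_list(1)[of l vs] l vs by simp
  qed
qed

lemma vecs_upper_sym: "vecs (upper_sym d) = {p. keys p \<subseteq> hmon d ` {..d}}"
proof -
  have "(i, j) \<in> hmon d ` {..d} \<longleftrightarrow> i + j = d" for i j
    by (auto simp: hmon_def image_iff)
  then show ?thesis
    unfolding upper_sym_def rep.simps by (intro Collect_cong) fast
qed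

lemma keys_lower_sym_upper_sym:
  assumes "w \<in> vecs (lower_sym R (upper_sym d))"
  shows "keys w \<subseteq> hmon_lists R d"
proof -
  have "w \<in> vecs (tensor_power R (upper_sym d))"
    using assms by (simp add: lower_sym_def)
  then show ?thesis
    unfolding hmon_lists_def by (rule keys_tensor_power[rotated]) (simp add: vecs_upper_sym)
qed

lemma lookup_lower_sym:
  assumes w: "w \<in> vecs (lower_sym R V)" and mset: "mset l = mset l'"
  shows "lookup w l = lookup w l'"
proof (cases "length l = R")
  case True
  obtain p where p: "p permutes {..<length l}" "permute_list p l = l'"
    using mset_eq_permutation[OF mset[symmetric]] by blast
  have "lookup w l = lookup (place_perm p w) l"
    using w p(1) True by (simp add: lower_sym_def)
  then show ?thesis
    using p by (simp add: lookup_place_perm)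
next
  case False
  moreover have "length l' = length l"
    using mset by (metis mset_eq_length)
  moreover have "keys w \<subseteq> {l. length l = R \<and> set l \<subseteq> UNIV}"
    using w by (intro keys_tensor_power[of V]) (auto simp: lower_sym_def)
  ultimately have "l \<notin> keys w" "l' \<notin> keys w"
    by auto
  then show ?thesis
    by (simp add: in_keys_iff)
qed

lemma subspace_sym_tensors: "fspace.subspace (sym_tensors U M a R b :: (_ \<Rightarrow>\<^sub>0 'f::field) set)"
proof -
  let ?K = "{x :: _ \<Rightarrow>\<^sub>0 'f. keys x \<subseteq> U \<times> hmon_lists M a \<times> hmon_lists R b}"
  let ?S = "{x :: _ \<Rightarrow>\<^sub>0 'f. \<forall>us as as' bs bs'. mset as = mset as' \<longrightarrow> mset bs = mset bs' \<longrightarrow>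
        lookup x (us :: 'a, as :: (nat \<times> nat) list, bs :: (nat \<times> nat) list) = lookup x (us, as', bs')}"
  have "fspace.subspace ?S"
    unfolding fspace.subspace_def
  proof (intro conjI ballI allI)
    fix x y :: "_ \<Rightarrow>\<^sub>0 'f" assume "x \<in> ?S" "y \<in> ?S"
    then show "x + y \<in> ?S"
      unfolding mem_Collect_eq lookup_add by metis
  next
    fix c and x :: "_ \<Rightarrow>\<^sub>0 'f" assume "x \<in> ?S"
    then show "cmul c x \<in> ?S"
      unfolding mem_Collect_eq lookup_cmul by metis
  qed simp
  then have "fspace.subspace (?K \<inter> ?S)"
    using fspace.subspace_inter[OF subspace_keys] by blast
  moreover have "sym_tensors U M a R b = ?K \<inter> ?S"
    unfolding sym_tensors_def by blast
  ultimately show ?thesis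
    by simp
qed

text \<open>\<open>sym_tensors\<close> is a subspace, so its conditions are checked on pure tensors,
  for the inner product first and then for the outer one.\<close>

lemma tensor_rep_lower_sym_subset:
  assumes V: "\<And>v. v \<in> vecs V \<Longrightarrow> keys v \<subseteq> U"
  shows "vecs (tensor_rep V (tensor_rep (lower_sym M (upper_sym a)) (lower_sym R (upper_sym b)))) \<subseteq>
    sym_tensors U M a R b"
proof -
  let ?W = "tensor_rep (lower_sym M (upper_sym a)) (lower_sym R (upper_sym b))"
  have "tensor v w \<in> sym_tensors U M a R b" if v: "v \<in> vecs V" and w: "w \<in> vecs ?W" for v w
  proof -
    let ?S = "{tensor w1 w2 | w1 w2. w1 \<in> vecs (lower_sym M (upper_sym a)) \<and>
      w2 \<in> vecs (lower_sym R (upper_sym b))}"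
    have lin: "Vector_Spaces.linear cmul cmul (tensor v)"
      by unfold_locales (auto intro!: poly_mapping_eqI simp: lookup_tensor lookup_add algebra_simps)
    have "tensor v x \<in> fspace.span (sym_tensors U M a R b)" if xS: "x \<in> ?S" for x
    proof -
      obtain w1 w2 where x: "x = tensor w1 w2" and w1: "w1 \<in> vecs (lower_sym M (upper_sym a))"
        and w2: "w2 \<in> vecs (lower_sym R (upper_sym b))"
        using xS by blast
      have "keys (tensor v x) \<subseteq> U \<times> hmon_lists M a \<times> hmon_lists R b"
        unfolding x keys_tensor
        using V[OF v] keys_lower_sym_upper_sym[OF w1] keys_lower_sym_upper_sym[OF w2] by blast
      moreover have "lookup (tensor v x) (us, as, bs) = lookup (tensor v x) (us, as', bs')"
        if "mset as = mset as'" "mset bs = mset bs'" for us as as' bs bs'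
        unfolding x lookup_tensor
        using lookup_lower_sym[OF w1 that(1)] lookup_lower_sym[OF w2 that(2)] by simp
      ultimately have "tensor v x \<in> sym_tensors U M a R b"
        unfolding sym_tensors_def by blast
      then show ?thesis
        by (rule fspace.span_base)
    qed
    moreover have "w \<in> fspace.span ?S"
      using w by (simp add: tensor_rep_def)
    ultimately have "tensor v w \<in> fspace.span (sym_tensors U M a R b)"
      using linear_span_closed[OF lin] by blast
    then show ?thesis
      by (metis fspace.span_eq_iff subspace_sym_tensors)
  qed
  then show ?thesis
    unfolding tensor_rep_def[of V] rep.simps
    by (intro fspace.span_minimal subspace_sym_tensors) blast
qed

text \<open>An orbit sum of basis lists; these form the usual basis of a lower symmetric power in
  every characteristic.\<close>

definition monomial_sym :: "'b multiset \<Rightarrow> ('b list \<Rightarrow>\<^sub>0 'f::field)" where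
  "monomial_sym A = (\<Sum>l\<in>permutations_of_multiset A. basis_vec l)"

lemma lookup_monomial_sym: "lookup (monomial_sym A) l = (if mset l = A then 1 else 0)"
proof -
  have "lookup (monomial_sym A) l = (\<Sum>l'\<in>permutations_of_multiset A. if l' = l then 1 else 0)"
    unfolding monomial_sym_def lookup_sum
    by (rule sum.cong[OF refl]) (simp add: basis_vec_def lookup_single when_def)
  also have "\<dots> = (if mset l = A then 1 else 0)"
    unfolding sum.delta[OF finite_permutations_of_multiset]
    by (simp add: permutations_of_multiset_def)
  finally show ?thesis .
qed

lemma monomial_sym_in_lower_sym:
  assumes "\<And>a. a \<in># A \<Longrightarrow> basis_vec a \<in> vecs V" "size A = R"
  shows "monomial_sym A \<in> vecs (lower_sym R V)"
proof -
  have "monomial_sym A \<in> vecs (tensor_power R V)"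
    unfolding monomial_sym_def tensor_power_def rep.simps
  proof (intro fspace.span_sum fspace.span_base)
    fix l assume "l \<in> permutations_of_multiset A"
    then have "mset l = A"
      by (rule permutations_of_multisetD)
    then have "length (map basis_vec l :: (_ \<Rightarrow>\<^sub>0 'b) list) = R"
      "set (map basis_vec l) \<subseteq> vecs V"
      using assms by auto
    then show "basis_vec l \<in> {tensor_list vs | vs. length vs = R \<and> set vs \<subseteq> vecs V}"
      unfolding tensor_list_basis_vec[symmetric] by blast
  qed
  moreover have "place_perm \<sigma> (monomial_sym A) = (monomial_sym A :: _ \<Rightarrow>\<^sub>0 'b)"
    if \<sigma>: "\<sigma> permutes {..<R}" for \<sigma>
  proof (rule poly_mapping_eqI)
    fix l :: "'a list"
    show "lookup (place_perm \<sigma> (monomial_sym A :: _ \<Rightarrow>\<^sub>0 'b)) l = lookup (monomial_sym A) l"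
    proof (cases "length l = R")
      case True
      then show ?thesis
        using \<sigma> by (simp add: lookup_place_perm lookup_monomial_sym)
    next
      case False
      have "l' \<notin> keys (monomial_sym A :: _ \<Rightarrow>\<^sub>0 'b)" if "permute_list (inv_into UNIV \<sigma>) l' = l" for l'
        using that False assms(2) by (auto simp: in_keys_iff lookup_monomial_sym)
      then have "l \<notin> keys (place_perm \<sigma> (monomial_sym A :: _ \<Rightarrow>\<^sub>0 'b))"
        unfolding place_perm_def by (auto simp: keys_basis_vec elim!: keys_lin_ext)
      moreover have "mset l \<noteq> A"
        using False assms(2) by auto
      ultimately show ?thesis
        by (simp add: in_keys_iff lookup_monomial_sym)
    qed
  qed
  ultimately show ?thesis
    by (simp add: lower_sym_def)
qed

section \<open>Linear independence and counting\<close>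

lemma independent_image:
  fixes f :: "'t \<Rightarrow> ('b \<Rightarrow>\<^sub>0 'f::field)"
  assumes T: "finite T"
    and f: "\<And>c. (\<Sum>t\<in>T. cmul (c t) (f t)) = 0 \<Longrightarrow> \<forall>t\<in>T. c t = 0"
  shows "inj_on f T" "fspace.independent (f ` T)"
proof -
  show inj: "inj_on f T"
  proof (rule inj_onI)
    fix s t assume st: "s \<in> T" "t \<in> T" "f s = f t"
    show "s = t"
    proof (rule ccontr)
      assume "s \<noteq> t"
      define c :: "'t \<Rightarrow> 'f" where "c = (\<lambda>r. if r = s then 1 else if r = t then - 1 else 0)"
      have "(\<Sum>r\<in>T. cmul (c r) (f r)) = (\<Sum>r\<in>{s, t}. cmul (c r) (f r))"
        using T st by (intro sum.mono_neutral_right) (auto simp: c_def)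
      also have "\<dots> = 0"
        using \<open>s \<noteq> t\<close> st(3) by (simp add: c_def)
      finally have "c s = 0"
        using f st(1) by blast
      then show False
        by (simp add: c_def)
    qed
  qed
  show "fspace.independent (f ` T)"
    unfolding fspace.dependent_finite[OF finite_imageI[OF T]]
  proof clarify
    fix u t assume "(\<Sum>v\<in>f ` T. cmul (u v) v) = 0" "t \<in> T" "u (f t) \<noteq> 0"
    then show False
      using f[of "u \<circ> f"] by (simp add: sum.reindex[OF inj])
  qed
qed

text \<open>A vector of \<open>T\<close> outside the span of \<open>S\<close> would extend
  \<open>S\<close> to an independent set with more than \<open>card T\<close> elements in the span
  of \<open>T\<close>.\<close>

lemma span_eq_if_independent:
  assumes "fspace.independent S" "finite T" "S \<subseteq> fspace.span T" "card T \<le> card S"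
  shows "fspace.span T = fspace.span S"
proof -
  have "T \<subseteq> fspace.span S"
  proof (rule ccontr)
    assume "\<not> T \<subseteq> fspace.span S"
    then obtain t where t: "t \<in> T" "t \<notin> fspace.span S"
      by blast
    have fin: "finite S"
      using fspace.independent_span_bound[OF assms(2,1,3)] by simp
    have "fspace.independent (insert t S)"
      using t(2) assms(1) by (simp add: fspace.independent_insert)
    moreover have "insert t S \<subseteq> fspace.span T"
      using t(1) assms(3) by (simp add: fspace.span_base)
    ultimately have "card (insert t S) \<le> card T"
      using fspace.independent_span_bound[OF assms(2)] by blast
    moreover have "t \<notin> S"
      using t(2) fspace.span_base by blast
    ultimately show False
      using fin assms(4) by simp
  qed
  then show ?thesis
    using assms(3) by (metis fspace.span_eq)
qed

text \<open>Trinomial revision turns the product into \<open>(k + M) choose (M + N - 1)\<close>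
  times a constant, and the hockey-stick identity sums it.\<close>

lemma sum_choose_mult_choose:
  assumes "1 \<le> N"
  shows "(\<Sum>k\<le>d. ((k + M) choose M) * (k choose (N - 1))) =
    ((M + N - 1) choose M) * ((d + M + 1) choose (M + N))"
proof -
  have *: "((k + M) choose M) * (k choose (N - 1)) = ((k + M) choose (M + N - 1)) * ((M + N - 1) choose M)" for k
  proof (cases "N - 1 \<le> k")
    case True
    then show ?thesis
      using choose_mult[of M "M + N - 1" "k + M"] assms by simp
  qed (use assms in \<open>simp add: binomial_eq_0\<close>)
  have "(\<Sum>k\<le>d. (k + M) choose (M + N - 1)) = (\<Sum>j\<in>{M..d + M}. j choose (M + N - 1))"
    by (rule sum.reindex_bij_witness[of _ "\<lambda>j. j - M" "\<lambda>k. k + M"]) auto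
  \<comment> \<open>The added terms have \<open>j < M\<close>, below the lower index
    \<open>M + N - 1\<close>, and are zero.\<close>
  also have "\<dots> = (\<Sum>j\<le>d + M. j choose (M + N - 1))"
    using assms by (intro sum.mono_neutral_left) auto
  also have "\<dots> = (d + M + 1) choose (M + N)"
    using assms by (simp add: sum_choose_upper)
  finally show ?thesis
    unfolding * sum_distrib_right[symmetric] by (simp only: mult.commute)
qed

text \<open>A semistandard hook is recovered from its corner \<open>a\<close>, the multiset of its
  arm in \<open>{a..d}\<close> and the set of its leg in \<open>{a<..d}\<close>. Counting these with
  \<open>k = d - a\<close> gives the sum of \<open>sum_choose_mult_choose\<close>.\<close>

lemma card_hook_ssyt_le:
  assumes N: "1 \<le> N"
  shows "card (hook_ssyt M N d) \<le> ((M + N - 1) choose M) * ((d + M + 1) choose (M + N))"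
proof -
  let ?B = "\<lambda>a. multisets_of_size {a..d} M \<times> {B. B \<subseteq> {a<..d} \<and> card B = N - 1}"
  let ?f = "\<lambda>(as, bs). (hd as, mset (tl as), set bs)"
  have fin: "finite (?B a)" for a
    by (intro finite_cartesian_product finite_multisets_of_size) auto
  have "card (hook_ssyt M N d) \<le> card (SIGMA a:{..d}. ?B a)"
  proof (rule card_inj_on_le)
    show "inj_on ?f (hook_ssyt M N d)"
    proof (rule inj_onI)
      fix s t assume st: "s \<in> hook_ssyt M N d" "t \<in> hook_ssyt M N d" "?f s = ?f t"
      obtain as bs as' bs' where ab: "s = (as, bs)" "t = (as', bs')"
        by (metis surj_pair)
      have ne: "as \<noteq> []" "as' \<noteq> []"
        and srt: "sorted as" "sorted as'" "sorted bs" "sorted bs'" "distinct bs" "distinct bs'"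
        using st(1,2) by (auto simp: ab hook_ssyt_def strict_sorted_iff)
      have "mset as = mset as'"
        using st(3) ne by (cases as; cases as') (auto simp: ab)
      then have "as = as'"
        using srt(1,2) by (metis properties_for_sort)
      moreover have "bs = bs'"
        using srt st(3) by (simp add: ab sorted_distinct_set_unique)
      ultimately show "s = t"
        by (simp add: ab)
    qed
    show "?f ` hook_ssyt M N d \<subseteq> (SIGMA a:{..d}. ?B a)"
    proof (rule image_subsetI)
      fix t assume "t \<in> hook_ssyt M N d"
      then obtain as bs where ab: "t = (as, bs)" and t: "(as, bs) \<in> hook_ssyt M N d"
        by (cases t) auto
      obtain a as' where as: "as = a # as'"
        using t by (cases as) (auto simp: hook_ssyt_def)
      show "?f t \<in> (SIGMA a:{..d}. ?B a)"
        using t by (auto simp: ab hook_ssyt_def as multisets_of_size_def distinct_card strict_sorted_iff)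
    qed
    show "finite (SIGMA a:{..d}. ?B a)"
      by (intro finite_SigmaI fin) simp
  qed
  also have "\<dots> = (\<Sum>a\<le>d. card (?B a))"
    by (rule card_SigmaI) (auto intro: fin)
  also have "\<dots> = (\<Sum>a\<le>d. ((d - a + M) choose M) * ((d - a) choose (N - 1)))"
  proof (rule sum.cong[OF refl])
    fix a assume "a \<in> {..d}"
    then show "card (?B a) = ((d - a + M) choose M) * ((d - a) choose (N - 1))"
      by (simp add: card_cartesian_product card_multisets_of_size n_subsets Suc_diff_le)
  qed
  also have "\<dots> = (\<Sum>k\<le>d. ((k + M) choose M) * (k choose (N - 1)))"
    by (rule sum.reindex_bij_witness[of _ "\<lambda>k. d - k" "\<lambda>a. d - a"]) auto
  finally show ?thesis
    using sum_choose_mult_choose[OF N] by simp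
qed

section \<open>Supports of images, and equivariance\<close>

lemma keys_tensor_map:
  assumes "\<And>a b. (a, b) \<in> keys u \<Longrightarrow> keys (f (basis_vec a)) \<subseteq> A \<and> keys (h (basis_vec b)) \<subseteq> B"
  shows "keys (tensor_map f h u) \<subseteq> A \<times> B"
proof
  fix t assume "t \<in> keys (tensor_map f h u)"
  then obtain ab where "ab \<in> keys u" "t \<in> keys (case ab of (a, b) \<Rightarrow> tensor (f (basis_vec a)) (h (basis_vec b)))"
    unfolding tensor_map_def by (rule keys_lin_ext)
  then show "t \<in> A \<times> B"
    using assms by (cases ab) (auto simp: keys_tensor)
qed

lemma keys_tensor_list_map_act:
  fixes g :: "'f::field ^ 2 ^ 2"
  assumes g: "g \<in> carrier GL2" and l: "l \<in> hmon_lists n d"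
  shows "keys (tensor_list_map (act (upper_sym d) g) (basis_vec l)) \<subseteq> hmon_lists n d"
proof -
  let ?vs = "map (\<lambda>a. act (upper_sym d) g (basis_vec a)) l"
  have "set ?vs \<subseteq> vecs (upper_sym d)"
  proof
    fix v assume "v \<in> set ?vs"
    then obtain a where a: "a \<in> set l" "v = act (upper_sym d) g (basis_vec a)"
      by auto
    then have "(basis_vec a :: _ \<Rightarrow>\<^sub>0 'f) \<in> vecs (upper_sym d)"
      using l by (auto simp: vecs_upper_sym keys_basis_vec hmon_lists_def)
    then show "v \<in> vecs (upper_sym d)"
      using linear_repD(3)[OF linear_rep_upper_sym g] a(2) by blast
  qed
  moreover have "length ?vs = n"
    using l by (simp add: hmon_lists_def)
  ultimately have "tensor_list ?vs \<in> vecs (tensor_power n (upper_sym d))"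
    unfolding tensor_power_def rep.simps by (intro fspace.span_base) blast
  then have "keys (tensor_list ?vs) \<subseteq> hmon_lists n d"
    unfolding hmon_lists_def by (rule keys_tensor_power[rotated]) (simp add: vecs_upper_sym)
  then show ?thesis
    by (simp add: tensor_list_map_def)
qed

lemma keys_plethysm_map:
  fixes x :: "'u \<times> (nat \<times> nat) list \<times> (nat \<times> nat) list \<Rightarrow>\<^sub>0 'f::field"
  assumes x: "x \<in> sym_tensors U M (N - 1) (N + M) (d + 1 - N)" and N: "1 \<le> N" "N \<le> d + 1"
  shows "keys (antisymmetrize N (diag_mult N x)) \<subseteq> hmon_lists (N + M) d"
    and "keys (plethysm_map N x) \<subseteq> hmon_lists N d \<times> hmon_lists M d"
proof -
  show *: "keys (antisymmetrize N (diag_mult N x)) \<subseteq> hmon_lists (N + M) d"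
  proof
    fix l assume "l \<in> keys (antisymmetrize N (diag_mult N x))"
    then obtain l' \<tau> where l': "l' \<in> keys (diag_mult N x)" "\<tau> permutes {..<N}" "l = permute_list \<tau> l'"
      by (rule keys_antisymmetrize)
    then show "l \<in> hmon_lists (N + M) d"
      using keys_diag_mult_hmon_lists[OF x N] permutes_lessThan_mono[OF l'(2), of "N + M"]
        permute_list_hmon_lists[of \<tau> "N + M" l' d] by simp
  qed
  show "keys (plethysm_map N x) \<subseteq> hmon_lists N d \<times> hmon_lists M d"
  proof
    fix t assume "t \<in> keys (plethysm_map N x)"
    then obtain l where l: "l \<in> keys (antisymmetrize N (diag_mult N x))"
      "t \<in> keys (basis_vec (take N l, drop N l) :: _ \<Rightarrow>\<^sub>0 'f)"
      unfolding plethysm_map_def unflatten_def by (rule keys_lin_ext)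
    then show "t \<in> hmon_lists N d \<times> hmon_lists M d"
      using * by (auto simp: keys_basis_vec hmon_lists_def dest!: subsetD[OF *] in_set_takeD in_set_dropD)
  qed
qed

text \<open>On flat lists the image satisfies \<open>hook_symmetric\<close>, so it is a combination
  of antisymmetrized row sums; \<open>unflatten\<close> turns these into the
  \<open>F_Delta\<close>.\<close>

lemma plethysm_map_in_hook_weyl:
  assumes x: "x \<in> sym_tensors U M (N - 1) (N + M) (d + 1 - N)" and N: "1 \<le> N" "N \<le> d + 1"
  shows "plethysm_map N x \<in> vecs (hook_weyl_upper_sym M N d)"
proof -
  let ?A = "\<lambda>(as, bs). antisymmetrize N (row_sym (map (hmon d) as, map (hmon d) bs)) :: _ \<Rightarrow>\<^sub>0 'b"
  let ?v = "\<lambda>i. basis_vec (hmon d i) :: _ \<Rightarrow>\<^sub>0 'b"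
  have "length l = N + M \<and> set l \<subseteq> hmon d ` {..d}" if "l \<in> keys (antisymmetrize N (diag_mult N x))" for l
    using keys_plethysm_map(1)[OF x N] that by (auto simp: hmon_lists_def)
  then have span: "antisymmetrize N (diag_mult N x) \<in> fspace.span (?A ` hook_ssyt M N d)"
    by (rule hook_symmetric_in_span[OF N(1) inj_hmon hook_symmetric_plethysm[OF x N(1)]])
  have "unflatten N v \<in> fspace.span (F_Delta ?v ` hook_ssyt M N d)" if v: "v \<in> ?A ` hook_ssyt M N d" for v
  proof -
    obtain as bs where ab: "(as, bs) \<in> hook_ssyt M N d"
      "v = antisymmetrize N (row_sym (map (hmon d) as, map (hmon d) bs))"
      using v by auto
    have "F_Delta ?v (as, bs) = unflatten N v"
      unfolding ab(2) using ab(1)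
      by (intro F_Delta_eq_unflatten[OF N(1) inj_hmon, of _ M]) (auto simp: hook_ssyt_def)
    then show ?thesis
      using ab(1) by (metis fspace.span_base image_eqI)
  qed
  then have "unflatten N (antisymmetrize N (diag_mult N x)) \<in> fspace.span (F_Delta ?v ` hook_ssyt M N d)"
    by (rule linear_span_closed[OF linear_unflatten _ span])
  then show ?thesis
    by (simp add: plethysm_map_def hook_weyl_upper_sym_def hook_weyl_def pX_power_mult_pY_power hmon_def)
qed

context field_embedding
begin

lemma ev_diff: "ev m (u - v) = ev m u - ev m v"
proof -
  have "keys (u - v) \<subseteq> keys u \<union> keys v"
    by (auto simp: in_keys_iff lookup_minus)
  then show ?thesis
    by (simp add: ev_superset[of "keys u \<union> keys v"] lookup_minus emb_diff left_diff_distrib sum_subtractf)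
qed

text \<open>Both sides are evaluated at points \<open>(1, y i)\<close>. On the right the moved
  points multiply the Vandermonde factor by exactly the power of the determinant that
  \<open>det_rep\<close> contributes on the left. The symmetry of \<open>act V g x\<close> is
  assumed because the evaluation formula is applied to it as well.\<close>

lemma plethysm_map_equivariant:
  fixes g :: "'f ^ 2 ^ 2" and M N d :: nat
  defines "V \<equiv> tensor_rep (tensor_power (N choose 2) det_rep)
      (tensor_rep (lower_sym M (upper_sym (N - 1))) (lower_sym (N + M) (upper_sym (d + 1 - N))))"
  assumes inf: "infinite (UNIV :: 'k set)" and N: "1 \<le> N" "N \<le> d + 1"
    and g: "g \<in> carrier GL2"
    and x: "x \<in> sym_tensors U M (N - 1) (N + M) (d + 1 - N)"
    and gx: "act V g x \<in> sym_tensors U M (N - 1) (N + M) (d + 1 - N)"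
    and U: "\<And>us. us \<in> U \<Longrightarrow> length us = N choose 2"
  shows "plethysm_map N (act V g x) = act (hook_weyl_upper_sym M N d) g (plethysm_map N x)"
proof -
  let ?T = "tensor_map (tensor_list_map (act (upper_sym d) g)) (tensor_list_map (act (upper_sym d) g))"
  have actW: "act (hook_weyl_upper_sym M N d) g = ?T"
    by (simp add: hook_weyl_upper_sym_def hook_weyl_def tensor_rep_def ext_power_def tensor_power_def)
  have actV: "act V g = tensor_map (tensor_list_map (cmul (det g)))
      (tensor_map (tensor_list_map (act (upper_sym (N - 1)) g)) (tensor_list_map (act (upper_sym (d + 1 - N)) g)))"
    by (simp add: V_def tensor_rep_def lower_sym_def tensor_power_def det_rep_def)
  define a b c e where "a = emb (g $ 1 $ 1)" and "b = emb (g $ 1 $ 2)" and "c = emb (g $ 2 $ 1)"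
    and "e = emb (g $ 2 $ 2)"
  have det: "emb (det g) = a * e - b * c"
    by (simp add: det_2 emb_diff emb_mult a_def b_def c_def e_def)
  have "det g \<noteq> 0"
    using g by (simp add: GL2_def invertible_det_nz)
  then have D: "a * e - b * c \<noteq> 0"
    unfolding det[symmetric] by simp
  define S where "S = {y. a + c * y \<noteq> 0}"
  \<comment> \<open>At most one point goes to infinity; for \<open>c = 0\<close> there is none,
    since \<open>a\<close> is then nonzero.\<close>
  have "- S \<subseteq> {- a / c}"
  proof
    fix y assume "y \<in> - S"
    then have *: "c * y = - a"
      by (simp add: S_def add_eq_0_iff)
    with D have "c \<noteq> 0"
      by auto
    with * show "y \<in> {- a / c}"
      by (simp add: field_simps)
  qed
  then have S: "infinite S"
    using inf by (metis Compl_eq_Diff_UNIV Diff_infinite_finite double_complement finite.emptyI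
        finite_insert finite_subset)
  have "plethysm_map N (act V g x) - ?T (plethysm_map N x) = 0"
  proof (rule eq_0_if_ev_target_eq_0[OF _ S])
    have "keys (?T (plethysm_map N x)) \<subseteq> hmon_lists N d \<times> hmon_lists M d"
      by (rule keys_tensor_map)
        (use keys_plethysm_map(2)[OF x N] keys_tensor_list_map_act[OF g] in blast)
    moreover have "keys (u - v) \<subseteq> keys u \<union> keys v" for u v :: "(nat \<times> nat) list \<times> (nat \<times> nat) list \<Rightarrow>\<^sub>0 'f"
      by (auto simp: in_keys_iff lookup_minus)
    ultimately show "keys (plethysm_map N (act V g x) - ?T (plethysm_map N x)) \<subseteq> hmon_lists N d \<times> hmon_lists M d"
      using keys_plethysm_map(2)[OF gx N] by blast
    fix y assume y: "inj_on y {..<N + M}" "y ` {..<N + M} \<subseteq> S"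
    let ?p = "\<lambda>i. (1, y i)" and ?q = "\<lambda>i. gl2_transform g (1, y i)"
    have q: "?q = (\<lambda>i. (a + c * y i, b + e * y i))"
      by (simp add: gl2_transform_def a_def b_def c_def e_def)
    have inj: "inj_on y {..<N}"
      using y(1) by (rule inj_on_subset) auto
    have "a + c * y i \<noteq> 0" if "i < N" for i
    proof -
      have "y i \<in> S"
        using y(2) that by auto
      then show ?thesis
        by (simp add: S_def)
    qed
    then have vand: "hvandermonde N ?q = emb (det g) ^ (N choose 2) * vandermonde N y"
      unfolding q det by (intro hvandermonde_transform inj D)
    have "ev (target_weight N ?p) (plethysm_map N (act V g x)) =
        vandermonde N y * ev (source_weight N ?p) (act V g x)"
      using ev_plethysm_map[OF gx, of ?p] by (simp only: hvandermonde_affine)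
    also have "ev (source_weight N ?p) (act V g x) = emb (det g) ^ (N choose 2) * ev (source_weight N ?q) x"
      unfolding actV by (rule ev_source_act) (use sym_tensors_keys(1)[OF x] U in blast)
    also have "vandermonde N y * (emb (det g) ^ (N choose 2) * ev (source_weight N ?q) x) =
        ev (target_weight N ?q) (plethysm_map N x)"
      using ev_plethysm_map[OF x, of ?q] vand by (simp add: mult_ac)
    also have "\<dots> = ev (target_weight N ?p) (?T (plethysm_map N x))"
      by (rule ev_target_act[symmetric])
    finally show "ev (target_weight N ?p) (plethysm_map N (act V g x) - ?T (plethysm_map N x)) = 0"
      by (simp add: ev_diff)
  qed
  then show ?thesis
    by (simp add: actW)
qed

end

text \<open>Rational functions in one variable give an infinite extension of any field.\<close>

lemma field_embedding_fract: "field_embedding (\<lambda>c :: 'f::field. to_fract [:c:])"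
proof
  show "to_fract [:1 :: 'f:] = 1"
    by (simp flip: one_pCons)
qed (simp_all add: mult.commute flip: to_fract_add to_fract_mult)

lemma infinite_fract_poly: "infinite (UNIV :: 'f::field poly fract set)"
proof -
  have "inj (\<lambda>n. to_fract (monom (1 :: 'f) n))"
    by (auto simp: inj_on_def monom_eq_iff')
  then show ?thesis
    by (metis finite_imageD finite_subset infinite_UNIV_nat subset_UNIV)
qed

theorem corollary5p1:
  fixes M N d :: nat
  assumes "N \<ge> 1" and "N \<le> d + 1"
  shows "rep_isomorphic (GL2 :: ('f::field ^ 2 ^ 2) monoid)
           (tensor_rep (tensor_power (N choose 2) det_rep)
             (tensor_rep (lower_sym M (upper_sym (N - 1)))
               (lower_sym (M + N) (upper_sym (d + 1 - N)))))
           (hook_weyl_upper_sym M N d)"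
proof -
  let ?e = "d + 1 - N"
  let ?C = "N choose 2"
  let ?us = "replicate ?C ()"
  \<comment> \<open>\<open>N + M\<close> in place of \<open>M + N\<close>, because the lists start
    with the \<open>N\<close> places of the z's; the sum is commuted back at the end.\<close>
  define V :: "('f ^ 2 ^ 2, _ \<Rightarrow>\<^sub>0 'f) rep" where
    "V = tensor_rep (tensor_power ?C det_rep)
      (tensor_rep (lower_sym M (upper_sym (N - 1))) (lower_sym (N + M) (upper_sym ?e)))"
  define W :: "('f ^ 2 ^ 2, _ \<Rightarrow>\<^sub>0 'f) rep" where "W = hook_weyl_upper_sym M N d"
  define \<phi> :: "(unit list \<times> (nat \<times> nat) list \<times> (nat \<times> nat) list \<Rightarrow>\<^sub>0 'f) \<Rightarrow> _" where
    "\<phi> = plethysm_map N"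
  interpret emb: field_embedding "\<lambda>c :: 'f. to_fract [:c:]"
    by (rule field_embedding_fract)
  interpret \<phi>: Vector_Spaces.linear cmul cmul \<phi>
    unfolding \<phi>_def by (rule linear_plethysm_map)
  have V: "linear_rep GL2 V"
    unfolding V_def
    by (intro linear_rep_tensor_rep linear_rep_tensor_power linear_rep_lower_sym monoid_GL2
        linear_rep_det_rep linear_rep_upper_sym)
  have sub: "vecs V \<subseteq> sym_tensors {?us} M (N - 1) (N + M) ?e"
    unfolding V_def
  proof (rule tensor_rep_lower_sym_subset)
    fix v assume "v \<in> vecs (tensor_power ?C (det_rep :: ('f ^ 2 ^ 2, _) rep))"
    then have "keys v \<subseteq> {l. length l = ?C \<and> set l \<subseteq> UNIV}"
      by (rule keys_tensor_power[rotated]) simp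
    then show "keys v \<subseteq> {?us}"
      by (auto simp: list_eq_iff_nth_eq)
  qed
  have W_eq: "vecs W = fspace.span (F_Delta (\<lambda>i. pX ^ (d - i) * pY ^ i) ` hook_ssyt M N d)"
    by (simp add: W_def hook_weyl_upper_sym_def hook_weyl_def)
  have into: "\<phi> x \<in> vecs W" if "x \<in> vecs V" for x
    unfolding \<phi>_def W_def using sub that assms by (intro plethysm_map_in_hook_weyl) blast+
  have ker: "x = 0" if "x \<in> vecs V" "\<phi> x = 0" for x
    using emb.plethysm_map_eq_0_imp[of x ?us M N ?e] sub that assms infinite_fract_poly
    by (auto simp: \<phi>_def)
  have equiv: "\<phi> (act V g x) = act W g (\<phi> x)" if g: "g \<in> carrier GL2" and x: "x \<in> vecs V" for g x
  proof -
    have x': "x \<in> sym_tensors {?us} M (N - 1) (N + M) ?e"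
      and gx': "act V g x \<in> sym_tensors {?us} M (N - 1) (N + M) ?e"
      using sub x linear_repD(3)[OF V g x] by blast+
    show ?thesis
      unfolding \<phi>_def W_def V_def
      by (rule emb.plethysm_map_equivariant[OF infinite_fract_poly assms g x' gx'[unfolded V_def]]) auto
  qed
  \<comment> \<open>Indexes orbit sums of the source by multisets of exponents.\<close>
  define T where "T = multisets_of_size {..N - 1} M \<times> multisets_of_size {..?e} (N + M)"
  define \<beta> :: "nat multiset \<times> nat multiset \<Rightarrow> _ \<Rightarrow>\<^sub>0 'f" where
    "\<beta> = (\<lambda>(A, B). tensor (basis_vec ?us) (tensor (monomial_sym (image_mset (hmon (N - 1)) A))
      (monomial_sym (image_mset (hmon ?e) B))))"
  have finT: "finite T"
    by (auto simp: T_def intro: finite_multisets_of_size)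
  have \<beta>V: "\<beta> t \<in> vecs V" if t: "t \<in> T" for t
  proof -
    obtain A B where AB: "t = (A, B)" "set_mset A \<subseteq> {..N - 1}" "size A = M"
      "set_mset B \<subseteq> {..?e}" "size B = N + M"
      using t by (auto simp: T_def multisets_of_size_def)
    have mono: "monomial_sym (image_mset (hmon k) X) \<in> vecs (lower_sym (size X) (upper_sym k :: ('f ^ 2 ^ 2, _) rep))"
      if X: "set_mset X \<subseteq> {..k}" for k X
    proof (rule monomial_sym_in_lower_sym)
      fix a assume "a \<in># image_mset (hmon k) X"
      then obtain i where "i \<in># X" "a = hmon k i"
        unfolding set_image_mset by (rule imageE)
      then show "basis_vec a \<in> vecs (upper_sym k :: ('f ^ 2 ^ 2, _) rep)"
        using X by (auto simp: vecs_upper_sym keys_basis_vec)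
    qed simp
    have "monomial_sym (image_mset (hmon (N - 1)) A) \<in> vecs (lower_sym M (upper_sym (N - 1) :: ('f ^ 2 ^ 2, _) rep))"
      "monomial_sym (image_mset (hmon ?e) B) \<in> vecs (lower_sym (N + M) (upper_sym ?e :: ('f ^ 2 ^ 2, _) rep))"
      using mono[OF AB(2)] mono[OF AB(4)] by (simp_all only: AB(3,5))
    moreover have "basis_vec ?us \<in> vecs (tensor_power ?C (det_rep :: ('f ^ 2 ^ 2, _) rep))"
      unfolding tensor_power_def rep.simps det_rep_def
      by (intro fspace.span_base CollectI exI[of _ "map basis_vec ?us"])
        (simp add: tensor_list_basis_vec del: map_replicate)
    ultimately show ?thesis
      unfolding V_def tensor_rep_def rep.simps \<beta>_def AB(1) prod.case
      by (blast intro: fspace.span_base)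
  qed
  \<comment> \<open>As \<open>\<phi>\<close> has trivial kernel, a relation among the images is one
    among the \<open>\<beta> t\<close>, and each of these has a position at which it alone has a
    nonzero coefficient.\<close>
  have coeff: "\<forall>t\<in>T. c t = 0" if sum: "(\<Sum>t\<in>T. cmul (c t) (\<phi> (\<beta> t))) = 0" for c
  proof
    fix t assume t: "t \<in> T"
    have "\<phi> (\<Sum>t\<in>T. cmul (c t) (\<beta> t)) = 0"
      using sum by (simp add: \<phi>.sum \<phi>.scale)
    moreover have "(\<Sum>t\<in>T. cmul (c t) (\<beta> t)) \<in> vecs V"
      using \<beta>V linear_repD(1)[OF V] by (intro fspace.subspace_sum fspace.subspace_scale)
    ultimately have 0: "(\<Sum>t\<in>T. cmul (c t) (\<beta> t)) = 0"
      using ker by blast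
    obtain A B where AB: "t = (A, B)" by force
    obtain as bs where ab: "mset as = A" "mset bs = B"
      using ex_mset by metis
    have inj: "image_mset (hmon k) X = image_mset (hmon k) Y \<longleftrightarrow> X = Y" for k X Y
      using inj_eq[OF multiset.inj_map[OF inj_hmon]] by blast
    have "lookup (\<beta> t') (?us, map (hmon (N - 1)) as, map (hmon ?e) bs) = (if t' = t then 1 else 0)" for t'
      by (cases t') (auto simp: \<beta>_def lookup_tensor lookup_monomial_sym basis_vec_def ab inj AB)
    then have "lookup (\<Sum>t\<in>T. cmul (c t) (\<beta> t)) (?us, map (hmon (N - 1)) as, map (hmon ?e) bs) = c t"
      using finT t by (simp add: lookup_sum mult_if)
    then show "c t = 0"
      by (simp add: 0)
  qed
  note indep = independent_image[where f = "\<lambda>t. \<phi> (\<beta> t)" and T = T, OF finT coeff]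
  let ?\<Phi> = "(\<lambda>t. \<phi> (\<beta> t)) ` T"
  \<comment> \<open>The dimension count: the image contains at least as many independent vectors as
    the Weyl module has generators.\<close>
  have "vecs W = fspace.span ?\<Phi>"
    unfolding W_eq
  proof (rule span_eq_if_independent)
    show "fspace.independent ?\<Phi>"
      by (rule indep(2))
    show "?\<Phi> \<subseteq> fspace.span (F_Delta (\<lambda>i. pX ^ (d - i) * pY ^ i) ` hook_ssyt M N d)"
      using into \<beta>V W_eq by auto
    have "card (F_Delta (\<lambda>i. pX ^ (d - i) * pY ^ i :: _ \<Rightarrow>\<^sub>0 'f) ` hook_ssyt M N d) \<le> card (hook_ssyt M N d)"
      by (rule card_image_le[OF finite_hook_ssyt])
    also have "\<dots> \<le> ((M + N - 1) choose M) * ((d + M + 1) choose (M + N))"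
      by (rule card_hook_ssyt_le[OF assms(1)])
    also have "\<dots> = card T"
    proof -
      have "card {..N - 1} + M - 1 = M + N - 1" "card {..?e} + (N + M) - 1 = d + M + 1" "N + M = M + N"
        using assms by simp_all
      then show ?thesis
        by (simp only: T_def card_cartesian_product card_multisets_of_size finite_atMost)
    qed
    also have "\<dots> = card ?\<Phi>"
      by (rule card_image[OF indep(1), symmetric])
    finally show "card (F_Delta (\<lambda>i. pX ^ (d - i) * pY ^ i :: _ \<Rightarrow>\<^sub>0 'f) ` hook_ssyt M N d) \<le> card ?\<Phi>" .
  qed (simp add: finite_hook_ssyt)
  also have "\<dots> \<subseteq> \<phi> ` vecs V"
    using \<beta>V \<phi>.subspace_image[OF linear_repD(1)[OF V]] by (intro fspace.span_minimal) auto
  finally have image: "\<phi> ` vecs V = vecs W"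
    using into by auto
  have "inj_on \<phi> (vecs V)"
  proof (rule inj_onI)
    fix x y assume "x \<in> vecs V" "y \<in> vecs V" "\<phi> x = \<phi> y"
    then have "x - y = 0"
      using linear_repD(1)[OF V] by (intro ker) (auto simp: \<phi>.diff fspace.subspace_diff)
    then show "x = y"
      by simp
  qed
  with image have bij: "bij_betw \<phi> (vecs V) (vecs W)"
    by (simp add: bij_betw_def)
  \<comment> \<open>Every element of the Weyl module is an image under \<open>\<phi>\<close>, so
    stability and the action laws carry over from the source.\<close>
  have W: "linear_rep GL2 W"
  proof (rule linear_repI)
    show "fspace.subspace (vecs W)"
      unfolding W_eq by (rule fspace.subspace_span)
    show "Vector_Spaces.linear cmul cmul (act W g)" for g
      by (simp add: W_def hook_weyl_upper_sym_def hook_weyl_def tensor_rep_def linear_tensor_map)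
    show "act W g w \<in> vecs W" if g: "g \<in> carrier GL2" and w: "w \<in> vecs W" for g w
    proof -
      obtain v where v: "v \<in> vecs V" "w = \<phi> v"
        using w image by auto
      then show ?thesis
        using equiv[OF g v(1)] into linear_repD(3)[OF V g v(1)] by metis
    qed
    show "act W \<one>\<^bsub>GL2\<^esub> w = w" if w: "w \<in> vecs W" for w
    proof -
      obtain v where v: "v \<in> vecs V" "w = \<phi> v"
        using w image by auto
      then show ?thesis
        using equiv[OF monoid.one_closed[OF monoid_GL2] v(1)] linear_repD(4)[OF V v(1)] by simp
    qed
    show "act W (g \<otimes>\<^bsub>GL2\<^esub> h) w = act W g (act W h w)"
      if g: "g \<in> carrier GL2" and h: "h \<in> carrier GL2" and w: "w \<in> vecs W" for g h w
    proof -
      obtain v where v: "v \<in> vecs V" "w = \<phi> v"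
        using w image by auto
      have "act W (g \<otimes>\<^bsub>GL2\<^esub> h) w = \<phi> (act V g (act V h v))"
        using equiv[OF monoid.m_closed[OF monoid_GL2 g h] v(1)] linear_repD(5)[OF V g h v(1)] v(2) by simp
      also have "\<dots> = act W g (act W h w)"
        using equiv[OF g linear_repD(3)[OF V h v(1)]] equiv[OF h v(1)] v(2) by simp
      finally show ?thesis .
    qed
  qed
  have "rep_isomorphic GL2 V W"
    unfolding rep_isomorphic_def
    using V W bij equiv linear_on_vecs_if_linear[OF \<phi>.linear_axioms] unfolding linear_rep_def by blast
  then show ?thesis
    by (simp only: V_def W_def add.commute[of M N])
qed

end
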